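(* Let $T_{k,j}$ ($k\ge1$, $1\le j\le n_k$) be real $d\times d$ matrices satisfying the standing assumption $0<\alpha_-\le\alpha_+<1$ (see context), and let $\Gamma=\{a_1,\dots,a_\tau\}$ be a finite collection of translations, where $a_1,\dots,a_\tau$ are regarded as variables in $\mathbb{R}^d$ and $\mathbf a=(a_1,\dots,a_\tau)\in\mathbb{R}^{\tau d}$. Let $E^{\mathbf a}$ be the non-autonomous affine set whose translations $\omega_{\mathbf u}$ ($\mathbf u\in\Sigma^*\setminus\{\emptyset\}$) are all chosen from $\Gamma$ (see context). Suppose that $$\sup\{\|T_{k,j}\|:0<j\le n_k,\ k>0\}<\tfrac12.$$ Then, with $s_A=\inf\{s\ge0:\mathcal{M}^s(\Sigma^\infty)=0\}$, for $\mathcal{L}^{\tau d}$-almost all $\mathbf a\in\mathbb{R}^{\tau d}$: (1) $\dim_{\rm H}E^{\mathbf a}=s_A$ if $s_A\le d$; (2) $\mathcal{L}^d(E^{\mathbf a})>0$ if $s_A>d$.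
   Context: Let $\{n_k\}_{k\ge1}$ be integers with $n_k\ge2$. Put $\Sigma^k=\{u_1\cdots u_k:1\le u_j\le n_j\}$, $\Sigma^0=\{\emptyset\}$, $\Sigma^*=\bigcup_{k\ge0}\Sigma^k$, and $\Sigma^\infty=\{u_1u_2\cdots:1\le u_k\le n_k\}$. For $\mathbf u\in\Sigma^*$, $\mathcal{C}_{\mathbf u}\subset\Sigma^\infty$ is the cylinder of infinite words beginning with $\mathbf u$, and $|\mathbf u|$ is the length of $\mathbf u$; for an infinite word $\mathbf u$, $\mathbf u|k=u_1\cdots u_k$. For $\mathbf u=u_1\cdots u_k$ write $T_{\mathbf u}=T_{1,u_1}\cdots T_{k,u_k}$ ($T_\emptyset$ is the identity). The set $E^{\mathbf a}$: to each $\mathbf u\in\Sigma^*\setminus\{\emptyset\}$ is assigned a fixed index in $\{1,\dots,\tau\}$, and $\omega_{\mathbf u}\in\Gamma$ is the translation $a_i$ with that index $i$. The associated affine maps are $\Psi_{u_j}(x)=T_{j,u_j}x+\omega_{u_1\cdots u_j}$, with basic sets $J_{\mathbf u}=\Psi_{u_1}\circ\cdots\circ\Psi_{u_k}(J)$ for $\mathbf u=u_1\cdots u_k$, $J$ compact with non-empty interior. The attractor is $E^{\mathbf a}=\Pi^{\mathbf a}(\Sigma^\infty)$, where $$\Pi^{\mathbf a}(\mathbf u)=\omega_{u_1}+T_{1,u_1}\omega_{u_1u_2}+\cdots+T_{\mathbf u|k}\,\omega_{\mathbf u|k+1}+\cdots .$$ Singular values of a matrix $T$ are $\alpha_1(T)\ge\dots\ge\alpha_d(T)$.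 Standing assumption: all $T_{k,i}$ are nonsingular and $0<\alpha_-\le\alpha_+<1$, where $\alpha_+=\sup_{k,i}\alpha_1(T_{k,i})$, $\alpha_-=\inf_{k,i}\alpha_d(T_{k,i})$. Singular value function: for $0<s\le d$, $\phi^s(T)=\alpha_1(T)\cdots\alpha_{m-1}(T)\alpha_m(T)^{s-m+1}$ with $m$ the integer such that $m-1<s\le m$; $\phi^0(T)=1$; for $s>d$, $\phi^s(T)=(\alpha_1(T)\cdots\alpha_d(T))^{s/d}$. For $s\ge0$, $G\subset\Sigma^\infty$ and $k\ge1$, $\mathcal{M}^s_{(k)}(G)=\inf\{\sum_{\mathbf u}\phi^s(T_{\mathbf u}):G\subset\bigcup_{\mathbf u}\mathcal{C}_{\mathbf u},\ |\mathbf u|\ge k\}$ (infimum over covers of $G$ by cylinders of words of length at least $k$), and $\mathcal{M}^s(G)=\lim_{k\to\infty}\mathcal{M}^s_{(k)}(G)$. One has $s_A=\inf\{s:\mathcal{M}^s(\Sigma^\infty)=0\}=\sup\{s:\mathcal{M}^s(\Sigma^\infty)=\infty\}$. $\mathcal{L}^n$ is $n$-dimensional Lebesgue measure and $\dim_{\rm H}$ is Hausdorff dimension.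
   Formalization: Added hypothesis: for each word u the translations ω_{u1},…,ω_{un_k} are pairwise different variables among a_1,…,a_τ; without it the claim fails (d=1, n_k=2, all T=1/3, one common translation: E^a is a single point although s_A=log 2/log 3). *)

theory Defs
  imports "HOL-Analysis.Analysis"
begin

section \<open>Hausdorff measure and dimension\<close>

text \<open>The empty set gets weight \<open>0\<close>; the case \<open>s = 0\<close> is treated separately because
  \<open>0 powr 0 = 0\<close>, whereas a non-empty set must have weight \<open>1\<close> in dimension \<open>0\<close>.\<close>

definition diam_weight :: "real \<Rightarrow> 'a::metric_space set \<Rightarrow> ennreal" where
  "diam_weight s U = (if U = {} then 0 else if s = 0 then 1 else ennreal (diameter U powr s))"

text \<open>Covers are sequences, so finite covers are padded with empty sets.  Boundedness is
  demanded since \<open>diameter\<close> is only meaningful for bounded sets.\<close>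

definition hausdorff_pre :: "real \<Rightarrow> real \<Rightarrow> 'a::metric_space set \<Rightarrow> ennreal" where
  "hausdorff_pre s \<delta> E =
     (INF U \<in> {U :: nat \<Rightarrow> 'a set. E \<subseteq> (\<Union>i. U i) \<and> (\<forall>i. bounded (U i) \<and> diameter (U i) \<le> \<delta>)}.
        \<Sum>i. diam_weight s (U i))"

definition hausdorff_measure :: "real \<Rightarrow> 'a::metric_space set \<Rightarrow> ennreal" where
  "hausdorff_measure s E = (SUP \<delta> \<in> {0<..}. hausdorff_pre s \<delta> E)"

definition hausdorff_dim :: "'a::metric_space set \<Rightarrow> ereal" where
  "hausdorff_dim E = (INF s \<in> {s. 0 \<le> s \<and> hausdorff_measure s E = 0}. ereal s)"

section \<open>Singular values and the singular value function\<close>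

text \<open>The singular values are the non-negative square roots of the eigenvalues of
  \<open>T\<^sup>t T\<close>, listed in decreasing order and repeated according to multiplicity, i.e. their squares
  are the roots of its characteristic polynomial.\<close>

definition singular_values :: "real^'d^'d \<Rightarrow> real list" where
  "singular_values T =
     (THE xs. length xs = CARD('d) \<and> sorted_wrt (\<ge>) xs \<and> (\<forall>x\<in>set xs. 0 \<le> x) \<and>
        (\<forall>z. det (mat z - transpose T ** T) = (\<Prod>x\<leftarrow>xs. z - x\<^sup>2)))"

text \<open>\<open>\<alpha>\<^sub>1(T) \<ge> \<dots> \<ge> \<alpha>\<^sub>d(T)\<close>: the index runs from \<open>1\<close> to \<open>d\<close>.\<close>

definition sing_val :: "nat \<Rightarrow> real^'d^'d \<Rightarrow> real" where
  "sing_val i T = singular_values T ! (i - 1)"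

definition sv_fun :: "real \<Rightarrow> real^'d^'d \<Rightarrow> real" where
  "sv_fun s T =
     (if s = 0 then 1
      else if s \<le> real CARD('d) then
        (let m = nat \<lceil>s\<rceil> in
          (\<Prod>i = 1..m - 1. sing_val i T) * sing_val m T powr (s - real m + 1))
      else (\<Prod>i = 1..CARD('d). sing_val i T) powr (s / real CARD('d)))"

section \<open>Words and cylinders\<close>

text \<open>Letters of the word \<open>u\<close> are counted from \<open>1\<close> in the mathematics and from \<open>0\<close> in lists and
  functions: \<open>u\<^sub>j\<^sub>+\<^sub>1\<close> is \<open>u ! j\<close> (or \<open>w j\<close> for infinite words) and lies in \<open>{1..n (Suc j)}\<close>.\<close>

definition fin_words :: "(nat \<Rightarrow> nat) \<Rightarrow> nat list set" where
  "fin_words n = {u. \<forall>j < length u. u ! j \<in> {1..n (Suc j)}}"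

definition inf_words :: "(nat \<Rightarrow> nat) \<Rightarrow> (nat \<Rightarrow> nat) set" where
  "inf_words n = {w. \<forall>j. w j \<in> {1..n (Suc j)}}"

definition prefix_word :: "(nat \<Rightarrow> nat) \<Rightarrow> nat \<Rightarrow> nat list" where
  "prefix_word w k = map w [0..<k]"

definition cylinder :: "(nat \<Rightarrow> nat) \<Rightarrow> nat list \<Rightarrow> (nat \<Rightarrow> nat) set" where
  "cylinder n u = {w \<in> inf_words n. prefix_word w (length u) = u}"

definition mat_word :: "(nat \<Rightarrow> nat \<Rightarrow> real^'d^'d) \<Rightarrow> nat list \<Rightarrow> real^'d^'d" where
  "mat_word T u = foldr (\<lambda>j A. T (Suc j) (u ! j) ** A) [0..<length u] (mat 1)"

section \<open>The bounds \<open>\<alpha>\<^sub>+\<close> and \<open>\<alpha>\<^sub>-\<close>, the measures \<open>M\<^sup>s\<close> and the exponent \<open>s\<^sub>A\<close>\<close>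

text \<open>The suprema and infima are taken in the extended reals, so that they do not degenerate
  when the family of matrices is unbounded.\<close>

definition letter_idx :: "(nat \<Rightarrow> nat) \<Rightarrow> (nat \<times> nat) set" where
  "letter_idx n = {(k, i). 1 \<le> k \<and> 1 \<le> i \<and> i \<le> n k}"

definition alpha_plus :: "(nat \<Rightarrow> nat) \<Rightarrow> (nat \<Rightarrow> nat \<Rightarrow> real^'d^'d) \<Rightarrow> ereal" where
  "alpha_plus n T = (SUP (k, i) \<in> letter_idx n. ereal (sing_val 1 (T k i)))"

definition alpha_minus :: "(nat \<Rightarrow> nat) \<Rightarrow> (nat \<Rightarrow> nat \<Rightarrow> real^'d^'d) \<Rightarrow> ereal" where
  "alpha_minus n T = (INF (k, i) \<in> letter_idx n. ereal (sing_val CARD('d) (T k i)))"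

text \<open>Since there are only countably many words, covers by cylinders are given by sets of words.\<close>

definition net_pre ::
  "(nat \<Rightarrow> nat) \<Rightarrow> (nat \<Rightarrow> nat \<Rightarrow> real^'d^'d) \<Rightarrow> real \<Rightarrow> nat \<Rightarrow> (nat \<Rightarrow> nat) set \<Rightarrow> ennreal" where
  "net_pre n T s k G =
     (INF C \<in> {C. C \<subseteq> fin_words n \<and> (\<forall>u\<in>C. k \<le> length u) \<and> G \<subseteq> (\<Union>u\<in>C. cylinder n u)}.
        \<Sum>\<^sub>\<infinity>u\<in>C. ennreal (sv_fun s (mat_word T u)))"

definition net_measure ::
  "(nat \<Rightarrow> nat) \<Rightarrow> (nat \<Rightarrow> nat \<Rightarrow> real^'d^'d) \<Rightarrow> real \<Rightarrow> (nat \<Rightarrow> nat) set \<Rightarrow> ennreal" where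
  "net_measure n T s G = lim (\<lambda>k. net_pre n T s k G)"

definition s_A :: "(nat \<Rightarrow> nat) \<Rightarrow> (nat \<Rightarrow> nat \<Rightarrow> real^'d^'d) \<Rightarrow> ereal" where
  "s_A n T = (INF s \<in> {s. 0 \<le> s \<and> net_measure n T s (inf_words n) = 0}. ereal s)"

section \<open>The non-autonomous affine set\<close>

text \<open>\<open>idx u\<close> is the index of the translation attached to the non-empty word \<open>u\<close>, so
  \<open>\<omega>\<^sub>u\<close> is \<open>a $ idx u\<close>.  The value of \<open>idx\<close> at the empty word is never used.\<close>

definition proj_pt ::
  "(nat \<Rightarrow> nat \<Rightarrow> real^'d^'d) \<Rightarrow> (nat list \<Rightarrow> 't) \<Rightarrow> real^'d^'t \<Rightarrow> (nat \<Rightarrow> nat) \<Rightarrow> real^'d" where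
  "proj_pt T idx a w = (\<Sum>k. mat_word T (prefix_word w k) *v (a $ idx (prefix_word w (Suc k))))"

definition affine_set ::
  "(nat \<Rightarrow> nat) \<Rightarrow> (nat \<Rightarrow> nat \<Rightarrow> real^'d^'d) \<Rightarrow> (nat list \<Rightarrow> 't) \<Rightarrow> real^'d^'t \<Rightarrow> (real^'d) set" where
  "affine_set n T idx a = proj_pt T idx a ` inf_words n"

text \<open>Different maps issuing from the same word carry different members of the family
  \<open>a\<^sub>1, \<dots>, a\<^sub>\<tau>\<close> of translation variables.  Without this the translations need not separate anything:
  if \<open>idx\<close> is constant and \<open>T k i\<close> is independent of \<open>k\<close> and \<open>i\<close>, then the affine set is a single
  point, although its exponent \<open>s\<^sub>A\<close> is positive.\<close>

definition separates_siblings :: "(nat \<Rightarrow> nat) \<Rightarrow> (nat list \<Rightarrow> 't) \<Rightarrow> bool" where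
  "separates_siblings n idx \<longleftrightarrow>
     (\<forall>u \<in> fin_words n. inj_on (\<lambda>i. idx (u @ [i])) {1..n (Suc (length u))})"

end

theory Submission
  imports Defs
begin

text \<open>The upper bound is the usual one: the part of the attractor coded by \<open>u\<close> lies in an ellipsoid with
  semi-axes comparable to the singular values of \<open>T\<^sub>u\<close>, and for \<open>m - 1 < s \<le> m\<close> it is covered by boxes of
  diameter comparable to \<open>\<alpha>\<^sub>m(T\<^sub>u)\<close> in number at most a multiple of \<open>\<phi>\<^sup>s(T\<^sub>u) / \<alpha>\<^sub>m(T\<^sub>u)\<^sup>s\<close>.

  For the lower bound let \<open>s < s\<^sub>A\<close>.  Minimal cuts of the tree of words of length at most \<open>k\<close> are bounded
  away from \<open>0\<close>, so a maximal flow gives probability weights on the words of length \<open>k\<close> for which the mass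
  of the descendants of \<open>u\<close> is at most \<open>C \<phi>\<^sup>s(T\<^sub>u)\<close>, with \<open>C\<close> independent of \<open>k\<close>.  If \<open>p\<close> is the common
  prefix of \<open>u\<close> and \<open>v\<close>, the set of bounded \<open>a\<close> for which the points coded by \<open>u\<close> and \<open>v\<close> are within
  distance \<open>r\<close> has measure at most a multiple of \<open>r\<^sup>t / \<phi>\<^sup>t(T\<^sub>p)\<close>, for every \<open>t \<le> d\<close>.  Integrating
  over \<open>a\<close> and using \<open>\<phi>\<^sup>s(T\<^sub>p) \<le> \<eta>\<^bsup>(s - t)|p|\<^esup> \<phi>\<^sup>t(T\<^sub>p)\<close> bounds the mean mass of pairs at distance
  at most \<open>r\<close> by a multiple of \<open>r\<^sup>t\<close>.  By Fatou's lemma almost every \<open>a\<close> then has infinitely many levels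
  of bounded energy.  Working with finite levels only, one passes to the limit by compactness of the attractor:
  for \<open>t < s \<le> d\<close> by the mass distribution principle applied to finite covers by balls, and for \<open>t = d < s\<close> by
  the Cauchy-Schwarz inequality for the densities at scale \<open>r\<close>.\<close>

section \<open>Singular value decomposition\<close>

text \<open>\<open>singular_values\<close> is a definite description, so nothing is known about
  \<open>sing_val\<close> until the eigenvalues of \<open>transpose T ** T\<close> are shown to
  exist and to form a unique ordered list. Afterwards the geometry of \<open>T\<close> enters
  through an orthonormal family \<open>e\<close> that diagonalises \<open>|T z|\<^sup>2\<close>, and
  \<phi> through a product of powers of singular values whose exponents add up to \<open>s\<close>.

  The obstacle in the lower bound is that a measure carried by finitely many points has infinite
  energy for every positive exponent, because of the diagonal. Energies are therefore truncated:
  only scales 2^-j with j at most J are counted, and the word length belonging to J is so large that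
  the diagonal is harmless even at scale 2^-J.

  Exponents are lost twice. Passing from s to t makes the sum over lengths of common prefixes
  geometric; passing from t to a smaller t' makes the weighted sum over scales geometric. For t = d
  the second loss cannot be afforded, and one scale per J has to do; it does, since the density
  argument looks at a single scale.\<close>

lemma symmetric_operator_max_eigenvector:
  fixes f :: "'a::euclidean_space \<Rightarrow> 'a"
  assumes lin: "linear f" and sym: "\<And>x y. f x \<bullet> y = x \<bullet> f y"
    and S: "subspace S" "f ` S \<subseteq> S" and nz: "S \<noteq> {0}"
  obtains x l where "x \<in> S" "norm x = 1" "f x = l *\<^sub>R x" "\<And>y. y \<in> S \<Longrightarrow> f y \<bullet> y \<le> l * (y \<bullet> y)"
proof -
  obtain v where v: "v \<in> S" "v \<noteq> 0" using nz S(1) subspace_0 by blast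
  have "v /\<^sub>R norm v \<in> S \<inter> sphere 0 1" using v S(1) by (simp add: subspace_scale)
  hence ne: "S \<inter> sphere 0 1 \<noteq> {}" by blast
  have cp: "compact (S \<inter> sphere 0 1)"
    by (simp add: closed_Int_compact closed_subspace S)
  have bl: "bounded_linear f" using lin by (simp add: linear_conv_bounded_linear)
  have cont: "continuous_on (S \<inter> sphere 0 1) (\<lambda>x. f x \<bullet> x)"
    by (intro continuous_intros bounded_linear.continuous_on[OF bl])
  obtain x where x: "x \<in> S" "norm x = 1"
    and mx: "\<And>y. y \<in> S \<Longrightarrow> norm y = 1 \<Longrightarrow> f y \<bullet> y \<le> f x \<bullet> x"
    using continuous_attains_sup[OF cp ne cont] by auto
  define l where "l = f x \<bullet> x"
  have le: "f y \<bullet> y \<le> l * (y \<bullet> y)" if "y \<in> S" for y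
  proof (cases "y = 0")
    case True thus ?thesis using linear_0[OF lin] by simp
  next
    case False
    let ?u = "y /\<^sub>R norm y"
    have "f ?u \<bullet> ?u \<le> l" unfolding l_def using mx[of ?u] that False S(1) by (simp add: subspace_scale)
    moreover have "f ?u \<bullet> ?u = (f y \<bullet> y) / (y \<bullet> y)"
    proof -
      have "y \<bullet> y = norm y * norm y" by (simp add: dot_square_norm power2_eq_square)
      thus ?thesis using linear_cmul[OF lin] by (simp add: field_simps)
    qed
    moreover have "0 < y \<bullet> y" using False by simp
    ultimately show ?thesis by (simp add: pos_divide_le_eq)
  qed
  \<comment> \<open>The form \<open>l * (y \<bullet> y) - f y \<bullet> y\<close> is nonnegative on
    \<open>S\<close> and vanishes at \<open>x\<close>. Varying \<open>t\<close> in
    \<open>quad\<close> shows that its polar form against \<open>x\<close> vanishes on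
    \<open>S\<close>, so the residual \<open>l *\<^sub>R x - f x\<close>, itself in
    \<open>S\<close>, is orthogonal to itself.\<close>
  have orth: "(l *\<^sub>R x - f x) \<bullet> y = 0" if y: "y \<in> S" for y
  proof -
    define B where "B = (l *\<^sub>R x - f x) \<bullet> y"
    define g where "g = l * (y \<bullet> y) - f y \<bullet> y"
    have quad: "0 \<le> 2 * t * B + t\<^sup>2 * g" for t
    proof -
      have "x + t *\<^sub>R y \<in> S" using x y S(1) by (simp add: subspace_add subspace_scale)
      from le[OF this]
      have "f x \<bullet> x + t * (f x \<bullet> y) + t * (f y \<bullet> x) + t\<^sup>2 * (f y \<bullet> y)
         \<le> l * (x \<bullet> x + 2 * t * (x \<bullet> y) + t\<^sup>2 * (y \<bullet> y))"
        by (simp add: linear_add[OF lin] linear_cmul[OF lin] inner_simps inner_commute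
            power2_eq_square algebra_simps)
      moreover have "f y \<bullet> x = f x \<bullet> y" using sym[of y x] by (simp add: inner_commute)
      moreover have "x \<bullet> x = 1" using x by (simp add: dot_square_norm)
      ultimately show ?thesis unfolding B_def g_def l_def[symmetric]
        by (simp add: inner_simps algebra_simps)
    qed
    have "B = 0"
    proof (rule ccontr)
      assume B: "B \<noteq> 0"
      \<comment> \<open>For this \<open>t\<close> the linear term wins;
        \<open>\<bar>g\<bar> + 1\<close> stands where the minimiser \<open>- B / g\<close> has
        \<open>g\<close>, since \<open>g\<close> may be 0.\<close>
      have "0 \<le> 2 * (-B/(\<bar>g\<bar>+1)) * B + (-B/(\<bar>g\<bar>+1))\<^sup>2 * g" by (rule quad)
      also have "\<dots> \<le> 2 * (-B/(\<bar>g\<bar>+1)) * B + (-B/(\<bar>g\<bar>+1))\<^sup>2 * (\<bar>g\<bar>+1)"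
        by (intro add_left_mono mult_left_mono) auto
      also have "\<dots> = - (B\<^sup>2/(\<bar>g\<bar>+1))"
      proof -
        have "(-B/c) * 2 * B + (-B/c)\<^sup>2 * c = - (B\<^sup>2/c)" if "c > 0" for c :: real
          using that by (simp add: power2_eq_square field_simps)
        from this[of "\<bar>g\<bar>+1"] show ?thesis by (simp add: mult_ac)
      qed
      also have "\<dots> < 0" using B by simp
      finally show False by simp
    qed
    thus ?thesis by (simp add: B_def)
  qed
  have "l *\<^sub>R x - f x \<in> S" using x S by (auto intro!: subspace_diff subspace_scale)
  from orth[OF this] have "f x = l *\<^sub>R x" by simp
  thus thesis using that x le by blast
qed

text \<open>Split off an eigenvector for the largest eigenvalue and continue in its orthogonal
  complement in \<open>S\<close>, which \<open>f\<close> preserves by symmetry. The maximality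
  inequality bounds all later eigenvalues by the one split off, which gives the decreasing
  order.\<close>

lemma symmetric_operator_orthonormal_eigenvectors:
  fixes f :: "'a::euclidean_space \<Rightarrow> 'a"
  assumes lin: "linear f" and sym: "\<And>x y. f x \<bullet> y = x \<bullet> f y"
  shows "subspace S \<Longrightarrow> f ` S \<subseteq> S \<Longrightarrow> dim S = k \<Longrightarrow>
    \<exists>e l. (\<forall>i<k. e i \<in> S \<and> f (e i) = l i *\<^sub>R e i) \<and>
      (\<forall>i<k. \<forall>j<k. e i \<bullet> e j = (if i = j then 1 else 0)) \<and>
      (\<forall>i j. i \<le> j \<longrightarrow> j < k \<longrightarrow> (l j :: real) \<le> l i)"
proof (induction k arbitrary: S)
  case 0
  thus ?case by simp
next
  case (Suc k)
  have "S \<noteq> {0}" using Suc.prems by auto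
  then obtain x m where x: "x \<in> S" "norm x = 1" "f x = m *\<^sub>R x"
    "\<And>y. y \<in> S \<Longrightarrow> f y \<bullet> y \<le> m * (y \<bullet> y)"
    using symmetric_operator_max_eigenvector[OF lin sym Suc.prems(1,2)] by blast
  define S' where "S' = {y \<in> S. \<forall>z\<in>span {x}. orthogonal z y}"
  have S'_iff: "y \<in> S' \<longleftrightarrow> y \<in> S \<and> x \<bullet> y = 0" for y
    unfolding S'_def by (auto simp: span_singleton orthogonal_def)
  have "dim S' + dim (span {x}) = dim S" unfolding S'_def
    using span_minimal[of "{x}" S] Suc.prems(1) x(1)
    by (intro dim_subspace_orthogonal_to_vectors) auto
  moreover have "dim (span {x}) = 1"
  proof -
    have "x \<noteq> 0" using x by auto
    hence "independent {x}" by simp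
    thus ?thesis using dim_eq_card_independent[of "{x}"] by simp
  qed
  ultimately have dimS': "dim S' = k" using Suc.prems by simp
  have subS': "subspace S'"
    using Suc.prems(1) unfolding subspace_def by (simp add: S'_iff inner_simps)
  have invS': "f ` S' \<subseteq> S'"
  proof
    fix z assume "z \<in> f ` S'"
    then obtain y where y: "y \<in> S'" "z = f y" by auto
    have "x \<bullet> f y = f x \<bullet> y" using sym[of x y] by simp
    thus "z \<in> S'" using y x Suc.prems(2) by (auto simp: S'_iff)
  qed
  obtain e l where e: "\<forall>i<k. e i \<in> S' \<and> f (e i) = l i *\<^sub>R e i"
      "\<forall>i<k. \<forall>j<k. e i \<bullet> e j = (if i = j then 1 else 0)"
      "\<forall>i j. i \<le> j \<longrightarrow> j < k \<longrightarrow> (l j :: real) \<le> l i"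
    using Suc.IH[OF subS' invS' dimS'] by blast
  have lm: "l j \<le> m" if "j < k" for j
  proof -
    have "f (e j) \<bullet> e j \<le> m * (e j \<bullet> e j)" using e(1) that x(4) S'_iff by blast
    thus ?thesis using e that by simp
  qed
  show ?case
    apply (rule exI[of _ "case_nat x e"], rule exI[of _ "case_nat m l"])
    using x e lm by (auto simp: S'_iff norm_eq_1 inner_commute split: nat.splits)
qed

lemma orthonormal_expansion:
  fixes e :: "nat \<Rightarrow> 'a::euclidean_space"
  assumes on: "\<And>i j. i < DIM('a) \<Longrightarrow> j < DIM('a) \<Longrightarrow> e i \<bullet> e j = (if i = j then 1 else 0)"
  shows "z = (\<Sum>i<DIM('a). (z \<bullet> e i) *\<^sub>R e i)"
proof -
  let ?B = "e ` {..<DIM('a)}"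
  have inj: "inj_on e {..<DIM('a)}"
    by (rule inj_onI) (metis lessThan_iff on zero_neq_one)
  have "0 \<notin> ?B" using on by (metis imageE inner_zero_left lessThan_iff zero_neq_one)
  moreover have "pairwise orthogonal ?B"
    using on inj by (auto simp: pairwise_def orthogonal_def)
  ultimately have ind: "independent ?B" by (rule pairwise_orthogonal_independent[rotated])
  have "card ?B = DIM('a)" using inj by (simp add: card_image)
  hence "dim ?B = DIM('a)" using ind by (simp add: dim_eq_card_independent)
  hence sp: "span ?B = UNIV" by (simp add: dim_eq_full)
  define w where "w = z - (\<Sum>i<DIM('a). (z \<bullet> e i) *\<^sub>R e i)"
  have "w \<bullet> e j = 0" if "j < DIM('a)" for j
  proof -
    have "(\<Sum>i<DIM('a). (z \<bullet> e i) *\<^sub>R e i) \<bullet> e j = (\<Sum>i<DIM('a). if i = j then z \<bullet> e i else 0)"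
      unfolding inner_sum_left using that by (intro sum.cong) (auto simp: on)
    thus ?thesis using that by (simp add: w_def inner_diff_left)
  qed
  hence "orthogonal w y" if "y \<in> span ?B" for y
    by (intro orthogonal_to_span[OF that]) (auto simp: orthogonal_def)
  hence "orthogonal w w" using sp by blast
  thus ?thesis by (simp add: w_def orthogonal_def)
qed

lemma orthonormal_norm:
  fixes e :: "nat \<Rightarrow> 'a::euclidean_space"
  assumes on: "\<And>i j. i < DIM('a) \<Longrightarrow> j < DIM('a) \<Longrightarrow> e i \<bullet> e j = (if i = j then 1 else 0)"
  shows "(norm z)\<^sup>2 = (\<Sum>i<DIM('a). (z \<bullet> e i)\<^sup>2)"
proof -
  have "(norm z)\<^sup>2 = z \<bullet> (\<Sum>i<DIM('a). (z \<bullet> e i) *\<^sub>R e i)"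
    using orthonormal_expansion[OF on, of z] by (metis dot_square_norm)
  thus ?thesis by (simp add: inner_sum_right power2_eq_square)
qed

section \<open>Characteristic polynomials and existence of singular values\<close>

text \<open>The square of the head of one list is a root of the other product, so this head is at
  most the other head; by symmetry the heads agree. Their common factor is cancelled between
  polynomials, since as functions the two sides cannot be divided at its zero.\<close>

lemma sorted_roots_unique:
  fixes xs ys :: "real list"
  assumes "length xs = length ys" "sorted_wrt (\<ge>) xs" "sorted_wrt (\<ge>) ys"
    "\<forall>x\<in>set xs. 0 \<le> x" "\<forall>x\<in>set ys. 0 \<le> x"
    "\<And>z. (\<Prod>x\<leftarrow>xs. z - x\<^sup>2) = (\<Prod>x\<leftarrow>ys. z - x\<^sup>2)"
  shows "xs = ys"
  using assms
proof (induction xs ys rule: list_induct2)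
  case (Cons x xs y ys)
  have *: "a \<le> b" if h: "sorted_wrt (\<ge>) (b # bs)" "(\<forall>x\<in>set (b#bs). 0 \<le> x) \<and> 0 \<le> a"
    "(\<Prod>x\<leftarrow>b # bs. a\<^sup>2 - x\<^sup>2) = 0" for a b :: real and bs
  proof -
    have "0 \<in> set (map (\<lambda>x. a\<^sup>2 - x\<^sup>2) (b # bs))" using h(3) unfolding prod_list_zero_iff .
    then obtain c where "c \<in> set (b # bs)" "a\<^sup>2 - c\<^sup>2 = 0"
      unfolding set_map image_iff by metis
    hence "a = c" "c \<le> b" using h by (auto simp: power2_eq_iff)
    thus ?thesis by simp
  qed
  have "x \<le> y" using Cons.prems(5)[of "x\<^sup>2"] by (intro *[of y ys]) (use Cons.prems in auto)
  moreover have "y \<le> x" using Cons.prems(5)[of "y\<^sup>2"] by (intro *[of x xs]) (use Cons.prems in auto)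
  ultimately have xy: "x = y" by simp
  have pl: "(\<Prod>x\<leftarrow>l. z - x\<^sup>2) = poly (\<Prod>x\<leftarrow>l. [:-(x\<^sup>2), 1:]) z" for l and z :: real
    by (induction l) (auto simp: left_diff_distrib)
  have "[:-(x\<^sup>2), 1:] * (\<Prod>x\<leftarrow>xs. [:-(x\<^sup>2), 1:]) = [:-(x\<^sup>2), 1:] * (\<Prod>x\<leftarrow>ys. [:-(x\<^sup>2), 1:])"
  proof (rule poly_eq_poly_eq_iff[THEN iffD1], rule ext)
    fix z show "poly ([:-(x\<^sup>2), 1:] * (\<Prod>x\<leftarrow>xs. [:-(x\<^sup>2), 1:])) z = poly ([:-(x\<^sup>2), 1:] * (\<Prod>x\<leftarrow>ys. [:-(x\<^sup>2), 1:])) z"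
    proof -
      have q: "poly [:-(x\<^sup>2), 1:] z = z - x\<^sup>2" by simp
      show ?thesis using Cons.prems(5)[of z] xy
        unfolding poly_mult q pl[symmetric] list.map prod_list.Cons by simp
    qed
  qed
  moreover have "[:-(x\<^sup>2), 1:] \<noteq> 0" by simp
  ultimately have "(\<Prod>x\<leftarrow>xs. [:-(x\<^sup>2), 1:]) = (\<Prod>x\<leftarrow>ys. [:-(x\<^sup>2), 1:])"
    by (metis mult_left_cancel)
  hence "xs = ys" by (intro Cons.IH) (use Cons.prems in \<open>auto simp: pl\<close>)
  thus ?case using xy by simp
qed simp

text \<open>Let \<open>Q\<close> have the eigenvectors as columns. Then
  \<open>(mat z - A) ** Q = Q ** D\<close> with \<open>D\<close> diagonal, and orthonormality makes
  \<open>det Q\<close> nonzero, so it cancels. The bijection \<open>b\<close> moves the family from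
  natural numbers to the index type.\<close>

lemma det_symmetric_eigenbasis:
  fixes A :: "real^'d^'d"
  assumes e: "\<And>i. i < CARD('d) \<Longrightarrow> A *v e i = l i *\<^sub>R e i"
    and on: "\<And>i j. i < CARD('d) \<Longrightarrow> j < CARD('d) \<Longrightarrow> e i \<bullet> e j = (if i = j then 1 else 0)"
  shows "det (mat z - A) = (\<Prod>i<CARD('d). z - l i)"
proof -
  obtain b where b: "bij_betw b (UNIV :: 'd set) {..<CARD('d)}"
    using ex_bij_betw_finite_nat[of "UNIV :: 'd set"] by (auto simp: atLeast0LessThan)
  have bl: "b i < CARD('d)" for i using b by (auto simp: bij_betw_def)
  have binj: "b i = b j \<longleftrightarrow> i = j" for i j using b by (auto simp: bij_betw_def inj_on_def)
  define Q :: "real^'d^'d" where "Q = (\<chi> i j. e (b j) $ i)"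
  define D :: "real^'d^'d" where "D = (\<chi> i j. if i = j then z - l (b i) else 0)"
  have on': "(\<Sum>k\<in>UNIV. e (b i) $ k * e (b j) $ k) = (if i = j then 1 else 0)" for i j
    using on[OF bl bl, of i j] by (simp add: inner_vec_def binj)
  have "(transpose Q ** Q) = mat 1"
    by (simp add: vec_eq_iff matrix_matrix_mult_def transpose_def Q_def mat_def on')
  hence "det Q * det Q = 1" by (metis det_I det_mul det_transpose)
  hence nz: "det Q \<noteq> 0" by auto
  have Ae: "(\<Sum>k\<in>UNIV. A $ i $ k * e (b j) $ k) = l (b j) * e (b j) $ i" for i j
    using e[OF bl, of j] by (simp add: vec_eq_iff matrix_vector_mult_def)
  have "(mat z - A) ** Q = Q ** D"
  proof -
    have "((mat z - A) ** Q) $ i $ j = (Q ** D) $ i $ j" for i j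
    proof -
      have "((mat z - A) ** Q) $ i $ j = (\<Sum>k\<in>UNIV. (if i = k then z * e (b j) $ k else 0)) - (\<Sum>k\<in>UNIV. A $ i $ k * e (b j) $ k)"
        unfolding sum_subtractf[symmetric]
        unfolding matrix_matrix_mult_def Q_def mat_def vec_lambda_beta
        by (intro sum.cong) (auto simp: left_diff_distrib)
      also have "\<dots> = z * e (b j) $ i - l (b j) * e (b j) $ i" by (simp add: Ae)
      also have "\<dots> = (\<Sum>k\<in>UNIV. (if k = j then e (b j) $ i * (z - l (b j)) else 0))" by (simp add: algebra_simps)
      also have "\<dots> = (Q ** D) $ i $ j"
        unfolding matrix_matrix_mult_def Q_def D_def vec_lambda_beta by (intro sum.cong) auto
      finally show ?thesis .
    qed
    thus ?thesis by (simp add: vec_eq_iff)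
  qed
  hence "det (mat z - A) * det Q = det Q * det D" by (metis det_mul)
  hence "det (mat z - A) = det D" using nz by simp
  also have "\<dots> = (\<Prod>i\<in>UNIV. z - l (b i))" unfolding D_def by (subst det_diagonal) auto
  also have "\<dots> = (\<Prod>i<CARD('d). z - l i)" by (rule prod.reindex_bij_betw[OF b])
  finally show ?thesis .
qed

text \<open>Only right singular vectors are produced. The norm identity carries the geometric
  information used later, and it spares the choice of left singular vectors on the part where
  \<open>T\<close> vanishes.\<close>

lemma singular_value_decomposition:
  fixes T :: "real^'d^'d"
  obtains e :: "nat \<Rightarrow> real^'d" where
    "\<And>i j. i < CARD('d) \<Longrightarrow> j < CARD('d) \<Longrightarrow> e i \<bullet> e j = (if i = j then 1 else 0)"
    "\<And>z. (norm (T *v z))\<^sup>2 = (\<Sum>i<CARD('d). (sing_val (Suc i) T)\<^sup>2 * (z \<bullet> e i)\<^sup>2)"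
    "\<And>i. i < CARD('d) \<Longrightarrow> 0 \<le> sing_val (Suc i) T"
    "\<And>i j. i \<le> j \<Longrightarrow> j < CARD('d) \<Longrightarrow> sing_val (Suc j) T \<le> sing_val (Suc i) T"
proof -
  let ?d = "CARD('d)"
  define f where "f x = (transpose T ** T) *v x" for x
  have ff: "f x \<bullet> y = (T *v x) \<bullet> (T *v y)" for x y
    unfolding f_def by (simp add: matrix_vector_mul_assoc[symmetric] dot_lmul_matrix[symmetric])
  have lin: "linear f" unfolding f_def by (rule matrix_vector_mul_linear)
  have sym: "f x \<bullet> y = x \<bullet> f y" for x y
    using ff[of x y] ff[of y x] by (simp add: inner_commute)
  obtain e l where e: "\<forall>i<?d. f (e i) = l i *\<^sub>R e i"
      "\<forall>i<?d. \<forall>j<?d. e i \<bullet> e j = (if i = j then 1 else 0)"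
      "\<forall>i j. i \<le> j \<longrightarrow> j < ?d \<longrightarrow> (l j :: real) \<le> l i"
    using symmetric_operator_orthonormal_eigenvectors[OF lin sym, of UNIV ?d] by auto
  have l_nn: "0 \<le> l i" if "i < ?d" for i
  proof -
    have "l i = f (e i) \<bullet> e i" using e that by simp
    thus ?thesis by (simp add: ff)
  qed
  define xs where "xs = map (\<lambda>i. sqrt (l i)) [0..<?d]"
  have "singular_values T = xs" unfolding singular_values_def
  proof (rule the_equality)
    have pl: "(\<Prod>x\<leftarrow>xs. z - x\<^sup>2) = (\<Prod>i<?d. z - l i)" for z
    proof -
      have "(\<Prod>x\<leftarrow>xs. z - x\<^sup>2) = (\<Prod>i\<leftarrow>[0..<?d]. z - (sqrt (l i))\<^sup>2)" by (simp add: xs_def o_def)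
      also have "\<dots> = (\<Prod>i<?d. z - (sqrt (l i))\<^sup>2)"
        by (subst prod.distinct_set_conv_list[symmetric]) (auto simp: atLeast0LessThan)
      finally show ?thesis using l_nn by simp
    qed
    have "det (mat z - transpose T ** T) = (\<Prod>x\<leftarrow>xs. z - x\<^sup>2)" for z
      unfolding pl by (rule det_symmetric_eigenbasis[of _ e]) (use e in \<open>auto simp: f_def\<close>)
    thus P: "length xs = ?d \<and> sorted_wrt (\<ge>) xs \<and> (\<forall>x\<in>set xs. 0 \<le> x) \<and>
        (\<forall>z. det (mat z - transpose T ** T) = (\<Prod>x\<leftarrow>xs. z - x\<^sup>2))"
      using e(3) l_nn by (auto simp: xs_def sorted_wrt_iff_nth_less)
    fix ys assume "length ys = ?d \<and> sorted_wrt (\<ge>) ys \<and> (\<forall>x\<in>set ys. 0 \<le> x) \<and>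
        (\<forall>z. det (mat z - transpose T ** T) = (\<Prod>x\<leftarrow>ys. z - x\<^sup>2))"
    with P show "ys = xs" by (intro sorted_roots_unique) auto
  qed
  hence sv: "sing_val (Suc i) T = sqrt (l i)" if "i < ?d" for i
    using that by (simp add: sing_val_def xs_def)
  show thesis
  proof (rule that[of e])
    show "e i \<bullet> e j = (if i = j then 1 else 0)" if "i < ?d" "j < ?d" for i j using e that by blast
    hence ex: "z = (\<Sum>i<?d. (z \<bullet> e i) *\<^sub>R e i)" for z using orthonormal_expansion[of e z] by simp
    show "(norm (T *v z))\<^sup>2 = (\<Sum>i<?d. (sing_val (Suc i) T)\<^sup>2 * (z \<bullet> e i)\<^sup>2)" for z
    proof -
      have "(norm (T *v z))\<^sup>2 = f z \<bullet> z" by (simp add: ff dot_square_norm)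
      also have "f z = (\<Sum>i<?d. (z \<bullet> e i) *\<^sub>R f (e i))"
        by (subst ex[of z]) (simp add: linear_sum[OF lin] linear_cmul[OF lin])
      also have "\<dots> \<bullet> z = (\<Sum>i<?d. l i * (z \<bullet> e i)\<^sup>2)"
        unfolding inner_sum_left using e by (intro sum.cong) (auto simp: power2_eq_square inner_commute)
      also have "\<dots> = (\<Sum>i<?d. (sing_val (Suc i) T)\<^sup>2 * (z \<bullet> e i)\<^sup>2)"
        using l_nn by (intro sum.cong) (auto simp: sv)
      finally show ?thesis .
    qed
    show "0 \<le> sing_val (Suc i) T" if "i < ?d" for i using that l_nn by (simp add: sv)
    show "sing_val (Suc j) T \<le> sing_val (Suc i) T" if "i \<le> j" "j < ?d" for i j
      using that e(3) by (simp add: sv)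
  qed
qed

section \<open>Bounds for single singular values\<close>

lemma sing_val_attained:
  fixes T :: "real^'d^'d"
  assumes "i < CARD('d)"
  obtains z where "norm z = 1" "norm (T *v z) = sing_val (Suc i) T"
proof -
  obtain e where e: "\<And>i j. i < CARD('d) \<Longrightarrow> j < CARD('d) \<Longrightarrow> e i \<bullet> e j = (if i = j then 1 else 0)"
    "\<And>z. (norm (T *v z))\<^sup>2 = (\<Sum>i<CARD('d). (sing_val (Suc i) T)\<^sup>2 * (z \<bullet> e i)\<^sup>2)"
    "\<And>i. i < CARD('d) \<Longrightarrow> 0 \<le> sing_val (Suc i) T"
    by (rule singular_value_decomposition[of T]) blast
  have "(norm (T *v e i))\<^sup>2 = (\<Sum>j<CARD('d). if j = i then (sing_val (Suc i) T)\<^sup>2 else 0)"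
    unfolding e(2) using assms by (intro sum.cong) (auto simp: e(1))
  hence "(norm (T *v e i))\<^sup>2 = (sing_val (Suc i) T)\<^sup>2" using assms by simp
  hence "norm (T *v e i) = sing_val (Suc i) T" using e(3)[OF assms] by (simp add: power2_eq_iff_nonneg)
  moreover have "norm (e i) = 1" using e(1)[OF assms assms] by (simp add: norm_eq_1)
  ultimately show thesis using that by blast
qed

lemma sing_val_le_onorm:
  assumes "i < CARD('d)" shows "sing_val (Suc i) (T :: real^'d^'d) \<le> onorm ((*v) T)"
proof -
  obtain z where z: "norm z = 1" "norm (T *v z) = sing_val (Suc i) T"
    using sing_val_attained[OF assms] .
  show ?thesis using onorm[OF matrix_vector_mul_bounded_linear[of T], of z] z by simp
qed

lemma sing_val_pos:
  fixes T :: "real^'d^'d"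
  assumes "invertible T" "i < CARD('d)"
  shows "0 < sing_val (Suc i) T"
proof -
  obtain z where z: "norm z = 1" "norm (T *v z) = sing_val (Suc i) T"
    using sing_val_attained[OF assms(2)] .
  have "T *v z \<noteq> 0" using z(1) assms(1)
    by (metis invertible_def matrix_vector_mul_assoc matrix_vector_mul_lid matrix_vector_mult_0_right norm_zero zero_neq_one)
  thus ?thesis using z by (metis zero_less_norm_iff)
qed

section \<open>Singular value function, covers and Hausdorff measure\<close>

text \<open>The exponent of the singular value number \<open>i + 1\<close> in \<phi>: for
  \<open>s \<le> d\<close> a run of ones, one fractional exponent, then zeros; beyond
  \<open>d\<close> the constant \<open>s / d\<close>. The exponents add up to \<open>s\<close> and
  each is monotone in \<open>s\<close>, so inequalities between values of \<phi> can be checked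
  factor by factor.\<close>

definition sv_exp :: "nat \<Rightarrow> real \<Rightarrow> nat \<Rightarrow> real" where
  "sv_exp d s i = (if s \<le> real d then max 0 (min 1 (s - real i)) else s / real d)"

lemma sum_sv_exp:
  assumes "0 \<le> s" "0 < d"
  shows "(\<Sum>i<d. sv_exp d s i) = s"
proof (cases "s \<le> real d")
  case True
  have "(\<Sum>i<m. max 0 (min 1 (s - real i))) = min s (real m)" for m
    by (induction m) (use assms in auto)
  thus ?thesis using True by (simp add: sv_exp_def)
qed (use assms in \<open>simp add: sv_exp_def\<close>)

lemma sv_exp_mono: "t \<le> s \<Longrightarrow> i < d \<Longrightarrow> sv_exp d t i \<le> sv_exp d s i"
proof -
  assume ts: "t \<le> s" and i: "i < d"
  show ?thesis
  proof (cases "t \<le> real d \<and> \<not> s \<le> real d")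
    case True
    have "max 0 (min 1 (t - real i)) \<le> 1" by simp
    also have "1 \<le> s / real d" using True i by (simp add: field_simps)
    finally show ?thesis using True by (simp add: sv_exp_def)
  qed (use ts in \<open>auto simp: sv_exp_def divide_right_mono\<close>)
qed

lemma sv_exp_bounds: "s \<le> real d \<Longrightarrow> 0 \<le> sv_exp d s i \<and> sv_exp d s i \<le> 1"
  by (auto simp: sv_exp_def)

text \<open>Positivity of the singular values matters because the factors with exponent 0 have to be
  1, whereas \<open>0 powr 0 = 0\<close>.\<close>

lemma sv_fun_eq_prod:
  fixes T :: "real^'d^'d"
  assumes s: "0 \<le> s" and pos: "\<And>i. i < CARD('d) \<Longrightarrow> 0 < sing_val (Suc i) T"
  shows "sv_fun s T = (\<Prod>i<CARD('d). sing_val (Suc i) T powr sv_exp CARD('d) s i)"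
proof -
  let ?d = "CARD('d)" and ?a = "\<lambda>i. sing_val (Suc i) T"
  consider "s = 0" | "0 < s" "s \<le> real ?d" | "s > real ?d" using s by linarith
  thus ?thesis
  proof cases
    case 1
    have "(\<Prod>i<?d. ?a i powr sv_exp ?d s i) = (\<Prod>i<?d. 1)"
    proof (rule prod.cong)
      fix i assume "i \<in> {..<?d}"
      thus "?a i powr sv_exp ?d s i = 1" using 1 pos[of i] by (simp add: sv_exp_def)
    qed simp
    thus ?thesis using 1 by (simp add: sv_fun_def)
  next
    case 2
    \<comment> \<open>One less than the \<open>m\<close> in \<open>sv_fun\<close>: counted from 0,
      this is the position of the singular value with the fractional exponent.\<close>
    define m where "m = nat \<lceil>s\<rceil> - 1"
    have Sm: "nat \<lceil>s\<rceil> = Suc m" using 2 unfolding m_def by linarith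
    have m: "real m < s" "s \<le> real m + 1" "m < ?d" using 2 Sm by linarith+
    have split: "{..<?d} = {..<m} \<union> {m} \<union> {Suc m..<?d}" using m(3) by auto
    have "(\<Prod>i<?d. ?a i powr sv_exp ?d s i)
      = (\<Prod>i<m. ?a i powr sv_exp ?d s i) * (?a m powr sv_exp ?d s m) * (\<Prod>i\<in>{Suc m..<?d}. ?a i powr sv_exp ?d s i)"
      unfolding split by (subst prod.union_disjoint; (subst prod.union_disjoint)?; auto)
    also have "(\<Prod>i<m. ?a i powr sv_exp ?d s i) = (\<Prod>i<m. ?a i)"
    proof (rule prod.cong)
      fix i assume i: "i \<in> {..<m}"
      hence "sv_exp ?d s i = 1" using m 2 by (simp add: sv_exp_def)
      thus "?a i powr sv_exp ?d s i = ?a i" using pos[of i] i m by simp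
    qed simp
    also have "\<dots> = (\<Prod>i = 1..m. sing_val i T)"
      by (rule prod.reindex_bij_witness[of _ "\<lambda>i. i - 1" Suc]) auto
    also have "(\<Prod>i\<in>{Suc m..<?d}. ?a i powr sv_exp ?d s i) = 1"
    proof (rule prod.neutral, rule)
      fix i assume i: "i \<in> {Suc m..<?d}"
      hence "sv_exp ?d s i = 0" using m 2 by (simp add: sv_exp_def)
      thus "?a i powr sv_exp ?d s i = 1" using pos[of i] i by simp
    qed
    also have "sv_exp ?d s m = s - real m" using m 2 by (simp add: sv_exp_def)
    finally show ?thesis using 2 by (simp add: sv_fun_def Let_def Sm)
  next
    case 3
    have "(\<Prod>i = 1..?d. sing_val i T) = (\<Prod>i<?d. ?a i)"
      by (rule prod.reindex_bij_witness[of _ Suc "\<lambda>i. i - 1"]) auto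
    moreover have "s \<noteq> 0" using 3 by (metis of_nat_0_le_iff not_le)
    ultimately show ?thesis using 3 pos
      by (simp add: sv_fun_def sv_exp_def prod_powr_distrib less_imp_le)
  qed
qed

lemma sv_fun_pos:
  fixes T :: "real^'d^'d"
  assumes "0 \<le> s" "invertible T"
  shows "0 < sv_fun s T"
proof -
  note pos = sing_val_pos[OF assms(2)]
  have "0 < (\<Prod>i<CARD('d). sing_val (Suc i) T powr sv_exp CARD('d) s i)"
  proof (rule prod_pos)
    fix i assume "i \<in> {..<CARD('d)}"
    thus "0 < sing_val (Suc i) T powr sv_exp CARD('d) s i" using pos[of i] by simp
  qed
  thus ?thesis using sv_fun_eq_prod[OF assms(1) pos] by simp
qed

text \<open>The exponents for \<open>s\<close> exceed those for \<open>t\<close> by nonnegative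
  amounts of sum \<open>s - t\<close>, and every singular value is at most \<open>b\<close>. For
  words this becomes geometric decay in the length.\<close>

lemma sv_fun_ratio:
  fixes T :: "real^'d^'d"
  assumes t: "0 \<le> t" "t \<le> s" and inv: "invertible T" and T: "onorm ((*v) T) \<le> b" and b: "0 < b"
  shows "sv_fun s T \<le> b powr (s - t) * sv_fun t T"
proof -
  let ?d = "CARD('d)" and ?a = "\<lambda>i. sing_val (Suc i) T"
  have pos: "i < ?d \<Longrightarrow> 0 < ?a i" for i by (rule sing_val_pos[OF inv])
  have s: "0 \<le> s" using t by simp
  have "sv_fun s T = (\<Prod>i<?d. ?a i powr (sv_exp ?d s i - sv_exp ?d t i) * ?a i powr sv_exp ?d t i)"
    by (subst sv_fun_eq_prod[OF s pos]) (auto simp flip: powr_add)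
  also have "\<dots> \<le> (\<Prod>i<?d. b powr (sv_exp ?d s i - sv_exp ?d t i) * ?a i powr sv_exp ?d t i)"
  proof (intro prod_mono conjI mult_right_mono powr_mono2)
    fix i assume "i \<in> {..<?d}"
    hence i: "i < ?d" by simp
    show "0 \<le> sv_exp ?d s i - sv_exp ?d t i" using sv_exp_mono[OF t(2) i] by simp
    show "0 \<le> ?a i" using pos[OF i] by simp
    show "?a i \<le> b" using sing_val_le_onorm[OF i, of T] T by simp
  qed auto
  also have "\<dots> = b powr (\<Sum>i<?d. sv_exp ?d s i - sv_exp ?d t i) * sv_fun t T"
    by (subst sv_fun_eq_prod[OF t(1) pos]) (use b in \<open>auto simp: prod.distrib powr_sum\<close>)
  also have "(\<Sum>i<?d. sv_exp ?d s i - sv_exp ?d t i) = s - t"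
    using s t by (simp add: sum_subtractf sum_sv_exp)
  finally show ?thesis .
qed

text \<open>One has \<open>min 1 x \<le> x powr p\<close> for positive \<open>x\<close> and every
  \<open>p\<close> in [0,1]. Use it with the exponents of \<phi> at \<open>t\<close>; the bound
  \<open>t \<le> d\<close> keeps them in [0,1], and their sum \<open>t\<close> gives the power of
  \<open>r\<close>.\<close>

lemma prod_min_le_powr_div_sv_fun:
  fixes T :: "real^'d^'d"
  assumes t: "0 \<le> t" "t \<le> real CARD('d)" and inv: "invertible T" and r: "0 < r"
  shows "(\<Prod>i<CARD('d). min 1 (r / sing_val (Suc i) T)) \<le> r powr t / sv_fun t T"
proof -
  let ?d = "CARD('d)" and ?a = "\<lambda>i. sing_val (Suc i) T"
  have pos: "i < ?d \<Longrightarrow> 0 < ?a i" for i by (rule sing_val_pos[OF inv])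
  have "(\<Prod>i<?d. min 1 (r / ?a i)) \<le> (\<Prod>i<?d. (r / ?a i) powr sv_exp ?d t i)"
  proof (intro prod_mono conjI)
    fix i assume "i \<in> {..<?d}"
    hence i: "i < ?d" by simp
    have e: "0 \<le> sv_exp ?d t i" "sv_exp ?d t i \<le> 1" using sv_exp_bounds[OF t(2)] by auto
    have x: "0 < r / ?a i" using pos[OF i] r by simp
    thus "0 \<le> min 1 (r / ?a i)" by simp
    show "min 1 (r / ?a i) \<le> (r / ?a i) powr sv_exp ?d t i"
    proof (cases "r / ?a i \<le> 1")
      case True
      have "(r / ?a i) powr 1 \<le> (r / ?a i) powr sv_exp ?d t i"
        by (rule powr_mono') (use True x e in auto)
      thus ?thesis using x True by (simp only: min_absorb2 powr_one less_imp_le)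
    next
      case False
      thus ?thesis using e ge_one_powr_ge_zero[of "r / ?a i" "sv_exp ?d t i"] by simp
    qed
  qed
  also have "\<dots> = (\<Prod>i<?d. r powr sv_exp ?d t i) / (\<Prod>i<?d. ?a i powr sv_exp ?d t i)"
    unfolding prod_dividef[symmetric] using pos r
    by (intro prod.cong) (auto simp: powr_divide less_imp_le)
  also have "(\<Prod>i<?d. r powr sv_exp ?d t i) = r powr t"
    using r sum_sv_exp[OF t(1), of ?d] by (simp flip: powr_sum)
  finally show ?thesis by (simp add: sv_fun_eq_prod[OF t(1) pos])
qed

section \<open>Grids and Hausdorff pre-measures\<close>

text \<open>Cells of a grid anchored at a point of \<open>S\<close>, told apart by the integer parts
  of the rescaled coordinates; each coordinate has at most \<open>2 * L i / h i + 2\<close> of them.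
  Both \<open>h\<close> and \<open>L\<close> depend on the direction since one application varies
  the steps over a ball and another varies the extent of the set with a common step.\<close>

lemma orthonormal_box_cover:
  fixes e :: "nat \<Rightarrow> 'a::euclidean_space" and S :: "'a set"
  assumes h: "\<And>i. i < D \<Longrightarrow> 0 < h i" and L: "\<And>i. i < D \<Longrightarrow> 0 \<le> L i"
    and S: "\<And>x y i. x \<in> S \<Longrightarrow> y \<in> S \<Longrightarrow> i < D \<Longrightarrow> \<bar>(x - y) \<bullet> e i\<bar> \<le> L i"
  obtains F where "finite F" "S \<subseteq> \<Union>F" "real (card F) \<le> (\<Prod>i<D. 2 * L i / h i + 2)"
    "\<And>V x y i. V \<in> F \<Longrightarrow> x \<in> V \<Longrightarrow> y \<in> V \<Longrightarrow> i < D \<Longrightarrow> \<bar>(x - y) \<bullet> e i\<bar> \<le> h i"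
    "\<And>V. V \<in> F \<Longrightarrow> V \<subseteq> S"
proof (cases "S = {}")
  case True
  have "0 \<le> (\<Prod>i<D. 2 * L i / h i + 2)"
    using h L by (intro prod_nonneg) (simp add: less_imp_le)
  thus thesis using True that[of "{}"] by simp
next
  case False
  then obtain x0 where x0: "x0 \<in> S" by blast
  define K where "K = (\<Pi>\<^sub>E i\<in>{..<D}. {\<lfloor>- (L i / h i)\<rfloor>..\<lfloor>L i / h i\<rfloor>})"
  define q where "q x = (\<lambda>i\<in>{..<D}. \<lfloor>((x - x0) \<bullet> e i) / h i\<rfloor>)" for x
  define F where "F = (\<lambda>k. {x\<in>S. q x = k}) ` K"
  have finK: "finite K" unfolding K_def by (intro finite_PiE) auto
  have qK: "q x \<in> K" if x: "x \<in> S" for x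
  proof -
    have "\<lfloor>- (L i / h i)\<rfloor> \<le> \<lfloor>((x - x0) \<bullet> e i) / h i\<rfloor> \<and> \<lfloor>((x - x0) \<bullet> e i) / h i\<rfloor> \<le> \<lfloor>L i / h i\<rfloor>"
      if i: "i < D" for i
    proof -
      have "- L i \<le> (x - x0) \<bullet> e i" "(x - x0) \<bullet> e i \<le> L i" using S[OF x x0 i] by linarith+
      hence "- (L i / h i) \<le> ((x - x0) \<bullet> e i) / h i" "((x - x0) \<bullet> e i) / h i \<le> L i / h i"
        using h[OF i] by (auto simp: field_simps)
      thus ?thesis by (auto intro: floor_mono)
    qed
    thus ?thesis by (auto simp: K_def q_def)
  qed
  show thesis
  proof (rule that[of F])
    show "finite F" using finK by (simp add: F_def)
    show "S \<subseteq> \<Union>F" using qK by (auto simp: F_def)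
    have "card F \<le> card K" unfolding F_def by (rule card_image_le[OF finK])
    also have "card K = (\<Prod>i<D. card {\<lfloor>- (L i / h i)\<rfloor>..\<lfloor>L i / h i\<rfloor>})"
      unfolding K_def by (subst card_PiE) auto
    finally have "real (card F) \<le> (\<Prod>i<D. real (card {\<lfloor>- (L i / h i)\<rfloor>..\<lfloor>L i / h i\<rfloor>}))"
      by (metis of_nat_le_iff of_nat_prod)
    also have "\<dots> \<le> (\<Prod>i<D. 2 * L i / h i + 2)"
    proof (intro prod_mono conjI)
      fix i assume "i \<in> {..<D}"
      hence "0 \<le> L i / h i" using h L by (simp add: less_imp_le)
      hence "real (card {\<lfloor>- (L i / h i)\<rfloor>..\<lfloor>L i / h i\<rfloor>}) \<le> 2 * (L i / h i) + 2" by (simp; linarith)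
      thus "real (card {\<lfloor>- (L i / h i)\<rfloor>..\<lfloor>L i / h i\<rfloor>}) \<le> 2 * L i / h i + 2" by simp
    qed auto
    finally show "real (card F) \<le> (\<Prod>i<D. 2 * L i / h i + 2)" .
    show "\<bar>(x - y) \<bullet> e i\<bar> \<le> h i" if V: "V \<in> F" "x \<in> V" "y \<in> V" and i: "i < D" for V x y i
    proof -
      have "q x = q y" using V by (auto simp: F_def)
      hence "q x i = q y i" by simp
      hence "\<lfloor>((x - x0) \<bullet> e i) / h i\<rfloor> = \<lfloor>((y - x0) \<bullet> e i) / h i\<rfloor>" using i by (simp add: q_def)
      hence "\<bar>((x - x0) \<bullet> e i) / h i - ((y - x0) \<bullet> e i) / h i\<bar> \<le> 1" by linarith
      moreover have "((x - x0) \<bullet> e i) / h i - ((y - x0) \<bullet> e i) / h i = ((x - y) \<bullet> e i) / h i"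
        by (simp add: inner_diff_left diff_divide_distrib)
      ultimately show ?thesis using h[OF i] by (simp add: divide_le_eq)
    qed
    show "V \<subseteq> S" if "V \<in> F" for V using that by (auto simp: F_def)
  qed
qed

lemma hausdorff_pre_mono: "A \<subseteq> B \<Longrightarrow> hausdorff_pre s \<delta> A \<le> hausdorff_pre s \<delta> B"
  unfolding hausdorff_pre_def by (rule INF_superset_mono) auto

lemma hausdorff_pre_le_finite_cover:
  assumes F: "finite F" "E \<subseteq> \<Union>F" and b: "\<And>V. V \<in> F \<Longrightarrow> bounded V \<and> diameter V \<le> \<delta>" and \<delta>: "0 \<le> \<delta>"
  shows "hausdorff_pre s \<delta> E \<le> (\<Sum>V\<in>F. diam_weight s V)"
proof -
  obtain g where g: "bij_betw g {..<card F} F"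
    using F(1) ex_bij_betw_nat_finite by (auto simp: atLeast0LessThan)
  define U where "U i = (if i < card F then g i else {})" for i
  have gF: "i < card F \<Longrightarrow> g i \<in> F" for i using g by (auto simp: bij_betw_def)
  have "E \<subseteq> (\<Union>i. U i)"
  proof
    fix x assume "x \<in> E"
    then obtain V where "V \<in> F" "x \<in> V" using F by auto
    have "V \<in> g ` {..<card F}" using g \<open>V \<in> F\<close> by (simp add: bij_betw_def)
    then obtain i where "i < card F" "g i = V" by (metis imageE lessThan_iff)
    hence "U i = V" by (simp add: U_def)
    thus "x \<in> (\<Union>i. U i)" using \<open>x \<in> V\<close> by blast
  qed
  moreover have "\<forall>i. bounded (U i) \<and> diameter (U i) \<le> \<delta>"
    using b gF \<delta> by (auto simp: U_def diameter_empty)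
  ultimately have "hausdorff_pre s \<delta> E \<le> (\<Sum>i. diam_weight s (U i))"
    unfolding hausdorff_pre_def by (intro INF_lower) auto
  also have "\<dots> = (\<Sum>i<card F. diam_weight s (U i))"
    by (rule suminf_finite) (auto simp: U_def diam_weight_def)
  also have "\<dots> = (\<Sum>i<card F. diam_weight s (g i))" by (simp add: U_def)
  also have "\<dots> = (\<Sum>V\<in>F. diam_weight s V)" by (rule sum.reindex_bij_betw[OF g])
  finally show ?thesis .
qed

lemma hausdorff_pre_UN_nat:
  "hausdorff_pre s \<delta> (\<Union>i::nat. A i) \<le> (\<Sum>i. hausdorff_pre s \<delta> (A i))"
proof (rule ennreal_le_epsilon)
  fix \<epsilon> :: real assume fin: "(\<Sum>i. hausdorff_pre s \<delta> (A i)) < top" and \<epsilon>: "0 < \<epsilon>"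
  define c where "c i = ennreal (\<epsilon> * (1/2)^Suc i)" for i
  have cpos: "0 < c i" for i using \<epsilon> by (simp add: c_def)
  have fi: "hausdorff_pre s \<delta> (A i) < top" for i
  proof -
    have "hausdorff_pre s \<delta> (A i) = (\<Sum>j\<in>{i}. hausdorff_pre s \<delta> (A j))" by simp
    also have "\<dots> \<le> (\<Sum>j. hausdorff_pre s \<delta> (A j))" by (rule sum_le_suminf) auto
    finally show ?thesis using fin by (rule le_less_trans)
  qed
  have "\<exists>U. A i \<subseteq> (\<Union>j. U j) \<and> (\<forall>j. bounded (U j) \<and> diameter (U j) \<le> \<delta>) \<and>
     (\<Sum>j::nat. diam_weight s (U j)) < hausdorff_pre s \<delta> (A i) + c i" for i
  proof -
    have "hausdorff_pre s \<delta> (A i) < hausdorff_pre s \<delta> (A i) + c i"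
      using fi[of i] cpos[of i] ennreal_add_left_cancel_less[of "hausdorff_pre s \<delta> (A i)" 0 "c i"] by simp
    from this[unfolded hausdorff_pre_def[of s \<delta> "A i", THEN eq_reflection]]
    show ?thesis unfolding Inf_less_iff hausdorff_pre_def[of s \<delta> "A i"] by auto
  qed
  then obtain U where U: "\<And>i. A i \<subseteq> (\<Union>j. U i j)" "\<And>i j. bounded (U i j) \<and> diameter (U i j) \<le> \<delta>"
     "\<And>i. (\<Sum>j::nat. diam_weight s (U i j)) < hausdorff_pre s \<delta> (A i) + c i" by metis
  define W where "W n = (case prod_decode n of (i, j) \<Rightarrow> U i j)" for n
  have "(\<Union>i. A i) \<subseteq> (\<Union>n. W n)"
  proof
    fix x assume "x \<in> (\<Union>i. A i)"
    then obtain i j where "x \<in> U i j" using U(1) by blast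
    hence "x \<in> W (prod_encode (i, j))" by (simp add: W_def)
    thus "x \<in> (\<Union>n. W n)" by blast
  qed
  moreover have "\<forall>n. bounded (W n) \<and> diameter (W n) \<le> \<delta>"
    using U(2) by (auto simp: W_def split: prod.split)
  ultimately have "hausdorff_pre s \<delta> (\<Union>i. A i) \<le> (\<Sum>n. diam_weight s (W n))"
    unfolding hausdorff_pre_def by (intro INF_lower) auto
  also have "\<dots> = (\<Sum>n. (case prod_decode n of (i, j) \<Rightarrow> diam_weight s (U i j)))"
    by (intro suminf_cong) (simp add: W_def split: prod.split)
  also have "\<dots> = (\<Sum>i. \<Sum>j. diam_weight s (U i j))"
    by (subst suminf_ennreal_2dimen[where f = "\<lambda>(i, j). diam_weight s (U i j)"]) (auto simp: comp_def)
  also have "\<dots> \<le> (\<Sum>i. hausdorff_pre s \<delta> (A i) + c i)"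
    using U(3) by (intro suminf_le) (auto intro: less_imp_le)
  also have "\<dots> = (\<Sum>i. hausdorff_pre s \<delta> (A i)) + (\<Sum>i. c i)" by (rule suminf_add[symmetric]) auto
  also have "(\<Sum>i. c i) = ennreal \<epsilon>"
  proof -
    have "(\<lambda>i. \<epsilon> * (1/2)^Suc i) sums (\<epsilon> * 1)" by (rule sums_mult[OF power_half_series])
    thus ?thesis unfolding c_def using \<epsilon> by (intro suminf_ennreal_eq) auto
  qed
  finally show "hausdorff_pre s \<delta> (\<Union>i. A i) \<le> (\<Sum>i. hausdorff_pre s \<delta> (A i)) + ennreal \<epsilon>" .
qed

lemma hausdorff_pre_empty: "0 \<le> \<delta> \<Longrightarrow> hausdorff_pre s \<delta> {} = 0"
  using hausdorff_pre_le_finite_cover[of "{}" "{}" \<delta> s] by simp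

lemma sum_le_infsum_ennreal:
  fixes g :: "'i \<Rightarrow> ennreal"
  assumes "finite F" "F \<subseteq> I"
  shows "sum g F \<le> (\<Sum>\<^sub>\<infinity>i\<in>I. g i)"
  using assms by (subst nonneg_infsum_complete) (auto intro: SUP_upper)

lemma hausdorff_pre_UN_le_infsum:
  fixes I :: "'i::countable set" and g :: "'i \<Rightarrow> ennreal"
  assumes A: "\<And>i. i \<in> I \<Longrightarrow> hausdorff_pre s \<delta> (A i) \<le> K * g i" and \<delta>: "0 \<le> \<delta>"
  shows "hausdorff_pre s \<delta> (\<Union>i\<in>I. A i) \<le> K * (\<Sum>\<^sub>\<infinity>i\<in>I. g i)"
proof -
  \<comment> \<open>\<open>from_nat\<close> may repeat values; the guard keeps one code per index,
    so partial sums become sums over finite subsets of \<open>I\<close>.\<close>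
  define A' where "A' n = (if from_nat n \<in> I \<and> to_nat (from_nat n :: 'i) = n then A (from_nat n) else {})" for n
  have "(\<Union>i\<in>I. A i) \<subseteq> (\<Union>n. A' n)"
  proof
    fix x assume "x \<in> (\<Union>i\<in>I. A i)"
    then obtain i where "i \<in> I" "x \<in> A i" by blast
    hence "x \<in> A' (to_nat i)" by (simp add: A'_def)
    thus "x \<in> (\<Union>n. A' n)" by blast
  qed
  hence "hausdorff_pre s \<delta> (\<Union>i\<in>I. A i) \<le> hausdorff_pre s \<delta> (\<Union>n. A' n)" by (rule hausdorff_pre_mono)
  also have "\<dots> \<le> (\<Sum>n. hausdorff_pre s \<delta> (A' n))" by (rule hausdorff_pre_UN_nat)
  also have "\<dots> \<le> K * (\<Sum>\<^sub>\<infinity>i\<in>I. g i)"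
    unfolding suminf_eq_SUP
  proof (rule SUP_least)
    fix N
    define J where "J = {n. n < N \<and> from_nat n \<in> I \<and> to_nat (from_nat n :: 'i) = n}"
    have inj: "inj_on (from_nat :: nat \<Rightarrow> 'i) J" by (rule inj_on_inverseI[of _ to_nat]) (auto simp: J_def)
    have "(\<Sum>n<N. hausdorff_pre s \<delta> (A' n)) = (\<Sum>n\<in>J. hausdorff_pre s \<delta> (A' n))"
      by (rule sum.mono_neutral_right) (auto simp: J_def A'_def hausdorff_pre_empty[OF \<delta>])
    also have "\<dots> \<le> (\<Sum>n\<in>J. K * g (from_nat n))"
      by (intro sum_mono) (auto simp: J_def A'_def intro: A)
    also have "\<dots> = K * (\<Sum>i\<in>from_nat ` J. g i)"
      by (simp add: sum.reindex[OF inj] sum_distrib_left)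
    also have "\<dots> \<le> K * (\<Sum>\<^sub>\<infinity>i\<in>I. g i)"
    proof (rule mult_left_mono)
      have "finite (from_nat ` J :: 'i set)" "from_nat ` J \<subseteq> I" by (auto simp: J_def)
      thus "(\<Sum>i\<in>from_nat ` J. g i) \<le> (\<Sum>\<^sub>\<infinity>i\<in>I. g i)"
        by (rule sum_le_infsum_ennreal)
    qed simp
    finally show "(\<Sum>n<N. hausdorff_pre s \<delta> (A' n)) \<le> K * (\<Sum>\<^sub>\<infinity>i\<in>I. g i)" .
  qed
  finally show ?thesis .
qed

lemma hausdorff_dim_le:
  assumes "0 \<le> s" "\<And>\<delta>. 0 < \<delta> \<Longrightarrow> hausdorff_pre s \<delta> E = 0"
  shows "hausdorff_dim E \<le> ereal s"
  unfolding hausdorff_dim_def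
  by (rule INF_lower) (use assms in \<open>auto simp: hausdorff_measure_def bot_ennreal intro!: SUP_eq_const\<close>)

lemma bounded_diameter_le:
  fixes V :: "'a::metric_space set"
  assumes "\<And>x y. x \<in> V \<Longrightarrow> y \<in> V \<Longrightarrow> dist x y \<le> c" "0 \<le> c"
  shows "bounded V \<and> diameter V \<le> c"
proof
  show "bounded V" unfolding bounded_two_points using assms by blast
  show "diameter V \<le> c" unfolding diameter_def using assms
    by (auto intro!: cSUP_least)
qed

lemma diam_weight_le:
  assumes "\<And>x y. x \<in> V \<Longrightarrow> y \<in> V \<Longrightarrow> dist x y \<le> c" "0 \<le> c" "0 < s"
  shows "diam_weight s V \<le> ennreal (c powr s)"
proof -
  have "bounded V" "diameter V \<le> c" using bounded_diameter_le[of V c] assms by auto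
  moreover have "0 \<le> diameter V" using diameter_ge_0 \<open>bounded V\<close> by blast
  ultimately show ?thesis using assms unfolding diam_weight_def by (auto intro!: ennreal_leI powr_mono2)
qed

section \<open>Covers of linear images of balls\<close>

text \<open>The grid is placed in the source, along the right singular vectors and with steps
  \<open>l\<close> divided by the singular values; \<open>T\<close> maps each cell to a set of
  diameter at most \<open>sqrt d * l\<close>, whatever the directions in the target.\<close>

lemma hausdorff_pre_linear_image_cover:
  fixes T :: "real^'d^'d"
  assumes inv: "invertible T" and l: "0 < l" and R: "0 \<le> R" and s: "0 < s" and \<delta>: "sqrt (real CARD('d)) * l \<le> \<delta>"
    and S: "S \<subseteq> (\<lambda>z. c + T *v z) ` cball 0 R"
  shows "hausdorff_pre s \<delta> S \<le> ennreal ((\<Prod>i<CARD('d). 4 * R * sing_val (Suc i) T / l + 2) * (sqrt (real CARD('d)) * l) powr s)"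
proof -
  let ?f = "\<lambda>z. c + T *v z"
  let ?d = "CARD('d)" and ?a = "\<lambda>i. sing_val (Suc i) T"
  have pos: "i < ?d \<Longrightarrow> 0 < ?a i" for i by (rule sing_val_pos[OF inv])
  obtain e :: "nat \<Rightarrow> real^'d" where on: "\<And>i j. i < CARD('d) \<Longrightarrow> j < CARD('d) \<Longrightarrow> e i \<bullet> e j = (if i = j then 1 else 0)"
    and nT: "\<And>z. (norm (T *v z))\<^sup>2 = (\<Sum>i<CARD('d). (?a i)\<^sup>2 * (z \<bullet> e i)\<^sup>2)"
    by (rule singular_value_decomposition[of T]) blast
  have ne: "norm (e i) = 1" if "i < ?d" for i using on[OF that that] by (simp add: norm_eq_1)
  have bx: "\<bar>(x - y) \<bullet> e i\<bar> \<le> 2 * R" if "x \<in> cball 0 R" "y \<in> cball 0 R" "i < ?d" for x y i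
  proof -
    have "\<bar>(x - y) \<bullet> e i\<bar> \<le> norm (x - y) * norm (e i)" by (rule Cauchy_Schwarz_ineq2)
    also have "\<dots> \<le> 2 * R" using ne[OF that(3)] norm_triangle_ineq4[of x y] that by auto
    finally show ?thesis .
  qed
  obtain F where F: "finite F" "cball 0 R \<subseteq> \<Union>F" "real (card F) \<le> (\<Prod>i<?d. 2 * (2 * R) / (l / ?a i) + 2)"
    "\<And>V x y i. V \<in> F \<Longrightarrow> x \<in> V \<Longrightarrow> y \<in> V \<Longrightarrow> i < ?d \<Longrightarrow> \<bar>(x - y) \<bullet> e i\<bar> \<le> l / ?a i"
    by (rule orthonormal_box_cover[of ?d "\<lambda>i. l / ?a i" "\<lambda>i. 2 * R" "cball 0 R" e])
       (use l pos R bx in auto)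
  let ?c = "sqrt (real ?d) * l"
  define G where "G = (\<lambda>V. ?f ` V) ` F"
  have small: "dist x y \<le> ?c" if V: "V \<in> G" "x \<in> V" "y \<in> V" for V x y
  proof -
    obtain W z w where W: "W \<in> F" "z \<in> W" "w \<in> W" "x = c + T *v z" "y = c + T *v w"
      using V by (auto simp: G_def)
    have "(norm (T *v (z - w)))\<^sup>2 \<le> (\<Sum>i<?d. l\<^sup>2)"
      unfolding nT
    proof (rule sum_mono)
      fix i assume "i \<in> {..<?d}"
      hence i: "i < ?d" by simp
      have "?a i * \<bar>(z - w) \<bullet> e i\<bar> \<le> l" using F(4)[OF W(1-3) i] pos[OF i] by (simp add: field_simps)
      hence "(?a i * \<bar>(z - w) \<bullet> e i\<bar>)\<^sup>2 \<le> l\<^sup>2" using pos[OF i] by (intro power_mono) auto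
      thus "(?a i)\<^sup>2 * ((z - w) \<bullet> e i)\<^sup>2 \<le> l\<^sup>2" by (simp add: power_mult_distrib)
    qed
    also have "\<dots> = ?c\<^sup>2" by (simp add: power_mult_distrib)
    finally have "norm (T *v (z - w)) \<le> ?c" using l by (meson power2_le_imp_le mult_nonneg_nonneg real_sqrt_ge_zero of_nat_0_le_iff less_imp_le)
    thus ?thesis using W by (simp add: dist_norm matrix_vector_mult_diff_distrib)
  qed
  have c0: "0 \<le> ?c" using l by simp
  have "hausdorff_pre s \<delta> S \<le> (\<Sum>V\<in>G. diam_weight s V)"
  proof (rule hausdorff_pre_le_finite_cover)
    show "finite G" using F by (simp add: G_def)
    have "?f ` cball 0 R \<subseteq> ?f ` \<Union>F" using F(2) by (rule image_mono)
    thus "S \<subseteq> \<Union>G" using S by (simp add: G_def image_Union)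
    show "0 \<le> \<delta>" using c0 \<delta> by linarith
    show "bounded V \<and> diameter V \<le> \<delta>" if "V \<in> G" for V
      using bounded_diameter_le[of V ?c] small[OF that] c0 \<delta> by force
  qed
  also have "\<dots> \<le> (\<Sum>V\<in>G. ennreal (?c powr s))"
    by (intro sum_mono diam_weight_le) (use small c0 s in auto)
  also have "\<dots> = ennreal (real (card G) * ?c powr s)"
    by (simp add: ennreal_mult' ennreal_of_nat_eq_real_of_nat)
  also have "\<dots> \<le> ennreal ((\<Prod>i<?d. 4 * R * ?a i / l + 2) * ?c powr s)"
  proof (intro ennreal_leI mult_right_mono)
    have "card G \<le> card F" unfolding G_def by (rule card_image_le[OF F(1)])
    hence "real (card G) \<le> (\<Prod>i<?d. 2 * (2 * R) / (l / ?a i) + 2)" using F(3) by linarith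
    thus "real (card G) \<le> (\<Prod>i<?d. 4 * R * ?a i / l + 2)" by (simp add: mult_ac)
  qed simp
  finally show ?thesis .
qed

lemma hausdorff_pre_linear_image_sv_fun:
  fixes T :: "real^'d^'d"
  assumes inv: "invertible T" and R: "0 \<le> R" and s: "0 < s" "s \<le> real CARD('d)"
    and \<delta>: "sqrt (real CARD('d)) * onorm ((*v) T) \<le> \<delta>"
    and S: "S \<subseteq> (\<lambda>z. c + T *v z) ` cball 0 R"
  shows "hausdorff_pre s \<delta> S \<le> ennreal ((4 * R + 2) ^ CARD('d) * sqrt (real CARD('d)) powr s) * ennreal (sv_fun s T)"
proof -
  let ?d = "CARD('d)" and ?a = "\<lambda>i. sing_val (Suc i) T"
  have pos: "i < ?d \<Longrightarrow> 0 < ?a i" for i by (rule sing_val_pos[OF inv])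
  define m where "m = nat \<lceil>s\<rceil> - 1"
  have m: "real m < s" "s \<le> real m + 1" "m < ?d" using s unfolding m_def by linarith+
  have anti: "?a j \<le> ?a i" if "i \<le> j" "j < ?d" for i j
    by (rule singular_value_decomposition[of T]) (use that in blast)
  let ?l = "?a m"
  have l: "0 < ?l" using pos m by simp
  have "sqrt (real ?d) * ?l \<le> \<delta>"
    by (rule order_trans[OF mult_left_mono[OF sing_val_le_onorm[OF m(3), of T]] \<delta>]) simp
  from hausdorff_pre_linear_image_cover[OF inv l R s(1) this S]
  have "hausdorff_pre s \<delta> S \<le> ennreal ((\<Prod>i<?d. 4 * R * ?a i / ?l + 2) * (sqrt (real ?d) * ?l) powr s)" .
  also have "\<dots> \<le> ennreal ((4 * R + 2) ^ ?d * sqrt (real ?d) powr s * sv_fun s T)"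
  proof (rule ennreal_leI)
    \<comment> \<open>Sharing out \<open>?l powr s\<close> with the exponents of \<phi> reduces the
      bound to one direction at a time: large singular values use their whole exponent 1 to pay for
      the number of cells, small ones need boundedly many cells.\<close>
    have ls: "?l powr s = (\<Prod>i<?d. ?l powr sv_exp ?d s i)"
      using l sum_sv_exp[of s ?d] s by (simp flip: powr_sum)
    have "(\<Prod>i<?d. 4 * R * ?a i / ?l + 2) * ?l powr s = (\<Prod>i<?d. (4 * R * ?a i / ?l + 2) * ?l powr sv_exp ?d s i)"
      unfolding ls by (simp add: prod.distrib)
    also have "\<dots> \<le> (\<Prod>i<?d. (4 * R + 2) * ?a i powr sv_exp ?d s i)"
    proof (intro prod_mono conjI)
      fix i assume "i \<in> {..<?d}"
      hence i: "i < ?d" by simp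
      show "0 \<le> (4 * R * ?a i / ?l + 2) * ?l powr sv_exp ?d s i" using R l pos[OF i] by simp
      show "(4 * R * ?a i / ?l + 2) * ?l powr sv_exp ?d s i \<le> (4 * R + 2) * ?a i powr sv_exp ?d s i"
      proof (cases "i < m")
        case True
        hence ex: "sv_exp ?d s i = 1" using m s by (simp add: sv_exp_def)
        have "?l \<le> ?a i" using anti[of i m] True m by simp
        hence "4 * R * ?a i + 2 * ?l \<le> (4 * R + 2) * ?a i" by (simp add: algebra_simps)
        thus ?thesis using ex l pos[OF i] by (simp add: field_simps)
      next
        case False
        hence "?a i \<le> ?l" using anti[of m i] i by simp
        hence "4 * R * ?a i / ?l + 2 \<le> 4 * R + 2" using l R by (simp add: divide_le_eq mult_left_mono)
        moreover have "?l powr sv_exp ?d s i = ?a i powr sv_exp ?d s i"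
        proof (cases "i = m")
          case False
          hence "sv_exp ?d s i = 0" using m s \<open>\<not> i < m\<close> by (simp add: sv_exp_def)
          thus ?thesis using l pos[OF i] by simp
        qed simp
        ultimately show ?thesis by (simp add: mult_right_mono)
      qed
    qed
    also have "\<dots> = (4 * R + 2) ^ ?d * sv_fun s T"
      by (subst sv_fun_eq_prod[OF less_imp_le[OF s(1)] pos]) (auto simp: prod.distrib)
    finally show "(\<Prod>i<?d. 4 * R * ?a i / ?l + 2) * (sqrt (real ?d) * ?l) powr s
       \<le> (4 * R + 2) ^ ?d * sqrt (real ?d) powr s * sv_fun s T"
      using l by (simp add: powr_mult mult_ac mult_left_mono)
  qed
  also have "\<dots> = ennreal ((4 * R + 2) ^ ?d * sqrt (real ?d) powr s) * ennreal (sv_fun s T)"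
    using R by (subst ennreal_mult') (auto intro!: mult_nonneg_nonneg)
  finally show ?thesis .
qed

lemma sing_val_mat_1: "i < CARD('d) \<Longrightarrow> sing_val (Suc i) (mat 1 :: real^'d^'d) = 1"
  using sing_val_attained[of i "mat 1 :: real^'d^'d"] by (metis matrix_vector_mul_lid)

text \<open>Above \<open>d\<close> the singular value function no longer has the cell-counting
  meaning, but boundedness is enough: about \<open>l\<close> to the power \<open>- d\<close> cells
  of diameter comparable to \<open>l\<close> have total weight of order
  \<open>l powr (s - d)\<close>, which tends to 0.\<close>

lemma hausdorff_dim_le_CARD:
  fixes E :: "(real^'d) set"
  assumes "bounded E" and s: "real CARD('d) < s"
  shows "hausdorff_dim E \<le> ereal s"
proof (rule hausdorff_dim_le)
  let ?d = "CARD('d)"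
  show "0 \<le> s" using s by (meson less_imp_le of_nat_0_le_iff order_trans)
  have s0: "0 < s" using s by (meson le_less_trans of_nat_0_le_iff)
  obtain R where R: "0 < R" "E \<subseteq> cball 0 R"
    using assms(1) by (meson bounded_pos mem_cball_0 subsetI)
  fix \<delta> :: real assume \<delta>: "0 < \<delta>"
  have bnd: "hausdorff_pre s \<delta> E \<le> ennreal ((4 * R + 2) ^ ?d * sqrt (real ?d) powr s * l powr (s - ?d))"
    if l: "0 < l" "l \<le> 1" "sqrt (real ?d) * l \<le> \<delta>" for l
  proof -
    have "hausdorff_pre s \<delta> E \<le> ennreal ((\<Prod>i<?d. 4 * R * sing_val (Suc i) (mat 1 :: real^'d^'d) / l + 2) * (sqrt (real ?d) * l) powr s)"
      by (rule hausdorff_pre_linear_image_cover[where c = 0 and T = "mat 1"])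
        (use R l s0 in \<open>auto intro!: exI[of _ "mat 1"] simp: invertible_def\<close>)
    also have "\<dots> = ennreal ((4 * R / l + 2) ^ ?d * (sqrt (real ?d) * l) powr s)"
      by (simp add: sing_val_mat_1)
    also have "\<dots> \<le> ennreal (((4 * R + 2) / l) ^ ?d * (sqrt (real ?d) * l) powr s)"
      using l R by (intro ennreal_leI mult_right_mono power_mono) (auto simp: field_simps)
    also have "((4 * R + 2) / l) ^ ?d * (sqrt (real ?d) * l) powr s = (4 * R + 2) ^ ?d * sqrt (real ?d) powr s * l powr (s - ?d)"
      using l by (simp add: powr_mult powr_diff powr_realpow power_divide)
    finally show ?thesis .
  qed
  have "((\<lambda>l. ennreal ((4 * R + 2) ^ ?d * sqrt (real ?d) powr s * l powr (s - ?d))) \<longlongrightarrow> ennreal ((4 * R + 2) ^ ?d * sqrt (real ?d) powr s * 0)) (at_right 0)"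
    by (intro tendsto_ennrealI tendsto_mult tendsto_const tendsto_zero_powrI[where b = "s - ?d"])
      (use s in \<open>auto intro: tendsto_ident_at eventually_at_rightI[of 0 1]\<close>)
  moreover have "eventually (\<lambda>l. hausdorff_pre s \<delta> E \<le> ennreal ((4 * R + 2) ^ ?d * sqrt (real ?d) powr s * l powr (s - ?d))) (at_right 0)"
  proof (rule eventually_at_rightI[of 0 "min 1 (\<delta> / sqrt (real ?d))"])
    fix l assume "l \<in> {0<..<min 1 (\<delta> / sqrt (real ?d))}"
    hence "0 < l" "l \<le> 1" "sqrt (real ?d) * l \<le> \<delta>" by (auto simp: field_simps)
    thus "hausdorff_pre s \<delta> E \<le> ennreal ((4 * R + 2) ^ ?d * sqrt (real ?d) powr s * l powr (s - ?d))" by (rule bnd)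
  qed (use \<delta> in auto)
  ultimately have "hausdorff_pre s \<delta> E \<le> ennreal ((4 * R + 2) ^ ?d * sqrt (real ?d) powr s * 0)"
    by (rule tendsto_lowerbound) simp
  thus "hausdorff_pre s \<delta> E = 0" by simp
qed

section \<open>Words, cut sets and the upper bound\<close>

text \<open>The matrix attached to a letter depends on its position, so the product over a suffix of
  a word is not a \<open>mat_word\<close>; the offset \<open>q\<close> records where the suffix
  starts.\<close>

primrec mat_from :: "(nat \<Rightarrow> nat \<Rightarrow> real^'d^'d) \<Rightarrow> nat \<Rightarrow> nat list \<Rightarrow> real^'d^'d" where
  "mat_from T q [] = mat 1"
| "mat_from T q (x # v) = T (Suc q) x ** mat_from T (Suc q) v"

lemma mat_from_eq_foldr:
  "mat_from T q v = foldr (\<lambda>j A. T (Suc (q + j)) (v ! j) ** A) [0..<length v] (mat 1)"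
proof (induction v arbitrary: q)
  case (Cons x v)
  have "[0..<length (x # v)] = 0 # map Suc [0..<length v]"
    by (simp add: upt_conv_Cons map_Suc_upt del: upt_Suc)
  thus ?case by (simp add: Cons foldr_map comp_def del: upt_Suc)
qed simp

lemma mat_word_eq_mat_from: "mat_word T u = mat_from T 0 u"
  by (simp add: mat_word_def mat_from_eq_foldr)

lemma mat_from_append: "mat_from T q (u @ v) = mat_from T q u ** mat_from T (q + length u) v"
  by (induction u arbitrary: q) (auto simp: matrix_mul_assoc)

definition words :: "(nat \<Rightarrow> nat) \<Rightarrow> nat \<Rightarrow> nat list set" where
  "words n k = {u \<in> fin_words n. length u = k}"

lemma length_words: "u \<in> words n k \<Longrightarrow> length u = k"
  by (simp add: words_def)

lemma words_0: "words n 0 = {[]}"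
  by (auto simp: words_def fin_words_def)

lemma fin_words_snoc: "u @ [i] \<in> fin_words n \<longleftrightarrow> u \<in> fin_words n \<and> i \<in> {1..n (Suc (length u))}"
  by (auto simp: fin_words_def nth_append less_Suc_eq)

lemma words_Suc: "words n (Suc k) = (\<Union>u\<in>words n k. (\<lambda>i. u @ [i]) ` {1..n (Suc k)})"
proof -
  have "v \<in> words n (Suc k) \<longleftrightarrow> (\<exists>u i. u \<in> words n k \<and> i \<in> {1..n (Suc k)} \<and> v = u @ [i])" for v
    by (cases v rule: rev_cases) (auto simp: words_def fin_words_snoc)
  thus ?thesis by (simp only: set_eq_iff UN_iff image_iff) blast
qed

lemma finite_words: "finite (words n k)"
  by (induction k) (auto simp: words_0 words_Suc)

lemma take_fin_words: "u \<in> fin_words n \<Longrightarrow> take k u \<in> fin_words n"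
  by (auto simp: fin_words_def)

lemma length_prefix_word [simp]: "length (prefix_word w k) = k"
  by (simp add: prefix_word_def)

lemma take_prefix_word [simp]: "j \<le> k \<Longrightarrow> take j (prefix_word w k) = prefix_word w j"
  by (simp add: prefix_word_def take_map min_def)

lemma prefix_word_in_words: "w \<in> inf_words n \<Longrightarrow> prefix_word w k \<in> words n k"
  by (auto simp: inf_words_def prefix_word_def words_def fin_words_def)

lemma prefix_word_add: "prefix_word w (m + k) = prefix_word w m @ map w [m..<m + k]"
  using upt_add_eq_append[of 0 m k] by (simp add: prefix_word_def)

lemma words_extend:
  assumes "\<And>k. 1 \<le> k \<Longrightarrow> 1 \<le> n k" "u \<in> words n k"
  obtains w where "w \<in> inf_words n" "prefix_word w k = u"
proof
  show "(\<lambda>j. if j < k then u ! j else 1) \<in> inf_words n"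
    using assms by (simp add: inf_words_def words_def fin_words_def)
  show "prefix_word (\<lambda>j. if j < k then u ! j else 1) k = u"
    using assms by (intro nth_equalityI) (auto simp: prefix_word_def words_def)
qed

section \<open>Flows and cuts on the tree of words\<close>

text \<open>The value of a maximal flow from \<open>u\<close> through \<open>j\<close> further
  generations under vertex capacities \<open>c\<close>. On a tree it can be computed from the leaves
  upwards.\<close>

fun flow :: "(nat \<Rightarrow> nat) \<Rightarrow> (nat list \<Rightarrow> real) \<Rightarrow> nat \<Rightarrow> nat list \<Rightarrow> real" where
  "flow n c 0 u = c u"
| "flow n c (Suc j) u = min (c u) (\<Sum>i\<in>{1..n (Suc (length u))}. flow n c j (u @ [i]))"

lemma sum_UN_le:
  fixes f :: "'a \<Rightarrow> real"
  assumes "finite I" "\<And>i. i \<in> I \<Longrightarrow> finite (A i)" "\<And>x. 0 \<le> f x"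
  shows "sum f (\<Union>i\<in>I. A i) \<le> (\<Sum>i\<in>I. sum f (A i))"
  using assms(1,2)
proof (induction I rule: finite_induct)
  case (insert i I)
  have "sum f (\<Union>i\<in>insert i I. A i) = sum f (A i \<union> (\<Union>i\<in>I. A i))" by simp
  also have "\<dots> \<le> sum f (A i) + sum f (\<Union>i\<in>I. A i)"
    using insert sum.union_inter[of "A i" "\<Union>i\<in>I. A i" f] assms(3) sum_nonneg[of "A i \<inter> (\<Union>i\<in>I. A i)" f]
    by simp
  finally show ?case using insert by simp
qed simp

lemma cylinder_subset_children:
  "cylinder n u \<subseteq> (\<Union>i\<in>{1..n (Suc (length u))}. cylinder n (u @ [i]))"
proof
  fix w assume w: "w \<in> cylinder n u"
  have "prefix_word w (Suc (length u)) = u @ [w (length u)]"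
    using w by (simp add: cylinder_def prefix_word_def)
  moreover have "w (length u) \<in> {1..n (Suc (length u))}"
    using w by (simp add: cylinder_def inf_words_def)
  ultimately show "w \<in> (\<Union>i\<in>{1..n (Suc (length u))}. cylinder n (u @ [i]))"
    using w by (auto simp: cylinder_def)
qed

text \<open>One half of max-flow min-cut. Where the capacity at \<open>u\<close> attains the minimum
  the cut is \<open>u\<close> itself, otherwise it is the union of the cuts found below the
  children.\<close>

lemma flow_ge_cut:
  assumes c: "\<And>u. u \<in> fin_words n \<Longrightarrow> 0 \<le> c u" and u: "u \<in> fin_words n"
  shows "\<exists>C. finite C \<and> C \<subseteq> fin_words n \<and> cylinder n u \<subseteq> (\<Union>v\<in>C. cylinder n v) \<and> sum c C \<le> flow n c j u"
  using u
proof (induction j arbitrary: u)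
  case 0
  thus ?case by (intro exI[of _ "{u}"]) auto
next
  case (Suc j)
  let ?I = "{1..n (Suc (length u))}"
  show ?case
  proof (cases "c u \<le> (\<Sum>i\<in>?I. flow n c j (u @ [i]))")
    case True
    thus ?thesis using Suc.prems by (intro exI[of _ "{u}"]) auto
  next
    case False
    have "\<forall>i\<in>?I. \<exists>C. finite C \<and> C \<subseteq> fin_words n \<and> cylinder n (u @ [i]) \<subseteq> (\<Union>v\<in>C. cylinder n v) \<and> sum c C \<le> flow n c j (u @ [i])"
      using Suc by (auto simp: fin_words_snoc)
    then obtain C where C: "\<And>i. i \<in> ?I \<Longrightarrow> finite (C i) \<and> C i \<subseteq> fin_words n \<and>
      cylinder n (u @ [i]) \<subseteq> (\<Union>v\<in>C i. cylinder n v) \<and> sum c (C i) \<le> flow n c j (u @ [i])" by metis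
    \<comment> \<open>\<open>sum_UN_le\<close> wants a function that is nonnegative everywhere,
      while \<open>c\<close> is controlled on \<open>fin_words n\<close> only.\<close>
    define c' where "c' v = (if v \<in> fin_words n then c v else 0)" for v
    have cc: "sum c A = sum c' A" if "A \<subseteq> fin_words n" for A
      using that by (intro sum.cong) (auto simp: c'_def)
    have "sum c (\<Union>i\<in>?I. C i) = sum c' (\<Union>i\<in>?I. C i)" using C by (intro cc) blast
    also have "\<dots> \<le> (\<Sum>i\<in>?I. sum c' (C i))"
      using C c by (intro sum_UN_le) (auto simp: c'_def)
    also have "\<dots> = (\<Sum>i\<in>?I. sum c (C i))"
    proof (rule sum.cong)
      fix i assume "i \<in> ?I"
      thus "sum c' (C i) = sum c (C i)" using C cc[of "C i"] by simp
    qed simp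
    also have "\<dots> \<le> (\<Sum>i\<in>?I. flow n c j (u @ [i]))" using C by (intro sum_mono) auto
    finally have "sum c (\<Union>i\<in>?I. C i) \<le> flow n c (Suc j) u" using False by simp
    moreover have "cylinder n u \<subseteq> (\<Union>v\<in>(\<Union>i\<in>?I. C i). cylinder n v)"
    proof
      fix w assume "w \<in> cylinder n u"
      then obtain i where "i \<in> ?I" "w \<in> cylinder n (u @ [i])" using cylinder_subset_children by blast
      thus "w \<in> (\<Union>v\<in>(\<Union>i\<in>?I. C i). cylinder n v)" using C by blast
    qed
    moreover have "finite (\<Union>i\<in>?I. C i)" using C by simp
    moreover have "(\<Union>i\<in>?I. C i) \<subseteq> fin_words n" using C by (intro UN_least) simp
    ultimately show ?thesis by blast
  qed
qed

definition descendants :: "(nat \<Rightarrow> nat) \<Rightarrow> nat \<Rightarrow> nat list \<Rightarrow> nat list set" where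
  "descendants n j u = {v \<in> words n (length u + j). take (length u) v = u}"

lemma finite_descendants: "finite (descendants n j u)"
  by (simp add: descendants_def finite_words)

lemma descendants_Suc:
  assumes "u \<in> fin_words n"
  shows "descendants n (Suc j) u = (\<Union>i\<in>{1..n (Suc (length u))}. descendants n j (u @ [i]))"
proof -
  have "v \<in> descendants n (Suc j) u \<longleftrightarrow> (\<exists>i\<in>{1..n (Suc (length u))}. v \<in> descendants n j (u @ [i]))" for v
  proof
    assume v: "v \<in> descendants n (Suc j) u"
    hence "length u < length v" by (simp add: descendants_def words_def)
    hence "take (Suc (length u)) v = u @ [v ! length u]"
      using v by (simp add: take_Suc_conv_app_nth descendants_def)
    moreover have "v ! length u \<in> {1..n (Suc (length u))}"
      using v by (auto simp: descendants_def words_def fin_words_def)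
    ultimately show "\<exists>i\<in>{1..n (Suc (length u))}. v \<in> descendants n j (u @ [i])"
      using v by (auto simp: descendants_def)
  next
    assume "\<exists>i\<in>{1..n (Suc (length u))}. v \<in> descendants n j (u @ [i])"
    then obtain i where i: "v \<in> words n (Suc (length u) + j)" "take (Suc (length u)) v = u @ [i]"
      by (auto simp: descendants_def)
    have "take (length u) v = take (length u) (take (Suc (length u)) v)" by (simp add: min_def)
    also have "\<dots> = u" by (simp add: i)
    finally show "v \<in> descendants n (Suc j) u" using i by (simp add: descendants_def)
  qed
  thus ?thesis by blast
qed

lemma flow_pos:
  assumes c: "\<And>u. u \<in> fin_words n \<Longrightarrow> 0 < c u" and n: "\<And>k. 1 \<le> k \<Longrightarrow> 1 \<le> n k"
  shows "u \<in> fin_words n \<Longrightarrow> 0 < flow n c j u"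
proof (induction j arbitrary: u)
  case (Suc j)
  have "0 < (\<Sum>i\<in>{1..n (Suc (length u))}. flow n c j (u @ [i]))"
    using Suc n[of "Suc (length u)"] by (intro sum_pos) (auto simp: fin_words_snoc)
  thus ?case using c Suc.prems by simp
qed (use c in simp)

text \<open>The other half: the flow value is realised by weights. Optimal weights below the
  children are scaled by one common factor at most 1 that brings the total down to what
  \<open>u\<close> may carry; scaling down preserves all constraints further below.\<close>

lemma flow_weights:
  assumes c: "\<And>u. u \<in> fin_words n \<Longrightarrow> 0 < c u" and n: "\<And>k. 1 \<le> k \<Longrightarrow> 1 \<le> n k"
  shows "u \<in> fin_words n \<Longrightarrow> \<exists>w. (\<forall>v. 0 \<le> w v) \<and> sum w (descendants n j u) = flow n c j u \<and>
    (\<forall>p\<in>fin_words n. length u \<le> length p \<longrightarrow> sum w {v\<in>descendants n j u. take (length p) v = p} \<le> c p)"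
proof (induction j arbitrary: u)
  case 0
  have d: "descendants n 0 u = {u}"
    using 0 by (auto simp: descendants_def words_def)
  show ?case
  proof (intro exI[of _ "\<lambda>v. if v = u then c u else 0"] conjI ballI impI)
    fix p assume p: "p \<in> fin_words n" "length u \<le> length p"
    have "{v \<in> descendants n 0 u. take (length p) v = p} = (if u = p then {u} else {})"
      using p by (auto simp: d)
    thus "sum (\<lambda>v. if v = u then c u else 0) {v \<in> descendants n 0 u. take (length p) v = p} \<le> c p"
      using c[OF p(1)] by auto
  qed (use 0 c[OF 0] in \<open>auto simp: d\<close>)
next
  case (Suc j)
  let ?I = "{1..n (Suc (length u))}"
  define S where "S = (\<Sum>i\<in>?I. flow n c j (u @ [i]))"
  have S: "0 < S" unfolding S_def
    using Suc.prems n[of "Suc (length u)"] flow_pos[of n c, OF c n] by (intro sum_pos) (auto simp: fin_words_snoc)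
  have "\<forall>i\<in>?I. \<exists>w. (\<forall>v. 0 \<le> w v) \<and> sum w (descendants n j (u @ [i])) = flow n c j (u @ [i]) \<and>
    (\<forall>p\<in>fin_words n. length (u @ [i]) \<le> length p \<longrightarrow> sum w {v\<in>descendants n j (u @ [i]). take (length p) v = p} \<le> c p)"
    by (rule ballI, rule Suc.IH) (use Suc.prems in \<open>simp add: fin_words_snoc\<close>)
  then obtain w where w: "\<forall>i\<in>?I. (\<forall>v. 0 \<le> w i v) \<and> sum (w i) (descendants n j (u @ [i])) = flow n c j (u @ [i]) \<and>
    (\<forall>p\<in>fin_words n. length (u @ [i]) \<le> length p \<longrightarrow> sum (w i) {v\<in>descendants n j (u @ [i]). take (length p) v = p} \<le> c p)"
    by (rule bchoice[THEN exE])
  define \<rho> where "\<rho> = flow n c (Suc j) u / S"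
  have \<rho>: "0 \<le> \<rho>" "\<rho> \<le> 1" "\<rho> * S = flow n c (Suc j) u"
    using S flow_pos[of n c, OF c n Suc.prems, where j = "Suc j"] by (auto simp: \<rho>_def S_def less_imp_le divide_le_eq)
  \<comment> \<open>The letter at position \<open>length u\<close> tells below which child
    \<open>v\<close> lies, and so which of the families \<open>w i\<close> applies.\<close>
  define W where "W v = (if v ! length u \<in> ?I then \<rho> * w (v ! length u) v else 0)" for v
  have nthi: "v ! length u = i" if "v \<in> descendants n j (u @ [i])" for v i
  proof -
    have "take (Suc (length u)) v = u @ [i]" using that by (simp add: descendants_def)
    hence "(take (Suc (length u)) v) ! length u = i" by simp
    thus ?thesis by simp
  qed
  have nn: "0 \<le> W v" for v using w \<rho> by (auto simp: W_def)
  have tot: "sum W (descendants n (Suc j) u) = flow n c (Suc j) u"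
  proof -
    have "sum W (descendants n (Suc j) u) = (\<Sum>i\<in>?I. sum W (descendants n j (u @ [i])))"
      unfolding descendants_Suc[OF Suc.prems]
      using nthi by (intro sum.UNION_disjoint) (auto simp: finite_descendants)
    also have "\<dots> = (\<Sum>i\<in>?I. \<rho> * flow n c j (u @ [i]))"
    proof (rule sum.cong)
      fix i assume i: "i \<in> ?I"
      have "sum W (descendants n j (u @ [i])) = (\<Sum>v\<in>descendants n j (u @ [i]). \<rho> * w i v)"
        by (intro sum.cong) (use nthi i in \<open>auto simp: W_def\<close>)
      thus "sum W (descendants n j (u @ [i])) = \<rho> * flow n c j (u @ [i])"
        using w i by (simp flip: sum_distrib_left)
    qed simp
    also have "\<dots> = \<rho> * S" by (simp add: S_def sum_distrib_left)
    finally show ?thesis using \<rho>(3) by simp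
  qed
  have "sum W {v \<in> descendants n (Suc j) u. take (length p) v = p} \<le> c p"
    if p: "p \<in> fin_words n" "length u \<le> length p" for p
  proof (cases "length p = length u")
    case True
    show ?thesis
    proof (cases "p = u")
      case True
      hence "{v \<in> descendants n (Suc j) u. take (length p) v = p} = descendants n (Suc j) u"
        by (auto simp: descendants_def)
      thus ?thesis using tot True by simp
    next
      case False
      hence "{v \<in> descendants n (Suc j) u. take (length p) v = p} = {}"
        using \<open>length p = length u\<close> by (auto simp: descendants_def)
      thus ?thesis using c[OF p(1)] by (simp only: sum.empty less_imp_le)
    qed
  next
    case False
    hence lp: "length u < length p" using p by simp
    define i where "i = p ! length u"
    have i: "i \<in> ?I" using p(1) lp by (auto simp: fin_words_def i_def)
    have sub: "{v \<in> descendants n (Suc j) u. take (length p) v = p} \<subseteq> {v \<in> descendants n j (u @ [i]). take (length p) v = p}"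
    proof safe
      fix v assume v: "v \<in> descendants n (Suc j) u" and t: "take (length p) v = p"
      then obtain i' where i': "i' \<in> ?I" "v \<in> descendants n j (u @ [i'])"
        using descendants_Suc[OF Suc.prems] by blast
      have "i' = v ! length u" using nthi[OF i'(2)] by simp
      also have "\<dots> = (take (length p) v) ! length u" using lp by simp
      also have "\<dots> = i" by (simp add: t i_def)
      finally show "v \<in> descendants n j (u @ [i])" using i' by simp
    qed
    have "sum W {v \<in> descendants n (Suc j) u. take (length p) v = p} \<le> sum W {v \<in> descendants n j (u @ [i]). take (length p) v = p}"
      using sub nn by (intro sum_mono2) (auto simp: finite_descendants)
    also have "\<dots> = (\<Sum>v\<in>{v \<in> descendants n j (u @ [i]). take (length p) v = p}. \<rho> * w i v)"
      by (intro sum.cong) (use nthi i in \<open>auto simp: W_def\<close>)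
    also have "\<dots> = \<rho> * sum (w i) {v \<in> descendants n j (u @ [i]). take (length p) v = p}"
      by (simp add: sum_distrib_left)
    also have "\<dots> \<le> 1 * c p"
      using \<rho> w i p lp by (intro mult_mono) (auto intro: sum_nonneg)
    finally show ?thesis by simp
  qed
  thus ?case using nn tot by blast
qed

section \<open>Matrix products along words and the coding map\<close>

text \<open>A single number \<open>\<eta>\<close> takes the place of the supremum of the norms. It
  is kept positive so that its real powers behave as expected.\<close>

locale affine_system =
  fixes n :: "nat \<Rightarrow> nat" and T :: "nat \<Rightarrow> nat \<Rightarrow> real^'d^'d" and idx :: "nat list \<Rightarrow> 'tau::finite"
    and \<eta> :: real
  assumes n_ge_1: "\<And>k. 1 \<le> k \<Longrightarrow> 1 \<le> n k"
    and inv: "\<And>k i. 1 \<le> k \<Longrightarrow> 1 \<le> i \<Longrightarrow> i \<le> n k \<Longrightarrow> invertible (T k i)"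
    and norm_le: "\<And>k i. 1 \<le> k \<Longrightarrow> 1 \<le> i \<Longrightarrow> i \<le> n k \<Longrightarrow> onorm ((*v) (T k i)) \<le> \<eta>"
    and eta: "0 < \<eta>" "\<eta> < 1/2"
    and sib: "separates_siblings n idx"
begin

lemma mat_from_bounds:
  "(\<And>j. j < length v \<Longrightarrow> v ! j \<in> {1..n (Suc (q + j))}) \<Longrightarrow>
    onorm ((*v) (mat_from T q v)) \<le> \<eta> ^ length v \<and> invertible (mat_from T q v)"
proof (induction v arbitrary: q)
  case Nil
  have "(*v) (mat 1 :: real^'d^'d) = (\<lambda>x. x)" by (rule ext) simp
  moreover have "invertible (mat 1 :: real^'d^'d)" by (auto intro!: exI[of _ "mat 1"] simp: invertible_def)
  moreover have "onorm (\<lambda>x::real^'d. x) \<le> 1" by (rule onorm_id_le)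
  ultimately show ?case by simp
next
  case (Cons x v)
  have x: "1 \<le> x" "x \<le> n (Suc q)" using Cons.prems[of 0] by auto
  have IH: "onorm ((*v) (mat_from T (Suc q) v)) \<le> \<eta> ^ length v \<and> invertible (mat_from T (Suc q) v)"
    using Cons.prems by (intro Cons.IH) fastforce
  have "onorm ((*v) (T (Suc q) x ** mat_from T (Suc q) v)) = onorm ((*v) (T (Suc q) x) \<circ> (*v) (mat_from T (Suc q) v))"
    by (simp add: comp_def matrix_vector_mul_assoc)
  also have "\<dots> \<le> onorm ((*v) (T (Suc q) x)) * onorm ((*v) (mat_from T (Suc q) v))"
    by (intro onorm_compose matrix_vector_mul_bounded_linear)
  also have "\<dots> \<le> \<eta> * \<eta> ^ length v"
    using norm_le x IH eta by (intro mult_mono) (auto intro: onorm_pos_le matrix_vector_mul_bounded_linear)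
  finally show ?case using inv x IH by (auto intro: invertible_mult)
qed

lemma mat_from_norm_le:
  assumes "\<And>j. j < length v \<Longrightarrow> v ! j \<in> {1..n (Suc (q + j))}"
  shows "norm (mat_from T q v *v x) \<le> \<eta> ^ length v * norm x"
proof -
  have "norm (mat_from T q v *v x) \<le> onorm ((*v) (mat_from T q v)) * norm x"
    by (rule onorm) (rule matrix_vector_mul_bounded_linear)
  thus ?thesis using mat_from_bounds[OF assms] by (meson mult_right_mono norm_ge_zero order_trans)
qed

lemma mat_word_bounds:
  assumes "u \<in> fin_words n"
  shows "onorm ((*v) (mat_word T u)) \<le> \<eta> ^ length u" "invertible (mat_word T u)"
  using mat_from_bounds[of u 0] assms by (auto simp: fin_words_def mat_word_eq_mat_from)

lemma sv_fun_word_pos: "0 \<le> s \<Longrightarrow> u \<in> fin_words n \<Longrightarrow> 0 < sv_fun s (mat_word T u)"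
  by (intro sv_fun_pos mat_word_bounds)

text \<open>A partial sum of the series in \<open>proj_pt\<close>, depending on a finite word only
  and linear in \<open>a\<close>. These points replace the attractor in all energy
  estimates.\<close>

definition trunc_pt :: "real^'d^'tau \<Rightarrow> nat list \<Rightarrow> real^'d" where
  "trunc_pt a u = (\<Sum>j<length u. mat_word T (take j u) *v (a $ idx (take (Suc j) u)))"

text \<open>Every term from number \<open>m\<close> on has the product over the prefix of length
  \<open>m\<close> as a left factor; \<open>y\<close> is what remains of the tail, bounded by a
  geometric series independently of \<open>w\<close> and \<open>m\<close>. Hence each cylinder is
  coded into an affine image of one fixed ball.\<close>

lemma proj_pt_split:
  assumes w: "w \<in> inf_words n"
  obtains y where "norm y \<le> norm a / (1 - \<eta>)"
    "proj_pt T idx a w = trunc_pt a (prefix_word w m) + mat_word T (prefix_word w m) *v y"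
proof
  define g where "g k = mat_from T m (map w [m..<m + k]) *v (a $ idx (prefix_word w (Suc (k + m))))" for k
  define f where "f k = mat_word T (prefix_word w k) *v (a $ idx (prefix_word w (Suc k)))" for k
  have gn: "norm (g k) \<le> \<eta> ^ k * norm a" for k
  proof -
    have "norm (g k) \<le> \<eta> ^ k * norm (a $ idx (prefix_word w (Suc (k + m))))"
      unfolding g_def using mat_from_norm_le[of "map w [m..<m + k]" m] w by (simp add: inf_words_def)
    also have "\<dots> \<le> \<eta> ^ k * norm a"
      using eta by (intro mult_left_mono Finite_Cartesian_Product.norm_nth_le) auto
    finally show ?thesis .
  qed
  have geo: "summable (\<lambda>k. \<eta> ^ k * norm a)" using eta by (intro summable_mult2 summable_geometric) auto
  have sg: "summable g" by (rule summable_comparison_test[OF _ geo]) (use gn in auto)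
  have fg: "f (k + m) = mat_word T (prefix_word w m) *v g k" for k
    unfolding f_def g_def
    by (simp add: add.commute[of k m] prefix_word_add mat_word_eq_mat_from mat_from_append matrix_vector_mul_assoc)
  have bl: "bounded_linear ((*v) (mat_word T (prefix_word w m)))" by (rule matrix_vector_mul_bounded_linear)
  have "summable (\<lambda>k. f (k + m))" unfolding fg by (rule bounded_linear.summable[OF bl sg])
  hence sf: "summable f" by (rule summable_iff_shift[THEN iffD1])
  have "proj_pt T idx a w = suminf f" by (simp add: proj_pt_def f_def[abs_def])
  also have "\<dots> = (\<Sum>k. f (k + m)) + (\<Sum>k<m. f k)" by (rule suminf_split_initial_segment[OF sf])
  also have "(\<Sum>k. f (k + m)) = mat_word T (prefix_word w m) *v suminf g"
    unfolding fg by (rule bounded_linear.suminf[OF bl sg, symmetric])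
  also have "(\<Sum>k<m. f k) = trunc_pt a (prefix_word w m)"
    unfolding trunc_pt_def f_def by (intro sum.cong) auto
  finally show "proj_pt T idx a w = trunc_pt a (prefix_word w m) + mat_word T (prefix_word w m) *v suminf g"
    by (simp add: add.commute)
  have "norm (suminf g) \<le> (\<Sum>k. \<eta> ^ k * norm a)"
    by (rule norm_suminf_le[OF gn geo])
  also have "\<dots> = norm a / (1 - \<eta>)"
    using eta by (simp add: suminf_mult2[symmetric] suminf_geometric summable_geometric)
  finally show "norm (suminf g) \<le> norm a / (1 - \<eta>)" .
qed

lemma dist_proj_pt_trunc_pt:
  assumes w: "w \<in> inf_words n"
  shows "dist (proj_pt T idx a w) (trunc_pt a (prefix_word w m)) \<le> norm a / (1 - \<eta>) * \<eta> ^ m"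
proof -
  obtain y where y: "norm y \<le> norm a / (1 - \<eta>)"
    "proj_pt T idx a w = trunc_pt a (prefix_word w m) + mat_word T (prefix_word w m) *v y"
    using proj_pt_split[OF w] .
  have "norm (mat_word T (prefix_word w m) *v y) \<le> \<eta> ^ m * norm y"
    using mat_from_norm_le[of "prefix_word w m" 0 y] prefix_word_in_words[OF w, of m]
    by (simp add: mat_word_eq_mat_from words_def fin_words_def)
  also have "\<dots> \<le> \<eta> ^ m * (norm a / (1 - \<eta>))" using y eta by (intro mult_left_mono) auto
  finally show ?thesis by (simp add: y dist_norm mult.commute)
qed

lemma bounded_affine_set: "bounded (affine_set n T idx a)"
proof -
  have "dist (proj_pt T idx a w) 0 \<le> norm a / (1 - \<eta>)" if "w \<in> inf_words n" for w
    using dist_proj_pt_trunc_pt[OF that, of a 0] by (simp add: trunc_pt_def prefix_word_def)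
  thus ?thesis unfolding affine_set_def bounded_def
    by (intro exI[of _ 0] exI[of _ "norm a / (1 - \<eta>)"]) (auto simp: dist_commute)
qed

section \<open>Net measures and the upper bound\<close>

lemma net_pre_incseq: "incseq (\<lambda>k. net_pre n T s k G)"
  unfolding net_pre_def by (intro incseq_SucI INF_superset_mono) auto

lemma net_measure_eq_SUP: "net_measure n T s G = (SUP k. net_pre n T s k G)"
  unfolding net_measure_def by (rule limI) (rule LIMSEQ_SUP[OF net_pre_incseq])

lemma inf_words_nonempty: "inf_words n \<noteq> {}"
  using n_ge_1 by (auto simp: inf_words_def intro!: exI[of _ "\<lambda>_. 1"])

text \<open>At exponent 0 every word has weight 1 and every cover is non-empty. This excludes
  \<open>s = 0\<close> from the upper bound, where the cover estimates ask for
  \<open>0 < s\<close>.\<close>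

lemma net_measure_0_nonzero: "net_measure n T 0 (inf_words n) \<noteq> 0"
proof -
  have "1 \<le> net_pre n T 0 0 (inf_words n)"
    unfolding net_pre_def
  proof (rule INF_greatest)
    fix C assume C: "C \<in> {C. C \<subseteq> fin_words n \<and> (\<forall>u\<in>C. 0 \<le> length u) \<and> inf_words n \<subseteq> (\<Union>u\<in>C. cylinder n u)}"
    then obtain u where "u \<in> C" using inf_words_nonempty by blast
    hence "(\<Sum>u\<in>{u}. ennreal (sv_fun 0 (mat_word T u))) \<le> (\<Sum>\<^sub>\<infinity>u\<in>C. ennreal (sv_fun 0 (mat_word T u)))"
      by (intro sum_le_infsum_ennreal) auto
    thus "1 \<le> (\<Sum>\<^sub>\<infinity>u\<in>C. ennreal (sv_fun 0 (mat_word T u)))" by (simp add: sv_fun_def)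
  qed
  also have "\<dots> \<le> net_measure n T 0 (inf_words n)"
    unfolding net_measure_eq_SUP by (rule SUP_upper) simp
  finally show ?thesis by auto
qed

text \<open>At every level there are cylinder covers of arbitrarily small total weight, and the
  piece of the attractor coded by \<open>u\<close> costs at most \<open>K\<close> times the weight
  of \<open>u\<close>, with \<open>K\<close> independent of \<open>u\<close>. The level is chosen so
  deep that the pieces are covered by sets of diameter at most \<open>\<delta>\<close>.\<close>

lemma hausdorff_dim_le_of_net_measure_zero:
  assumes s: "0 \<le> s" and z: "net_measure n T s (inf_words n) = 0"
  shows "hausdorff_dim (affine_set n T idx a) \<le> ereal s"
proof (cases "real CARD('d) < s")
  case True
  thus ?thesis by (rule hausdorff_dim_le_CARD[OF bounded_affine_set])
next
  case False
  have s0: "0 < s" using s z net_measure_0_nonzero by (cases "s = 0") auto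
  let ?E = "affine_set n T idx a" and ?d = "CARD('d)"
  define R where "R = norm a / (1 - \<eta>)"
  have R: "0 \<le> R" using eta by (simp add: R_def)
  define K where "K = (4 * R + 2) ^ ?d * sqrt (real ?d) powr s"
  have K: "0 < K" using R by (simp add: K_def)
  show ?thesis
  proof (rule hausdorff_dim_le[OF s])
    fix \<delta> :: real assume \<delta>: "0 < \<delta>"
    have "(\<lambda>k. sqrt (real ?d) * \<eta> ^ k) \<longlonglongrightarrow> sqrt (real ?d) * 0"
      using eta by (intro tendsto_mult tendsto_const LIMSEQ_realpow_zero) auto
    hence "eventually (\<lambda>k. sqrt (real ?d) * \<eta> ^ k < \<delta>) sequentially" using \<delta> by (intro order_tendstoD(2)) auto
    then obtain k where k: "sqrt (real ?d) * \<eta> ^ k < \<delta>" by (auto simp: eventually_sequentially)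
    have z0: "net_pre n T s k (inf_words n) = 0"
    proof -
      have "net_pre n T s k (inf_words n) \<le> net_measure n T s (inf_words n)"
        unfolding net_measure_eq_SUP by (rule SUP_upper) simp
      thus ?thesis by (simp add: z)
    qed
    have "hausdorff_pre s \<delta> ?E \<le> 0"
    proof (rule ennreal_le_epsilon)
      fix \<epsilon> :: real assume \<epsilon>: "0 < \<epsilon>"
      have "net_pre n T s k (inf_words n) < ennreal (\<epsilon> / K)" using z0 \<epsilon> K by simp
      then obtain C where C: "C \<subseteq> fin_words n" "\<forall>u\<in>C. k \<le> length u" "inf_words n \<subseteq> (\<Union>u\<in>C. cylinder n u)"
        "(\<Sum>\<^sub>\<infinity>u\<in>C. ennreal (sv_fun s (mat_word T u))) < ennreal (\<epsilon> / K)"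
        unfolding net_pre_def INF_less_iff by auto
      have "hausdorff_pre s \<delta> (proj_pt T idx a ` cylinder n u) \<le> ennreal K * ennreal (sv_fun s (mat_word T u))"
        if u: "u \<in> C" for u
        unfolding K_def
      proof (rule hausdorff_pre_linear_image_sv_fun)
        have uf: "u \<in> fin_words n" using u C by blast
        show "invertible (mat_word T u)" by (rule mat_word_bounds[OF uf])
        have "onorm ((*v) (mat_word T u)) \<le> \<eta> ^ length u" by (rule mat_word_bounds[OF uf])
        also have "\<dots> \<le> \<eta> ^ k" using C u eta by (intro power_decreasing) auto
        finally have "sqrt (real ?d) * onorm ((*v) (mat_word T u)) \<le> sqrt (real ?d) * \<eta> ^ k"
          by (intro mult_left_mono) auto
        thus "sqrt (real ?d) * onorm ((*v) (mat_word T u)) \<le> \<delta>" using k by linarith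
        show "proj_pt T idx a ` cylinder n u \<subseteq> (\<lambda>z. trunc_pt a u + mat_word T u *v z) ` cball 0 R"
        proof
          fix x assume "x \<in> proj_pt T idx a ` cylinder n u"
          then obtain w where w: "w \<in> inf_words n" "prefix_word w (length u) = u" "x = proj_pt T idx a w"
            by (auto simp: cylinder_def)
          obtain y where "norm y \<le> norm a / (1 - \<eta>)"
            "proj_pt T idx a w = trunc_pt a u + mat_word T u *v y"
            using proj_pt_split[OF w(1), of a "length u"] unfolding w(2) .
          thus "x \<in> (\<lambda>z. trunc_pt a u + mat_word T u *v z) ` cball 0 R"
            unfolding w(3) R_def by (intro image_eqI[of _ _ y]) auto
        qed
      qed (use s0 R False in auto)
      hence "hausdorff_pre s \<delta> (\<Union>u\<in>C. proj_pt T idx a ` cylinder n u)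
         \<le> ennreal K * (\<Sum>\<^sub>\<infinity>u\<in>C. ennreal (sv_fun s (mat_word T u)))"
        using \<delta> by (intro hausdorff_pre_UN_le_infsum) auto
      also have "\<dots> \<le> ennreal K * ennreal (\<epsilon> / K)" using C(4) by (intro mult_left_mono) auto
      also have "\<dots> = ennreal \<epsilon>" using K \<epsilon> by (simp flip: ennreal_mult)
      finally have "hausdorff_pre s \<delta> (\<Union>u\<in>C. proj_pt T idx a ` cylinder n u) \<le> ennreal \<epsilon>" .
      moreover have "?E \<subseteq> (\<Union>u\<in>C. proj_pt T idx a ` cylinder n u)"
        unfolding affine_set_def image_UN[symmetric] by (rule image_mono) (rule C(3))
      ultimately show "hausdorff_pre s \<delta> ?E \<le> 0 + ennreal \<epsilon>"
        using hausdorff_pre_mono[of ?E _ s \<delta>] by (auto intro: order_trans)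
    qed
    thus "hausdorff_pre s \<delta> ?E = 0" by simp
  qed
qed

lemma hausdorff_dim_le_s_A: "hausdorff_dim (affine_set n T idx a) \<le> s_A n T"
  unfolding s_A_def by (rule INF_greatest) (use hausdorff_dim_le_of_net_measure_zero in auto)

text \<open>A cut either contains a word shorter than \<open>k0\<close>, and these are finitely many
  with positive capacity, or it competes in the infimum defining \<open>net_pre\<close> at level
  \<open>k0\<close>. So all cuts, and with them all flow values, are at least some
  \<open>\<delta>\<close> that does not depend on \<open>k\<close>. Normalising the flow to mass 1
  costs a factor at most \<open>1 / \<delta>\<close>.\<close>

lemma frostman_weights:
  assumes s: "0 \<le> s" and nz: "net_measure n T s (inf_words n) \<noteq> 0"
  obtains C where "0 < C" "\<And>k. \<exists>w. (\<forall>v. 0 \<le> w v) \<and> sum w (words n k) = (1::real) \<and>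
    (\<forall>p\<in>fin_words n. sum w {v\<in>words n k. take (length p) v = p} \<le> C * sv_fun s (mat_word T p))"
proof -
  define c where "c u = sv_fun s (mat_word T u)" for u
  have cpos: "u \<in> fin_words n \<Longrightarrow> 0 < c u" for u unfolding c_def by (rule sv_fun_word_pos[OF s])
  obtain k0 where k0: "net_pre n T s k0 (inf_words n) \<noteq> 0"
  proof (rule ccontr)
    assume "\<not> thesis"
    hence "net_pre n T s k (inf_words n) = 0" for k using that by blast
    thus False using nz unfolding net_measure_eq_SUP by simp
  qed
  hence "0 < net_pre n T s k0 (inf_words n)" by (simp add: less_le)
  \<comment> \<open>The pre-measure may be infinite, so a finite number strictly below it is
    taken.\<close>
  then obtain x where x: "0 < x" "x < net_pre n T s k0 (inf_words n)" using dense by blast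
  define e where "e = enn2real x"
  have e: "0 < e" "ennreal e < net_pre n T s k0 (inf_words n)"
  proof -
    have "x < top" using x(2) top_greatest by (rule less_le_trans)
    thus "0 < e" "ennreal e < net_pre n T s k0 (inf_words n)"
      using x by (auto simp: e_def enn2real_positive_iff)
  qed
  have finS: "finite (\<Union>k<k0. words n k)" by (simp add: finite_words)
  define \<delta> where "\<delta> = Min (insert e (c ` (\<Union>k<k0. words n k)))"
  have \<delta>: "0 < \<delta>" "\<delta> \<le> e" "\<And>u. u \<in> fin_words n \<Longrightarrow> length u < k0 \<Longrightarrow> \<delta> \<le> c u"
    using finS e cpos unfolding \<delta>_def by (auto simp: words_def)
  have fl: "\<delta> \<le> flow n c k []" for k
  proof -
    have nil: "[] \<in> fin_words n" by (simp add: fin_words_def)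
    obtain C where C: "finite C" "C \<subseteq> fin_words n" "cylinder n [] \<subseteq> (\<Union>v\<in>C. cylinder n v)" "sum c C \<le> flow n c k []"
      using flow_ge_cut[of n c "[]" k, OF less_imp_le[OF cpos] nil] by blast
    have cyl: "cylinder n [] = inf_words n" by (auto simp: cylinder_def prefix_word_def)
    have "\<delta> \<le> sum c C"
    proof (cases "\<exists>u\<in>C. length u < k0")
      case True
      then obtain u where u: "u \<in> C" "length u < k0" by blast
      have "\<delta> \<le> c u" using \<delta>(3) u C by blast
      also have "\<dots> \<le> sum c C" using u C cpos by (intro member_le_sum) (auto intro: less_imp_le)
      finally show ?thesis .
    next
      case False
      have "net_pre n T s k0 (inf_words n) \<le> (\<Sum>\<^sub>\<infinity>u\<in>C. ennreal (sv_fun s (mat_word T u)))"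
        unfolding net_pre_def using C False cyl by (intro INF_lower) force
      also have "\<dots> = (\<Sum>u\<in>C. ennreal (c u))" using C(1) by (simp add: c_def)
      also have "\<dots> = ennreal (sum c C)" using C cpos by (intro sum_ennreal) (auto intro: less_imp_le)
      finally have "ennreal e \<le> ennreal (sum c C)" using e(2) by order
      moreover have "0 \<le> sum c C" using C cpos by (intro sum_nonneg) (auto intro: less_imp_le)
      ultimately show ?thesis using \<delta>(2) by (simp add: ennreal_le_iff)
    qed
    thus ?thesis using C(4) by linarith
  qed
  show thesis
  proof (rule that[of "1 / \<delta>"])
    show "0 < 1 / \<delta>" using \<delta> by simp
    fix k
    have d: "descendants n k [] = words n k" by (simp add: descendants_def)
    have nil: "[] \<in> fin_words n" by (simp add: fin_words_def)
    obtain w where w: "\<forall>v. 0 \<le> w v" "sum w (words n k) = flow n c k []"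
      "\<forall>p\<in>fin_words n. sum w {v\<in>words n k. take (length p) v = p} \<le> c p"
      using flow_weights[of n c "[]" k, OF cpos n_ge_1 nil] unfolding d by auto
    have fp: "0 < flow n c k []" using fl[of k] \<delta> by linarith
    show "\<exists>w. (\<forall>v. 0 \<le> w v) \<and> sum w (words n k) = (1::real) \<and>
    (\<forall>p\<in>fin_words n. sum w {v\<in>words n k. take (length p) v = p} \<le> 1 / \<delta> * sv_fun s (mat_word T p))"
    proof (intro exI[of _ "\<lambda>v. w v / flow n c k []"] conjI ballI allI)
      show "0 \<le> w v / flow n c k []" for v using w fp by simp
      show "(\<Sum>v\<in>words n k. w v / flow n c k []) = 1" using w fp by (simp flip: sum_divide_distrib)
      fix p assume p: "p \<in> fin_words n"
      have "(\<Sum>v\<in>{v\<in>words n k. take (length p) v = p}. w v / flow n c k []) \<le> c p / flow n c k []"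
        using w p fp by (simp add: divide_right_mono flip: sum_divide_distrib)
      also have "\<dots> \<le> c p / \<delta>" using fl[of k] \<delta> cpos[OF p] by (intro divide_left_mono) auto
      finally show "(\<Sum>v\<in>{v\<in>words n k. take (length p) v = p}. w v / flow n c k []) \<le> 1 / \<delta> * sv_fun s (mat_word T p)"
        by (simp add: c_def)
    qed
  qed
qed

end

section \<open>Transversality\<close>

lemma norm_axis_vec: "norm (axis l h :: 'a::real_inner^'n) = norm h"
  by (simp add: norm_eq_sqrt_inner inner_axis_axis)

lemma sing_val_inner_le:
  fixes T :: "real^'d^'d"
  assumes e: "\<And>z. (norm (T *v z))\<^sup>2 = (\<Sum>i<CARD('d). (sing_val (Suc i) T)\<^sup>2 * (z \<bullet> e i)\<^sup>2)"
    and i: "i < CARD('d)"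
  shows "sing_val (Suc i) T * \<bar>z \<bullet> e i\<bar> \<le> norm (T *v z)"
proof -
  have "(sing_val (Suc i) T)\<^sup>2 * (z \<bullet> e i)\<^sup>2 \<le> (norm (T *v z))\<^sup>2"
    unfolding e by (rule member_le_sum) (use i in auto)
  hence "(sing_val (Suc i) T * \<bar>z \<bullet> e i\<bar>)\<^sup>2 \<le> (norm (T *v z))\<^sup>2" by (simp add: power_mult_distrib)
  thus ?thesis by (rule power2_le_imp_le) simp
qed

text \<open>The image under \<open>g\<close> of the set in question lies in a box of sides about
  \<open>min 1 (r / \<alpha>\<^sub>i)\<close>; cutting the box into cubes of the smallest of these sides and pulling the cubes
  back by \<open>g\<close> avoids any change of variables.\<close>

lemma emeasure_bilipschitz_preimage_le:
  fixes T :: "real^'d^'d" and g :: "real^'d \<Rightarrow> real^'d"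
  assumes inv: "invertible T" and b: "0 < b" and r: "0 < r"
    and lower: "\<And>x y. b * norm (x - y) \<le> norm (g x - g y)"
    and upper: "\<And>x y. norm (g x - g y) \<le> 2 * norm (x - y)"
  shows "emeasure lborel {h \<in> cball 0 1. norm (T *v g h) \<le> r}
    \<le> ennreal (unit_ball_vol (real CARD('d)) * (16 * sqrt (real CARD('d)) / b) ^ CARD('d) *
         (\<Prod>i<CARD('d). min 1 (r / sing_val (Suc i) T)))"
proof -
  let ?V = "unit_ball_vol (real CARD('d))" and ?s = "sqrt (real CARD('d))"
  let ?d = "CARD('d)" and ?a = "\<lambda>i. sing_val (Suc i) T"
  let ?S = "{h \<in> cball 0 1. norm (T *v g h) \<le> r}"
  have pos: "i < ?d \<Longrightarrow> 0 < ?a i" for i by (rule sing_val_pos[OF inv])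
  obtain e :: "nat \<Rightarrow> real^'d" where on: "\<And>i j. i < ?d \<Longrightarrow> j < ?d \<Longrightarrow> e i \<bullet> e j = (if i = j then 1 else 0)"
    and nT: "\<And>z. (norm (T *v z))\<^sup>2 = (\<Sum>i<?d. (?a i)\<^sup>2 * (z \<bullet> e i)\<^sup>2)"
    by (rule singular_value_decomposition[of T]) blast
  have ne: "norm (e i) = 1" if "i < ?d" for i using on[OF that that] by (simp add: norm_eq_1)
  define L where "L i = min 4 (2 * r / ?a i)" for i
  have Lpos: "0 < L i" if "i < ?d" for i using pos[OF that] r by (simp add: L_def)
  define l where "l = Min (L ` {..<?d})"
  have lmem: "l \<in> L ` {..<?d}" unfolding l_def by (rule Min_in) (auto simp: lessThan_empty_iff)
  have l: "0 < l" using lmem Lpos by auto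
  have lL: "l \<le> L i" if "i < ?d" for i unfolding l_def using that by (intro Min_le) auto
  have box: "\<bar>(x - y) \<bullet> e i\<bar> \<le> L i" if xy: "x \<in> g ` ?S" "y \<in> g ` ?S" and i: "i < ?d" for x y i
  proof -
    obtain h h' where h: "h \<in> ?S" "h' \<in> ?S" "x = g h" "y = g h'" using xy by auto
    have "norm (x - y) \<le> 2 * norm (h - h')" using upper h by simp
    also have "\<dots> \<le> 4" using h norm_triangle_ineq4[of h h'] by simp
    finally have "\<bar>(x - y) \<bullet> e i\<bar> \<le> 4"
      using Cauchy_Schwarz_ineq2[of "x - y" "e i"] ne[OF i] by simp
    moreover have "\<bar>(x - y) \<bullet> e i\<bar> \<le> 2 * r / ?a i"
    proof -
      have "?a i * \<bar>(x - y) \<bullet> e i\<bar> \<le> norm (T *v (x - y))" by (rule sing_val_inner_le[OF nT i])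
      also have "\<dots> \<le> norm (T *v x) + norm (T *v y)"
        by (simp add: matrix_vector_mult_diff_distrib norm_triangle_ineq4)
      also have "\<dots> \<le> 2 * r" using h by simp
      finally show ?thesis using pos[OF i] by (simp add: field_simps)
    qed
    ultimately show ?thesis by (simp add: L_def)
  qed
  obtain F where F: "finite F" "g ` ?S \<subseteq> \<Union>F" "real (card F) \<le> (\<Prod>i<?d. 2 * L i / l + 2)"
    "\<And>V x y i. V \<in> F \<Longrightarrow> x \<in> V \<Longrightarrow> y \<in> V \<Longrightarrow> i < ?d \<Longrightarrow> \<bar>(x - y) \<bullet> e i\<bar> \<le> l"
    "\<And>V. V \<in> F \<Longrightarrow> V \<subseteq> g ` ?S"
    by (rule orthonormal_box_cover[of ?d "\<lambda>i. l" L "g ` ?S" e])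
       (use l Lpos box in \<open>auto simp: less_imp_le\<close>)
  \<comment> \<open>A cell has diameter at most \<open>?s * l\<close>; the lower Lipschitz bound
    turns this into a radius for its preimage.\<close>
  define \<rho> where "\<rho> = ?s * l / b"
  have \<rho>: "0 \<le> \<rho>" using l b by (simp add: \<rho>_def)
  have "\<exists>c. {h \<in> ?S. g h \<in> V} \<subseteq> cball c \<rho>" if V: "V \<in> F" for V
  proof (cases "{h \<in> ?S. g h \<in> V} = {}")
    case False
    then obtain c where c: "c \<in> ?S" "g c \<in> V" by auto
    have "norm (c - h) \<le> \<rho>" if h: "h \<in> ?S" "g h \<in> V" for h
    proof -
      have "(norm (g c - g h))\<^sup>2 = (\<Sum>i<?d. ((g c - g h) \<bullet> e i)\<^sup>2)"
        using orthonormal_norm[of e] on by simp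
      also have "\<dots> \<le> (\<Sum>i<?d. l\<^sup>2)"
      proof (rule sum_mono)
        fix i assume "i \<in> {..<?d}"
        hence "\<bar>(g c - g h) \<bullet> e i\<bar> \<le> l" using F(4)[OF V c(2) h(2)] by simp
        thus "((g c - g h) \<bullet> e i)\<^sup>2 \<le> l\<^sup>2" using l by (simp add: abs_le_square_iff[symmetric])
      qed
      also have "\<dots> = (?s * l)\<^sup>2" by (simp add: power_mult_distrib)
      finally have "norm (g c - g h) \<le> ?s * l" by (rule power2_le_imp_le) (use l in simp)
      with lower[of c h] have "b * norm (c - h) \<le> ?s * l" by linarith
      thus ?thesis using b by (simp add: \<rho>_def field_simps)
    qed
    hence "{h \<in> ?S. g h \<in> V} \<subseteq> cball c \<rho>" by (auto simp: dist_norm)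
    thus ?thesis by blast
  qed auto
  hence "\<forall>V\<in>F. \<exists>c. {h \<in> ?S. g h \<in> V} \<subseteq> cball c \<rho>" by blast
  from bchoice[OF this] obtain c where c: "\<And>V. V \<in> F \<Longrightarrow> {h \<in> ?S. g h \<in> V} \<subseteq> cball (c V) \<rho>" by blast
  have "?S \<subseteq> (\<Union>V\<in>F. cball (c V) \<rho>)"
  proof
    fix h assume h: "h \<in> ?S"
    then obtain V where "V \<in> F" "g h \<in> V" using F(2) by blast
    thus "h \<in> (\<Union>V\<in>F. cball (c V) \<rho>)" using c[OF \<open>V \<in> F\<close>] h by blast
  qed
  hence "emeasure lborel ?S \<le> emeasure lborel (\<Union>V\<in>F. cball (c V) \<rho>)"
    by (intro emeasure_mono) (use F(1) in auto)
  also have "\<dots> \<le> (\<Sum>V\<in>F. emeasure lborel (cball (c V) \<rho>))"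
    by (rule emeasure_subadditive_finite) (use F(1) in auto)
  also have "\<dots> = ennreal (real (card F) * (?V * \<rho> ^ ?d))"
    using \<rho> by (simp add: emeasure_cball ennreal_mult' ennreal_of_nat_eq_real_of_nat)
  also have "\<dots> \<le> ennreal (?V * (16 * ?s / b) ^ ?d *
         (\<Prod>i<?d. min 1 (r / ?a i)))"
  proof (rule ennreal_leI)
    have "real (card F) \<le> (\<Prod>i<?d. 4 * L i / l)"
    proof (rule order_trans[OF F(3)], intro prod_mono conjI)
      fix i assume "i \<in> {..<?d}"
      hence i: "i < ?d" by simp
      show "0 \<le> 2 * L i / l + 2" using Lpos[OF i] l by simp
      show "2 * L i / l + 2 \<le> 4 * L i / l" using lL[OF i] l by (simp add: field_simps)
    qed
    hence "real (card F) * (?V * \<rho> ^ ?d)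
      \<le> (\<Prod>i<?d. 4 * L i / l) * (?V * \<rho> ^ ?d)"
      using \<rho> by (intro mult_right_mono) auto
    also have "\<dots> = ?V * ((\<Prod>i<?d. 4 * L i / l) * (\<Prod>i<?d. \<rho>))" by simp
    \<comment> \<open>The auxiliary side \<open>l\<close> cancels between the number of cells and
      the volume of a ball around a pulled-back cell.\<close>
    also have "(\<Prod>i<?d. 4 * L i / l) * (\<Prod>i<?d. \<rho>) = (\<Prod>i<?d. 4 * ?s / b * L i)"
      unfolding prod.distrib[symmetric] using l by (intro prod.cong) (auto simp: \<rho>_def)
    also have "\<dots> \<le> (\<Prod>i<?d. 16 * ?s / b * min 1 (r / ?a i))"
    proof (intro prod_mono conjI)
      fix i assume "i \<in> {..<?d}"
      hence i: "i < ?d" by simp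
      show "0 \<le> 4 * ?s / b * L i" using Lpos[OF i] b by simp
      have "L i \<le> 4 * min 1 (r / ?a i)" using pos[OF i] r by (simp add: L_def min_def field_simps)
      hence "4 * ?s / b * L i \<le> 4 * ?s / b * (4 * min 1 (r / ?a i))"
        using b by (intro mult_left_mono) auto
      thus "4 * ?s / b * L i \<le> 16 * ?s / b * min 1 (r / ?a i)" by simp
    qed
    also have "\<dots> = (16 * ?s / b) ^ ?d * (\<Prod>i<?d. min 1 (r / ?a i))"
      unfolding prod.distrib by simp
    finally show "real (card F) * (?V * \<rho> ^ ?d)
      \<le> ?V * (16 * ?s / b) ^ ?d * (\<Prod>i<?d. min 1 (r / ?a i))"
      by (simp add: mult_left_mono mult.assoc)
  qed
  finally show ?thesis .
qed

text \<open>Translation invariance makes Tonelli on the product of the parameter space with the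
  directions \<open>h\<close> do the work of Fubini along a block of coordinates.\<close>

lemma emeasure_le_by_averaging:
  fixes S :: "'a::euclidean_space set" and L :: "'b::euclidean_space \<Rightarrow> 'a"
  assumes S: "S \<in> sets borel" "S \<subseteq> cball 0 \<rho>" and L: "continuous_on UNIV L" "\<And>h. norm (L h) \<le> norm h"
    and M: "\<And>a. emeasure lborel {h \<in> cball 0 1. a + L h \<in> S} \<le> M"
  shows "emeasure lborel S * emeasure lborel (cball 0 1 :: 'b set) \<le> M * emeasure lborel (cball 0 (\<rho> + 1) :: 'a set)"
proof -
  let ?Q = "cball 0 1 :: 'b set"
  have [measurable]: "S \<in> sets borel" "L \<in> borel_measurable borel"
    using S L by (auto intro: borel_measurable_continuous_onI)
  have [measurable]: "?Q \<in> sets borel" by simp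
  define f where "f a h = (indicator ?Q h * indicator S (a + L h) :: ennreal)" for a h
  have mf: "case_prod f \<in> borel_measurable (lborel \<Otimes>\<^sub>M lborel)"
    unfolding f_def case_prod_beta by measurable
  have tr: "emeasure lborel S = (\<integral>\<^sup>+a. indicator S (a + L h) \<partial>lborel)" for h
  proof -
    have "emeasure lborel S = (\<integral>\<^sup>+a. indicator S a \<partial>distr lborel borel ((+) (L h)))"
      by (simp add: lborel_distr_plus)
    also have "\<dots> = (\<integral>\<^sup>+a. indicator S (L h + a) \<partial>lborel)" by (subst nn_integral_distr) auto
    finally show ?thesis by (simp add: add.commute)
  qed
  have "emeasure lborel S * emeasure lborel ?Q = (\<integral>\<^sup>+h. emeasure lborel S * indicator ?Q h \<partial>lborel)"
    by (simp add: nn_integral_cmult)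
  also have "\<dots> = (\<integral>\<^sup>+h. (\<integral>\<^sup>+a. f a h \<partial>lborel) \<partial>lborel)"
  proof (rule nn_integral_cong)
    fix h
    show "emeasure lborel S * indicator ?Q h = (\<integral>\<^sup>+a. f a h \<partial>lborel)"
      unfolding f_def tr[of h] by (subst nn_integral_cmult) (auto simp: mult.commute)
  qed
  also have "\<dots> = (\<integral>\<^sup>+a. (\<integral>\<^sup>+h. f a h \<partial>lborel) \<partial>lborel)" by (rule lborel_pair.Fubini'[OF mf])
  also have "\<dots> \<le> (\<integral>\<^sup>+a. M * indicator (cball 0 (\<rho> + 1) :: 'a set) a \<partial>lborel)"
  proof (rule nn_integral_mono)
    fix a :: 'a
    have eq: "f a h = indicator {h \<in> ?Q. a + L h \<in> S} h" for h
      by (auto simp: f_def indicator_def)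
    have ms: "{h \<in> ?Q. a + L h \<in> S} \<in> sets lborel" by measurable
    have *: "(\<integral>\<^sup>+h. f a h \<partial>lborel) = emeasure lborel {h \<in> ?Q. a + L h \<in> S}"
      unfolding eq using ms by simp
    show "(\<integral>\<^sup>+h. f a h \<partial>lborel) \<le> M * indicator (cball 0 (\<rho> + 1)) a"
    proof (cases "a \<in> cball 0 (\<rho> + 1)")
      case True
      thus ?thesis using M[of a] * by simp
    next
      case False
      \<comment> \<open>As \<open>L\<close> does not increase norms, base points outside the ball of
        radius \<open>\<rho> + 1\<close> see nothing of \<open>S\<close>; this makes the averaging
        domain bounded.\<close>
      have "{h \<in> ?Q. a + L h \<in> S} = {}"
      proof (rule ccontr)
        assume "{h \<in> ?Q. a + L h \<in> S} \<noteq> {}"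
        then obtain h where h: "norm h \<le> 1" "norm (a + L h) \<le> \<rho>" using S by auto
        have "norm a \<le> norm (a + L h) + norm (L h)" using norm_triangle_ineq4[of "a + L h" "L h"] by simp
        also have "\<dots> \<le> \<rho> + 1" using h L(2)[of h] by linarith
        finally show False using False by simp
      qed
      thus ?thesis unfolding * by (simp only: emeasure_empty zero_le)
    qed
  qed
  also have "\<dots> = M * emeasure lborel (cball 0 (\<rho> + 1) :: 'a set)" by (subst nn_integral_cmult_indicator) auto
  finally show ?thesis .
qed

lemma sum_power_le_geometric:
  fixes x :: real
  assumes "0 \<le> x" "x < 1"
  shows "(\<Sum>i<m. x ^ i) \<le> 1 / (1 - x)"
proof -
  have "(\<Sum>i<m. x ^ i) \<le> (\<Sum>i. x ^ i)" using assms by (intro sum_le_suminf summable_geometric) auto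
  thus ?thesis using assms by (simp add: suminf_geometric)
qed

context affine_system
begin

section \<open>Dependence of truncated points on the translations\<close>

lemma mat_word_take_split:
  assumes "q \<le> j" "j \<le> length u"
  shows "mat_word T (take j u) = mat_word T (take q u) ** mat_from T q (drop q (take j u))"
proof -
  have "take j u = take q u @ drop q (take j u)"
    using append_take_drop_id[of q "take j u"] assms by (simp add: min_def)
  hence "mat_word T (take j u) = mat_from T 0 (take q u @ drop q (take j u))"
    by (metis mat_word_eq_mat_from)
  thus ?thesis using assms by (simp add: mat_word_eq_mat_from mat_from_append min_def)
qed

text \<open>The term at position \<open>j\<close> involves the first \<open>j + 1\<close> letters
  only, so the terms before \<open>q\<close> cancel, and all others share the factor belonging to
  the common prefix.\<close>

lemma trunc_pt_diff:
  assumes u: "u \<in> words n k" and v: "v \<in> words n k" and q: "q \<le> k" and eq: "take q u = take q v"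
  shows "trunc_pt a u - trunc_pt a v = mat_word T (take q u) *v
    (\<Sum>j\<in>{q..<k}. mat_from T q (drop q (take j u)) *v (a $ idx (take (Suc j) u))
              - mat_from T q (drop q (take j v)) *v (a $ idx (take (Suc j) v)))"
proof -
  let ?A = "\<lambda>w j. mat_from T q (drop q (take j w)) *v (a $ idx (take (Suc j) w))"
  let ?M = "\<lambda>w j. mat_word T (take j w) *v (a $ idx (take (Suc j) w))"
  have lu: "length u = k" "length v = k" using u v by (auto simp: words_def)
  have tq: "take j u = take j v" if "j \<le> q" for j
    using arg_cong[OF eq, of "take j"] that by (simp add: min_def)
  have "trunc_pt a u - trunc_pt a v = (\<Sum>j<k. ?M u j
     - ?M v j)"
    by (simp add: trunc_pt_def lu sum_subtractf)
  also have "\<dots> = (\<Sum>j\<in>{q..<k}. ?M u j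
     - ?M v j)"
    by (rule sum.mono_neutral_right) (auto simp: not_le tq Suc_le_eq)
  also have "\<dots> = (\<Sum>j\<in>{q..<k}. mat_word T (take q u) *v (?A u j
              - ?A v j))"
  proof (rule sum.cong)
    fix j assume "j \<in> {q..<k}"
    hence "mat_word T (take j u) = mat_word T (take q u) ** mat_from T q (drop q (take j u))"
      "mat_word T (take j v) = mat_word T (take q u) ** mat_from T q (drop q (take j v))"
      using mat_word_take_split[of q j u] mat_word_take_split[of q j v] lu by (simp_all add: eq)
    thus "?M u j - ?M v j
      = mat_word T (take q u) *v (?A u j
              - ?A v j)"
      by (simp only: matrix_vector_mult_diff_distrib matrix_vector_mul_assoc)
  qed simp
  finally show ?thesis
    by (simp add: linear_sum[OF matrix_vector_mul_linear])
qed

lemma mat_from_drop_norm_le: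
  assumes u: "u \<in> words n k" and j: "q \<le> j" "j \<le> k"
  shows "norm (mat_from T q (drop q (take j u)) *v x) \<le> \<eta> ^ (j - q) * norm x"
proof -
  have "norm (mat_from T q (drop q (take j u)) *v x) \<le> \<eta> ^ length (drop q (take j u)) * norm x"
  proof (rule mat_from_norm_le)
    fix i assume "i < length (drop q (take j u))"
    hence "q + i < length (take j u)" unfolding length_drop by linarith
    hence "drop q (take j u) ! i = u ! (q + i)" "q + i < length u" by simp_all
    thus "drop q (take j u) ! i \<in> {1..n (Suc (q + i))}" using u by (simp add: words_def fin_words_def)
  qed
  moreover have "length (drop q (take j u)) = j - q" using u j by (simp add: words_def)
  ultimately show ?thesis by simp
qed

text \<open>The distance of two truncated points depends on both distinguished translations.  The
  perturbations of their coefficients have norms summing to at most \<open>2\<eta>/(1 - \<eta>)\<close>, so one of the two is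
  perturbed by at most \<open>\<eta>/(1 - \<eta>) < 1\<close>: this is what makes \<open>1/2\<close> the right threshold.\<close>

lemma transversal_direction:
  assumes u: "u \<in> words n k" and v: "v \<in> words n k" and q: "q < k" and eq: "take q u = take q v" and ne: "u ! q \<noteq> v ! q"
  obtains l y where "linear y" "\<And>a. trunc_pt a u - trunc_pt a v = mat_word T (take q u) *v y a"
    "\<And>h. (1 - \<eta> / (1 - \<eta>)) * norm h \<le> norm (y (axis l h))" "\<And>h. norm (y (axis l h)) \<le> 2 * norm h"
proof -
  define A where "A w j = mat_from T q (drop q (take j w))" for w j
  define I where "I w j = idx (take (Suc j) w)" for w j
  define y where "y a = (\<Sum>j\<in>{q..<k}. A u j *v (a $ I u j) - A v j *v (a $ I v j))" for a
  have lin: "linear y"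
    unfolding y_def
  proof -
    have "linear (\<lambda>a. A w j *v (a $ i))" for w j and i :: 'tau
      by (rule linearI) (simp_all add: matrix_vector_right_distrib matrix_vector_mult_scaleR)
    thus "linear (\<lambda>a. \<Sum>j\<in>{q..<k}. A u j *v (a $ I u j) - A v j *v (a $ I v j))"
      by (intro linear_compose_sum linear_compose_sub ballI)
  qed
  have diff: "trunc_pt a u - trunc_pt a v = mat_word T (take q u) *v y a" for a
    unfolding y_def A_def I_def by (rule trunc_pt_diff[OF u v less_imp_le[OF q] eq])
  have lu: "length u = k" "length v = k" using u v by (auto simp: words_def)
  have Aq: "A u q = mat 1" "A v q = mat 1" by (simp_all add: A_def)
  \<comment> \<open>At position \<open>q\<close> both coefficients are the identity. Since the two
    words branch there, the sibling condition yields two different translation variables, and moving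
    either alone changes \<open>y\<close> by plus or minus the displacement, up to later
    occurrences.\<close>
  have Iq: "I u q \<noteq> I v q"
  proof -
    have "take q u \<in> fin_words n" using take_fin_words[of u n q] u by (simp add: words_def)
    moreover have "length (take q u) = q" using lu q by simp
    ultimately have "inj_on (\<lambda>i. idx (take q u @ [i])) {1..n (Suc q)}"
      using sib unfolding separates_siblings_def by metis
    moreover have "u ! q \<in> {1..n (Suc q)}" "v ! q \<in> {1..n (Suc q)}"
      using u v q by (auto simp: words_def fin_words_def)
    ultimately have "idx (take q u @ [u ! q]) \<noteq> idx (take q u @ [v ! q])"
      using ne by (meson inj_onD)
    thus ?thesis using lu q by (simp add: I_def take_Suc_conv_app_nth flip: eq)
  qed
  \<comment> \<open>A bound for the total norm of the coefficients with which variable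
    \<open>l\<close> reappears after position \<open>q\<close>.\<close>
  define c where "c l = (\<Sum>j\<in>{Suc q..<k}. (if I u j = l then \<eta> ^ (j - q) else 0) + (if I v j = l then \<eta> ^ (j - q) else 0))" for l
  define N where "N l h = (\<Sum>j\<in>{Suc q..<k}. (if I u j = l then A u j *v h else 0) - (if I v j = l then A v j *v h else 0))" for l h
  have Nle: "norm (N l h) \<le> c l * norm h" for l h
  proof -
    have "norm (N l h) \<le> (\<Sum>j\<in>{Suc q..<k}. norm ((if I u j = l then A u j *v h else 0) - (if I v j = l then A v j *v h else 0)))"
      unfolding N_def by (rule norm_sum)
    also have "\<dots> \<le> (\<Sum>j\<in>{Suc q..<k}. ((if I u j = l then \<eta> ^ (j - q) else 0) + (if I v j = l then \<eta> ^ (j - q) else 0)) * norm h)"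
    proof (rule sum_mono)
      fix j assume j: "j \<in> {Suc q..<k}"
      have "norm (A u j *v h) \<le> \<eta> ^ (j - q) * norm h" "norm (A v j *v h) \<le> \<eta> ^ (j - q) * norm h"
        unfolding A_def using j by (auto intro!: mat_from_drop_norm_le[OF u] mat_from_drop_norm_le[OF v])
      thus "norm ((if I u j = l then A u j *v h else 0) - (if I v j = l then A v j *v h else 0))
         \<le> ((if I u j = l then \<eta> ^ (j - q) else 0) + (if I v j = l then \<eta> ^ (j - q) else 0)) * norm h"
      proof -
        let ?e = "\<eta> ^ (j - q)"
        have "norm (if I u j = l then A u j *v h else 0) \<le> (if I u j = l then ?e else 0) * norm h"
          "norm (if I v j = l then A v j *v h else 0) \<le> (if I v j = l then ?e else 0) * norm h"
          using \<open>norm (A u j *v h) \<le> ?e * norm h\<close> \<open>norm (A v j *v h) \<le> ?e * norm h\<close> by simp_all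
        thus ?thesis unfolding distrib_right by (rule norm_triangle_le_diff[OF add_mono])
      qed
    qed
    also have "\<dots> = c l * norm h" by (simp add: c_def sum_distrib_right)
    finally show ?thesis .
  qed
  have "{q..<k} = insert q {Suc q..<k}" using q by auto
  hence yax: "y (axis l h) = ((if I u q = l then h else 0) - (if I v q = l then h else 0)) + N l h" for l h
  proof -
    have z: "A w j *v (axis l h $ i) = (if i = l then A w j *v h else 0)" for w j i
      by (simp add: axis_def)
    show ?thesis using \<open>{q..<k} = insert q {Suc q..<k}\<close> by (simp add: y_def N_def z Aq)
  qed
  \<comment> \<open>The two indices differ, so each later position of each word contributes to at
    most one of the two sums.\<close>
  have csum: "c (I u q) + c (I v q) \<le> 2 * (\<eta> / (1 - \<eta>))"
  proof -
    have "c (I u q) + c (I v q) \<le> (\<Sum>j\<in>{Suc q..<k}. 2 * \<eta> ^ (j - q))"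
      unfolding c_def sum.distrib[symmetric] using Iq eta by (intro sum_mono) auto
    also have "\<dots> = (\<Sum>i<k - Suc q. 2 * \<eta> * \<eta> ^ i)"
    proof (rule sum.reindex_bij_witness[of _ "\<lambda>i. i + Suc q" "\<lambda>j. j - Suc q"])
      fix j assume "j \<in> {Suc q..<k}"
      hence "j - q = Suc (j - Suc q)" by auto
      thus "2 * \<eta> * \<eta> ^ (j - Suc q) = 2 * \<eta> ^ (j - q)" by (simp only: power_Suc mult.assoc)
    qed auto
    also have "\<dots> = 2 * \<eta> * (\<Sum>i<k - Suc q. \<eta> ^ i)" by (simp add: sum_distrib_left)
    also have "\<dots> \<le> 2 * \<eta> * (1 / (1 - \<eta>))"
      using eta by (intro mult_left_mono sum_power_le_geometric) auto
    finally show ?thesis by simp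
  qed
  have k1: "\<eta> / (1 - \<eta>) < 1" using eta by (simp add: field_simps)
  obtain l where l: "l = I u q \<or> l = I v q" "c l \<le> \<eta> / (1 - \<eta>)"
  proof -
    have "c (I u q) \<le> \<eta> / (1 - \<eta>) \<or> c (I v q) \<le> \<eta> / (1 - \<eta>)" using csum by linarith
    thus thesis using that by blast
  qed
  have yl: "norm (y (axis l h)) \<ge> norm h - c l * norm h \<and> norm (y (axis l h)) \<le> norm h + c l * norm h" for h
  proof -
    from l(1) have "y (axis l h) = h + N l h \<or> y (axis l h) = - h + N l h"
    proof
      assume "l = I u q" thus ?thesis using Iq by (simp add: yax)
    next
      assume "l = I v q" thus ?thesis using Iq by (simp add: yax)
    qed
    thus ?thesis
    proof
      assume "y (axis l h) = h + N l h"
      thus ?thesis using Nle[of l h] norm_triangle_ineq[of h "N l h"] norm_diff_ineq[of h "N l h"] by simp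
    next
      assume "y (axis l h) = - h + N l h"
      thus ?thesis using Nle[of l h] norm_triangle_ineq[of "- h" "N l h"] norm_diff_ineq[of "- h" "N l h"] by simp
    qed
  qed
  show thesis
  proof (rule that[OF lin diff])
    fix h :: "real^'d"
    have "c l * norm h \<le> \<eta> / (1 - \<eta>) * norm h" using l(2) by (rule mult_right_mono) simp
    thus "(1 - \<eta> / (1 - \<eta>)) * norm h \<le> norm (y (axis l h))"
      using yl[of h] by (simp add: left_diff_distrib)
    have "\<eta> / (1 - \<eta>) * norm h \<le> 1 * norm h" using k1 by (intro mult_right_mono) auto
    thus "norm (y (axis l h)) \<le> 2 * norm h"
      using yl[of h] \<open>c l * norm h \<le> \<eta> / (1 - \<eta>) * norm h\<close> by linarith
  qed
qed

lemma continuous_trunc_pt [continuous_intros]: "continuous_on S (\<lambda>a. trunc_pt a u)"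
  unfolding trunc_pt_def
  by (intro continuous_on_sum bounded_linear.continuous_on[OF matrix_vector_mul_bounded_linear]
      continuous_on_component continuous_on_id)

text \<open>The constant of \<open>emeasure_bilipschitz_preimage_le\<close> for the lower Lipschitz
  bound \<open>1 - \<eta> / (1 - \<eta>)\<close>, times the ratio of volumes produced by
  \<open>emeasure_le_by_averaging\<close>. Neither words nor \<open>r\<close> enter.\<close>

definition transversality_const :: "real \<Rightarrow> real" where
  "transversality_const \<rho> = unit_ball_vol (real CARD('d)) * (16 * sqrt (real CARD('d)) / (1 - \<eta> / (1 - \<eta>))) ^ CARD('d)
     * measure lborel (cball 0 (\<rho> + 1) :: (real^'d^'tau) set) / measure lborel (cball 0 1 :: (real^'d) set)"

lemma transversality_const_nonneg: "0 \<le> transversality_const \<rho>"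
proof -
  have "\<eta> / (1 - \<eta>) < 1" using eta by (simp add: field_simps)
  thus ?thesis by (simp add: transversality_const_def)
qed

lemma pair_set_borel: "{a \<in> cball 0 \<rho>. dist (trunc_pt a u) (trunc_pt a v) \<le> r} \<in> sets borel"
proof -
  have "closed ({a. dist (trunc_pt a u) (trunc_pt a v) \<le> r})"
    by (intro closed_Collect_le continuous_on_dist continuous_trunc_pt continuous_on_const)
  hence "closed (cball 0 \<rho> \<inter> {a. dist (trunc_pt a u) (trunc_pt a v) \<le> r})" by (intro closed_Int) auto
  hence "cball 0 \<rho> \<inter> {a. dist (trunc_pt a u) (trunc_pt a v) \<le> r} \<in> sets borel" by (rule borel_closed)
  thus ?thesis by (simp only: Int_def mem_Collect_eq)
qed

text \<open>Along the block \<open>l\<close> the difference of the two points is the prefix matrix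
  applied to an affine bi-Lipschitz map of the displacement. This bounds every slice of the set in
  that block by a multiple of the product of \<open>min 1 (r / \<alpha>\<^sub>i)\<close>, and
  averaging passes from slices to the whole set.\<close>

lemma transversality:
  assumes u: "u \<in> words n k" and v: "v \<in> words n k" and q: "q < k" and eq: "take q u = take q v" and ne: "u ! q \<noteq> v ! q"
    and t: "0 \<le> t" "t \<le> real CARD('d)" and r: "0 < r"
  shows "emeasure lborel {a \<in> cball 0 \<rho>. dist (trunc_pt a u) (trunc_pt a v) \<le> r}
    \<le> ennreal (transversality_const \<rho> * (r powr t / sv_fun t (mat_word T (take q u))))"
proof -
  let ?P = "mat_word T (take q u)" and ?S = "{a \<in> cball 0 \<rho>. dist (trunc_pt a u) (trunc_pt a v) \<le> r}"
  let ?Q = "cball 0 1 :: (real^'d) set" and ?B = "cball 0 (\<rho> + 1) :: (real^'d^'tau) set"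
  define b where "b = 1 - \<eta> / (1 - \<eta>)"
  have b: "0 < b" using eta by (simp add: b_def field_simps)
  have pf: "take q u \<in> fin_words n" using u take_fin_words[of u] by (simp add: words_def)
  have inv: "invertible ?P" by (rule mat_word_bounds[OF pf])
  obtain y l where y: "linear y" "\<And>a. trunc_pt a u - trunc_pt a v = ?P *v y a"
    "\<And>h. b * norm h \<le> norm (y (axis l h))" "\<And>h. norm (y (axis l h)) \<le> 2 * norm h"
    by (rule transversal_direction[OF u v q eq ne, folded b_def]) (rule that; assumption)
  define K where "K = unit_ball_vol (real CARD('d)) * (16 * sqrt (real CARD('d)) / b) ^ CARD('d)"
  have K: "0 \<le> K" using b by (simp add: K_def)
  have S_sub: "?S \<subseteq> cball 0 \<rho>" by auto
  have S_meas: "?S \<in> sets borel" by (rule pair_set_borel)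
  have lax: "linear (axis l :: real^'d \<Rightarrow> real^'d^'tau)"
    by (rule linearI) (auto simp: axis_def vec_eq_iff)
  have blax: "bounded_linear (axis l :: real^'d \<Rightarrow> real^'d^'tau)" and bly: "bounded_linear y"
    using lax y(1) by (simp_all add: linear_conv_bounded_linear)
  have "emeasure lborel {h \<in> ?Q. a + axis l h \<in> ?S} \<le> ennreal (K * (r powr t / sv_fun t ?P))" for a
  proof -
    define g where "g h = y (a + axis l h)" for h
    have gd: "g h - g h' = y (axis l (h - h'))" for h h'
      using linear_diff[OF y(1), of "a + axis l h" "a + axis l h'"] linear_diff[OF lax, of h h']
      by (simp add: g_def)
    have "emeasure lborel {h \<in> ?Q. a + axis l h \<in> ?S} \<le> emeasure lborel {h \<in> ?Q. norm (?P *v g h) \<le> r}"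
    proof (rule emeasure_mono)
      have "norm (?P *v g h) = dist (trunc_pt (a + axis l h) u) (trunc_pt (a + axis l h) v)" for h
        by (simp only: g_def dist_norm y(2))
      thus "{h \<in> ?Q. a + axis l h \<in> ?S} \<subseteq> {h \<in> ?Q. norm (?P *v g h) \<le> r}" by auto
      have "continuous_on UNIV g" unfolding g_def
        by (intro bounded_linear.continuous_on[OF bly] continuous_on_add continuous_on_const
            bounded_linear.continuous_on[OF blax] continuous_on_id)
      hence "closed {h. norm (?P *v g h) \<le> r}"
        by (intro closed_Collect_le continuous_on_norm continuous_on_const
            bounded_linear.continuous_on[OF matrix_vector_mul_bounded_linear])
      hence "closed (?Q \<inter> {h. norm (?P *v g h) \<le> r})" by (intro closed_Int) auto
      hence "?Q \<inter> {h. norm (?P *v g h) \<le> r} \<in> sets borel" by (rule borel_closed)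
      thus "{h \<in> ?Q. norm (?P *v g h) \<le> r} \<in> sets lborel" by (simp only: Int_def mem_Collect_eq sets_lborel)
    qed
    also have "\<dots> \<le> ennreal (K * (\<Prod>i<CARD('d). min 1 (r / sing_val (Suc i) ?P)))"
      unfolding K_def by (rule emeasure_bilipschitz_preimage_le[OF inv b r]) (simp_all add: gd y)
    also have "\<dots> \<le> ennreal (K * (r powr t / sv_fun t ?P))"
      using K by (intro ennreal_leI mult_left_mono prod_min_le_powr_div_sv_fun[OF t inv r])
    finally show ?thesis .
  qed
  hence "emeasure lborel ?S * emeasure lborel ?Q \<le> ennreal (K * (r powr t / sv_fun t ?P)) * emeasure lborel ?B"
    by (intro emeasure_le_by_averaging[OF S_meas S_sub, of "axis l"])
       (use linear_continuous_on[OF blax] in \<open>auto simp: norm_axis_vec\<close>)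
  moreover have "emeasure lborel ?Q = ennreal (measure lborel ?Q)"
    using emeasure_lborel_cball_finite[of "0 :: real^'d" 1] by (simp add: emeasure_eq_ennreal_measure)
  moreover have "emeasure lborel ?B = ennreal (measure lborel ?B)"
    using emeasure_lborel_cball_finite[of "0 :: real^'d^'tau" "\<rho> + 1"] by (simp add: emeasure_eq_ennreal_measure)
  moreover have "emeasure lborel ?S = ennreal (measure lborel ?S)"
  proof (rule emeasure_eq_ennreal_measure)
    have "emeasure lborel ?S \<le> emeasure lborel (cball 0 \<rho> :: (real^'d^'tau) set)"
      using S_sub by (rule emeasure_mono) simp
    also have "\<dots> < top" using emeasure_lborel_cball_finite by (simp add: less_top)
    finally show "emeasure lborel ?S \<noteq> top" by simp
  qed
  ultimately have "ennreal (measure lborel ?S) * ennreal (measure lborel ?Q) \<le> ennreal (K * (r powr t / sv_fun t ?P)) * ennreal (measure lborel ?B)"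
    by simp
  moreover have K': "0 \<le> K * (r powr t / sv_fun t ?P)"
    using K less_imp_le[OF sv_fun_word_pos[OF t(1) pf]] by simp
  ultimately have "ennreal (measure lborel ?S * measure lborel ?Q) \<le> ennreal (K * (r powr t / sv_fun t ?P) * measure lborel ?B)"
    by (simp only: ennreal_mult[OF measure_nonneg measure_nonneg] ennreal_mult[OF K' measure_nonneg])
  hence "measure lborel ?S * measure lborel ?Q \<le> K * (r powr t / sv_fun t ?P) * measure lborel ?B"
    using K' by (meson ennreal_le_iff measure_nonneg mult_nonneg_nonneg)
  moreover have "0 < measure lborel ?Q" by (simp add: content_cball)
  ultimately have "measure lborel ?S \<le> K * (r powr t / sv_fun t ?P) * measure lborel ?B / measure lborel ?Q"
    by (simp only: pos_le_divide_eq)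
  also have "\<dots> = transversality_const \<rho> * (r powr t / sv_fun t ?P)"
    by (simp add: transversality_const_def K_def b_def mult_ac)
  finally show ?thesis using \<open>emeasure lborel ?S = ennreal (measure lborel ?S)\<close> by (simp add: ennreal_leI)
qed

end

section \<open>Energy estimates\<close>

text \<open>The lower limit has finite integral, so it is finite almost everywhere, and infinitely
  many values lie below the lower limit plus 1. Which indices these are depends on the point, so
  later arguments have to work along an arbitrary infinite set of levels.\<close>

lemma AE_frequently_bounded:
  fixes f :: "nat \<Rightarrow> 'a \<Rightarrow> ennreal"
  assumes f: "\<And>J. f J \<in> borel_measurable M" and C: "\<And>J. (\<integral>\<^sup>+x. f J x \<partial>M) \<le> ennreal C"
  shows "AE x in M. \<exists>B>0. \<exists>\<^sub>F J in sequentially. f J x \<le> ennreal B"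
proof -
  let ?g = "\<lambda>x. liminf (\<lambda>J. f J x)"
  have "(\<integral>\<^sup>+x. ?g x \<partial>M) \<le> liminf (\<lambda>J. \<integral>\<^sup>+x. f J x \<partial>M)"
    by (rule nn_integral_liminf) (rule f)
  also have "\<dots> \<le> liminf (\<lambda>J::nat. ennreal C)" by (rule Liminf_mono) (use C in auto)
  also have "\<dots> = ennreal C" by (simp add: Liminf_const)
  finally have "(\<integral>\<^sup>+x. ?g x \<partial>M) \<noteq> \<infinity>" by (auto simp: top_unique)
  moreover have "?g \<in> borel_measurable M" using f by measurable
  ultimately have "AE x in M. ?g x \<noteq> \<infinity>" by (intro nn_integral_PInf_AE)
  thus ?thesis
  proof (rule AE_mp, intro AE_I2 impI)
    fix x assume x: "?g x \<noteq> \<infinity>"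
    define B where "B = enn2real (?g x) + 1"
    have gB: "?g x < ennreal B"
    proof -
      have "?g x = ennreal (enn2real (?g x))" using x by (simp add: less_top)
      also have "\<dots> < ennreal B" unfolding B_def by (subst ennreal_less_iff) auto
      finally show ?thesis .
    qed
    have "\<exists>\<^sub>F J in sequentially. f J x \<le> ennreal B"
    proof (rule ccontr)
      assume "\<not> ?thesis"
      hence "eventually (\<lambda>J. ennreal B \<le> f J x) sequentially"
        unfolding not_frequently by (rule eventually_mono) auto
      hence "ennreal B \<le> ?g x" by (rule Liminf_bounded)
      thus False using gB by simp
    qed
    moreover have "0 < B" by (simp add: B_def add_nonneg_pos)
    ultimately show "\<exists>B>0. \<exists>\<^sub>F J in sequentially. f J x \<le> ennreal B" by blast
  qed
qed

lemma common_prefix: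
  assumes "length u = k" "length v = k" "u \<noteq> v"
  obtains q where "q < k" "take q u = take q v" "u ! q \<noteq> v ! q"
proof -
  define q where "q = (LEAST i. i < k \<and> u ! i \<noteq> v ! i)"
  have ex: "\<exists>i. i < k \<and> u ! i \<noteq> v ! i" using assms by (metis nth_equalityI)
  have q: "q < k \<and> u ! q \<noteq> v ! q" unfolding q_def by (rule LeastI_ex[OF ex])
  have "u ! i = v ! i" if "i < q" for i
    using not_less_Least[of i "\<lambda>i. i < k \<and> u ! i \<noteq> v ! i"] that q unfolding q_def by auto
  hence "take q u = take q v" using q assms by (intro nth_take_lemma) auto
  thus thesis using that q by blast
qed

context affine_system
begin

text \<open>The correlation integral at scale \<open>r\<close> of the discrete measure with masses
  \<open>w\<close> at the truncated points. For \<open>0 \<le> r\<close> the diagonal pairs always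
  count.\<close>

definition pair_sum :: "(nat list \<Rightarrow> real) \<Rightarrow> nat \<Rightarrow> real \<Rightarrow> real^'d^'tau \<Rightarrow> real" where
  "pair_sum w k r a = (\<Sum>u\<in>words n k. \<Sum>v\<in>words n k.
     w u * w v * (if dist (trunc_pt a u) (trunc_pt a v) \<le> r then 1 else 0))"

definition frostman :: "real \<Rightarrow> real \<Rightarrow> nat \<Rightarrow> (nat list \<Rightarrow> real) \<Rightarrow> bool" where
  "frostman s C k w \<longleftrightarrow> (\<forall>v. 0 \<le> w v) \<and> sum w (words n k) = 1 \<and>
     (\<forall>p\<in>fin_words n. sum w {v\<in>words n k. take (length p) v = p} \<le> C * sv_fun s (mat_word T p))"

text \<open>The first summand belongs to pairs of distinct words, with a geometric series over the
  length of the common prefix; the second belongs to the diagonal.\<close>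

definition energy_const :: "real \<Rightarrow> real \<Rightarrow> real \<Rightarrow> real \<Rightarrow> real" where
  "energy_const \<rho> s t C = transversality_const \<rho> * (C / (1 - \<eta> powr (s - t)))
     + C * measure lborel (cball 0 \<rho> :: (real^'d^'tau) set)"

lemma pair_sum_nonneg: "(\<And>v. 0 \<le> w v) \<Longrightarrow> 0 \<le> pair_sum w k r a"
  unfolding pair_sum_def by (intro sum_nonneg mult_nonneg_nonneg) auto

lemma pair_sum_measurable: "(\<lambda>a. ennreal (pair_sum w k r a)) \<in> borel_measurable lborel"
proof -
  have "(\<lambda>a. trunc_pt a u) \<in> borel_measurable borel" for u
    by (rule borel_measurable_continuous_onI) (rule continuous_trunc_pt)
  hence [measurable]: "(\<lambda>a. trunc_pt a u) \<in> borel_measurable lborel" for u by simp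
  show ?thesis unfolding pair_sum_def by measurable
qed

text \<open>For words with common prefix \<open>p\<close>, transversality costs the reciprocal of
  \<phi> at \<open>t\<close>, while the Frostman bound gives the words below \<open>p\<close> mass
  at most \<open>C\<close> times \<phi> at \<open>s\<close>. The quotient decays geometrically in
  the length of \<open>p\<close>, so the sum over prefix lengths is bounded independently of
  \<open>k\<close>.\<close>

lemma pair_sum_integral_le:
  assumes t: "0 \<le> t" "t \<le> real CARD('d)" "t < s" and fr: "frostman s C k w" and C: "0 \<le> C" and r: "0 < r"
  shows "(\<integral>\<^sup>+a. ennreal (pair_sum w k r a) * indicator (cball 0 \<rho>) a \<partial>lborel)
    \<le> ennreal (energy_const \<rho> s t C * (r powr t + (\<eta> ^ k) powr s))"
proof -
  let ?W = "words n k" and ?V = "measure lborel (cball 0 \<rho> :: (real^'d^'tau) set)"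
  define K where "K = transversality_const \<rho>"
  have K: "0 \<le> K" unfolding K_def by (rule transversality_const_nonneg)
  define S where "S u v = {a \<in> cball 0 \<rho>. dist (trunc_pt a u) (trunc_pt a v) \<le> r}" for u v
  define g where "g p = 1 / sv_fun t (mat_word T p)" for p
  \<comment> \<open>All common prefixes are counted, not only the longest: an upper bound for which
    the sum over \<open>v\<close> is the mass below a fixed prefix.\<close>
  define D where "D u v = (\<Sum>q<k. if take q v = take q u then g (take q u) else 0)" for u v
  let ?X = "\<lambda>u v. K * r powr t * D u v + (if u = v then ?V else 0)"
  have w: "\<And>v. 0 \<le> w v" "sum w ?W = 1"
    "\<And>p. p \<in> fin_words n \<Longrightarrow> sum w {v\<in>?W. take (length p) v = p} \<le> C * sv_fun s (mat_word T p)"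
    using fr by (auto simp: frostman_def)
  have fw: "take q u \<in> fin_words n" if "u \<in> ?W" for u q
    using that take_fin_words by (auto simp: words_def)
  have g0: "0 \<le> g (take q u)" if "u \<in> ?W" for u q
    using sv_fun_word_pos[OF t(1) fw[OF that]] by (simp add: g_def less_imp_le)
  have D0: "0 \<le> D u v" if "u \<in> ?W" for u v
    unfolding D_def using g0[OF that] by (intro sum_nonneg) auto
  have eS: "emeasure lborel (S u v) \<le> ennreal (?X u v)"
    if uv: "u \<in> ?W" "v \<in> ?W" for u v
  proof (cases "u = v")
    case True
    have "emeasure lborel (S u v) \<le> emeasure lborel (cball 0 \<rho> :: (real^'d^'tau) set)"
      by (rule emeasure_mono) (auto simp: S_def)
    also have "\<dots> = ennreal ?V"
      using emeasure_lborel_cball_finite[of "0 :: real^'d^'tau" \<rho>] by (simp add: emeasure_eq_ennreal_measure)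
    also have "\<dots> \<le> ennreal (K * r powr t * D u v + ?V)"
      using K D0[OF uv(1)] by (intro ennreal_leI) simp
    finally show ?thesis using True by simp
  next
    case False
    obtain q where q: "q < k" "take q u = take q v" "u ! q \<noteq> v ! q"
      using common_prefix[OF length_words[OF uv(1)] length_words[OF uv(2)] False] .
    have "emeasure lborel (S u v) \<le> ennreal (K * (r powr t / sv_fun t (mat_word T (take q u))))"
      unfolding S_def K_def by (rule transversality[OF uv q t(1,2) r])
    also have "\<dots> \<le> ennreal (K * r powr t * D u v)"
    proof (rule ennreal_leI)
      have "g (take q u) = (if take q v = take q u then g (take q u) else 0)" using q by simp
      also have "\<dots> \<le> D u v"
        unfolding D_def by (rule member_le_sum) (use q g0[OF uv(1)] in auto)
      finally have "K * r powr t * g (take q u) \<le> K * r powr t * D u v"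
        using K by (intro mult_left_mono) auto
      thus "K * (r powr t / sv_fun t (mat_word T (take q u))) \<le> K * r powr t * D u v" by (simp add: g_def)
    qed
    finally show ?thesis using False by simp
  qed
  have "(\<integral>\<^sup>+a. ennreal (pair_sum w k r a) * indicator (cball 0 \<rho>) a \<partial>lborel)
     = (\<integral>\<^sup>+a. (\<Sum>u\<in>?W. \<Sum>v\<in>?W. ennreal (w u * w v) * indicator (S u v) a) \<partial>lborel)"
  proof (rule nn_integral_cong)
    fix a :: "real^'d^'tau"
    have "ennreal (pair_sum w k r a) = (\<Sum>u\<in>?W. \<Sum>v\<in>?W. ennreal (w u * w v * (if dist (trunc_pt a u) (trunc_pt a v) \<le> r then 1 else 0)))"
      unfolding pair_sum_def using w(1)
      by (subst sum_ennreal[symmetric], force intro!: sum_nonneg, intro sum.cong refl sum_ennreal[symmetric], simp)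
    thus "ennreal (pair_sum w k r a) * indicator (cball 0 \<rho>) a = (\<Sum>u\<in>?W. \<Sum>v\<in>?W. ennreal (w u * w v) * indicator (S u v) a)"
      by (auto simp: S_def sum_distrib_right indicator_def intro!: sum.cong)
  qed
  also have "\<dots> = (\<Sum>u\<in>?W. \<Sum>v\<in>?W. ennreal (w u * w v) * emeasure lborel (S u v))"
  proof -
    have [measurable, simp]: "S u v \<in> sets borel" for u v unfolding S_def by (rule pair_set_borel)
    have "(\<integral>\<^sup>+a. (\<Sum>v\<in>?W. ennreal (w u * w v) * indicator (S u v) a) \<partial>lborel)
      = (\<Sum>v\<in>?W. ennreal (w u * w v) * emeasure lborel (S u v))" for u
      by (subst nn_integral_sum) (auto intro!: sum.cong nn_integral_cmult_indicator)
    thus ?thesis by (subst nn_integral_sum) auto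
  qed
  also have "\<dots> \<le> (\<Sum>u\<in>?W. \<Sum>v\<in>?W. ennreal (w u * w v * (?X u v)))"
  proof (intro sum_mono)
    fix u v assume uv: "u \<in> ?W" "v \<in> ?W"
    have "ennreal (w u * w v) * emeasure lborel (S u v) \<le> ennreal (w u * w v) * ennreal (?X u v)"
      by (intro mult_left_mono eS[OF uv]) simp
    also have "\<dots> = ennreal (w u * w v * (?X u v))"
      using w(1) by (intro ennreal_mult'[symmetric]) simp
    finally show "ennreal (w u * w v) * emeasure lborel (S u v) \<le> ennreal (w u * w v * (?X u v))" .
  qed
  also have "\<dots> = ennreal (\<Sum>u\<in>?W. \<Sum>v\<in>?W. w u * w v * (?X u v))"
  proof -
    have nn: "0 \<le> w u * w v * (?X u v)" if "u \<in> ?W" for u v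
      using w(1) K D0[OF that] by simp
    have "(\<Sum>v\<in>?W. ennreal (w u * w v * (?X u v)))
        = ennreal (\<Sum>v\<in>?W. w u * w v * (?X u v))" if "u \<in> ?W" for u
      by (intro sum_ennreal nn that)
    thus ?thesis using nn by (simp add: sum_ennreal sum_nonneg)
  qed
  also have "\<dots> \<le> ennreal (energy_const \<rho> s t C * (r powr t + (\<eta> ^ k) powr s))"
  proof (rule ennreal_leI)
    have b1: "0 < \<eta> powr (s - t)" "\<eta> powr (s - t) < 1"
      using eta t powr01_less_one[of \<eta> "s - t"] by auto
    have pw: "sv_fun s (mat_word T p) \<le> (\<eta> ^ length p) powr (s - t') * sv_fun t' (mat_word T p)"
      if "p \<in> fin_words n" "0 \<le> t'" "t' \<le> s" for p t'
      using sv_fun_ratio[OF that(2,3) mat_word_bounds(2)[OF that(1)] mat_word_bounds(1)[OF that(1)]] eta by simp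
    have "(\<Sum>u\<in>?W. \<Sum>v\<in>?W. w u * w v * D u v) = (\<Sum>u\<in>?W. \<Sum>q<k. w u * g (take q u) * sum w {v\<in>?W. take q v = take q u})"
    proof (rule sum.cong)
      fix u
      have "(\<Sum>v\<in>?W. w u * w v * D u v) = (\<Sum>q<k. \<Sum>v\<in>?W. w u * w v * (if take q v = take q u then g (take q u) else 0))"
        unfolding D_def sum_distrib_left by (rule sum.swap)
      also have "\<dots> = (\<Sum>q<k. w u * g (take q u) * (\<Sum>v\<in>?W. if take q v = take q u then w v else 0))"
        unfolding sum_distrib_left by (intro sum.cong) auto
      also have "\<dots> = (\<Sum>q<k. w u * g (take q u) * sum w {v\<in>?W. take q v = take q u})"
        by (simp add: sum.inter_filter finite_words)
      finally show "(\<Sum>v\<in>?W. w u * w v * D u v) = (\<Sum>q<k. w u * g (take q u) * sum w {v\<in>?W. take q v = take q u})" .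
    qed simp
    also have "\<dots> \<le> (\<Sum>u\<in>?W. \<Sum>q<k. w u * (C * (\<eta> powr (s - t)) ^ q))"
    proof (intro sum_mono)
      fix u q assume u: "u \<in> ?W" and q: "q \<in> {..<k}"
      let ?p = "take q u"
      have lp: "length ?p = q" using u q by (simp add: words_def)
      have pos: "0 < sv_fun t (mat_word T ?p)" by (rule sv_fun_word_pos[OF t(1) fw[OF u]])
      have "sum w {v\<in>?W. take q v = ?p} \<le> C * sv_fun s (mat_word T ?p)" using w(3)[OF fw[OF u, of q]] lp by simp
      also have "\<dots> \<le> C * ((\<eta> ^ q) powr (s - t) * sv_fun t (mat_word T ?p))"
        using pw[OF fw[OF u, of q] t(1) less_imp_le[OF t(3)]] C lp by (intro mult_left_mono) auto
      finally have "g ?p * sum w {v\<in>?W. take q v = ?p} \<le> g ?p * (C * ((\<eta> ^ q) powr (s - t) * sv_fun t (mat_word T ?p)))"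
        by (intro mult_left_mono g0[OF u])
      also have "\<dots> = C * (\<eta> ^ q) powr (s - t)" using pos by (simp add: g_def)
      also have "(\<eta> ^ q) powr (s - t) = (\<eta> powr (s - t)) ^ q"
        using eta by (simp add: powr_realpow[symmetric] powr_powr mult.commute)
      finally have "w u * (g ?p * sum w {v\<in>?W. take q v = ?p}) \<le> w u * (C * (\<eta> powr (s - t)) ^ q)"
        by (rule mult_left_mono) (rule w(1))
      thus "w u * g ?p * sum w {v\<in>?W. take q v = ?p} \<le> w u * (C * (\<eta> powr (s - t)) ^ q)" by (simp add: mult.assoc)
    qed
    also have "\<dots> = C * (\<Sum>q<k. (\<eta> powr (s - t)) ^ q)"
      by (simp add: sum_distrib_left[symmetric] sum_distrib_right[symmetric] w(2))
    also have "\<dots> \<le> C * (1 / (1 - \<eta> powr (s - t)))"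
      using C b1 by (intro mult_left_mono sum_power_le_geometric) auto
    finally have off: "(\<Sum>u\<in>?W. \<Sum>v\<in>?W. w u * w v * D u v) \<le> C / (1 - \<eta> powr (s - t))" by simp
    \<comment> \<open>On the diagonal the Frostman bound is applied to whole words of length
      \<open>k\<close> and compared with exponent 0, where \<phi> is 1; one factor
      \<open>w u\<close> gives the decay, the other sums to 1.\<close>
    have "(\<Sum>u\<in>?W. w u * w u) \<le> (\<Sum>u\<in>?W. w u * (C * (\<eta> ^ k) powr s))"
    proof (intro sum_mono mult_left_mono w(1))
      fix u assume u: "u \<in> ?W"
      have uf: "u \<in> fin_words n" "length u = k" using u by (auto simp: words_def)
      have "{v\<in>?W. take (length u) v = u} = {u}" using u by (auto simp: words_def)
      hence "w u \<le> C * sv_fun s (mat_word T u)" using w(3)[OF uf(1)] by simp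
      also have "\<dots> \<le> C * ((\<eta> ^ k) powr (s - 0) * sv_fun 0 (mat_word T u))"
        using pw[OF uf(1), of 0] C t uf by (intro mult_left_mono) auto
      finally show "w u \<le> C * (\<eta> ^ k) powr s" by (simp add: sv_fun_def)
    qed
    also have "\<dots> = C * (\<eta> ^ k) powr s" by (simp add: sum_distrib_right[symmetric] w(2))
    finally have diag: "(\<Sum>u\<in>?W. w u * w u) \<le> C * (\<eta> ^ k) powr s" .
    have "(\<Sum>u\<in>?W. \<Sum>v\<in>?W. w u * w v * (?X u v))
       = K * r powr t * (\<Sum>u\<in>?W. \<Sum>v\<in>?W. w u * w v * D u v) + ?V * (\<Sum>u\<in>?W. w u * w u)"
    proof -
      have "(\<Sum>v\<in>?W. w u * w v * (?X u v))
         = K * r powr t * (\<Sum>v\<in>?W. w u * w v * D u v) + ?V * (w u * w u)" if "u \<in> ?W" for u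
      proof -
        have "(\<Sum>v\<in>?W. w u * w v * (?X u v))
          = (\<Sum>v\<in>?W. K * r powr t * (w u * w v * D u v)) + (\<Sum>v\<in>?W. if u = v then ?V * (w u * w v) else 0)"
          unfolding sum.distrib[symmetric] by (intro sum.cong) (auto simp: algebra_simps)
        thus ?thesis using that finite_words by (simp add: sum_distrib_left)
      qed
      thus ?thesis by (simp add: sum.distrib sum_distrib_left)
    qed
    also have "\<dots> \<le> K * r powr t * (C / (1 - \<eta> powr (s - t))) + ?V * (C * (\<eta> ^ k) powr s)"
      using off diag K by (intro add_mono mult_left_mono) auto
    also have "\<dots> \<le> energy_const \<rho> s t C * (r powr t + (\<eta> ^ k) powr s)"
    proof -
      have "0 \<le> K * (C / (1 - \<eta> powr (s - t)))" "0 \<le> C * ?V" using K C b1 by auto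
      hence "0 \<le> K * (C / (1 - \<eta> powr (s - t))) * (\<eta> ^ k) powr s" "0 \<le> C * ?V * r powr t"
        by (simp_all only: mult_nonneg_nonneg powr_ge_zero)
      hence "K * (C / (1 - \<eta> powr (s - t))) * r powr t + C * ?V * (\<eta> ^ k) powr s
        \<le> (K * (C / (1 - \<eta> powr (s - t))) + C * ?V) * (r powr t + (\<eta> ^ k) powr s)"
        unfolding distrib_left distrib_right by linarith
      thus ?thesis unfolding energy_const_def K_def[symmetric] by (simp only: mult_ac)
    qed
    finally show "(\<Sum>u\<in>?W. \<Sum>v\<in>?W. w u * w v * (?X u v))
      \<le> energy_const \<rho> s t C * (r powr t + (\<eta> ^ k) powr s)" .
  qed
  finally show ?thesis .
qed

lemma energy_const_nonneg: "0 \<le> C \<Longrightarrow> t < s \<Longrightarrow> 0 \<le> energy_const \<rho> s t C"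
proof -
  assume C: "0 \<le> C" and "t < s"
  hence "\<eta> powr (s - t) < 1" using eta by (simp add: powr01_less_one)
  hence "0 \<le> C / (1 - \<eta> powr (s - t))" using C by simp
  thus ?thesis unfolding energy_const_def using transversality_const_nonneg[of \<rho>] C
    by (intro add_nonneg_nonneg mult_nonneg_nonneg) auto
qed

text \<open>The levels \<open>\<kappa> J\<close> are chosen so deep that at scale \<open>2\<^sup>-\<^sup>J\<close> the diagonal of the double sum, which
  would make the energy of a discrete measure infinite, is harmless.\<close>

lemma frostman_levels:
  assumes s: "0 < s" and nz: "net_measure n T s (inf_words n) \<noteq> 0" and t: "0 \<le> t"
  obtains C w \<kappa> where "0 < C" "\<And>J. frostman s C (\<kappa> J) (w J)" "\<And>J. (\<eta> ^ \<kappa> J) powr s \<le> ((1/2) ^ J) powr t" "\<And>J. J \<le> \<kappa> J"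
proof -
  obtain C where C: "0 < C" "\<And>k. \<exists>w. frostman s C k w"
    by (rule frostman_weights[OF less_imp_le[OF s] nz]) (rule that; simp only: frostman_def)
  have "\<exists>k\<ge>J. (\<eta> ^ k) powr s \<le> ((1/2) ^ J) powr t" for J
  proof -
    have "(\<lambda>k. (\<eta> powr s) ^ k) \<longlonglongrightarrow> 0"
      using eta s powr01_less_one[of \<eta> s] by (intro LIMSEQ_realpow_zero) auto
    hence "eventually (\<lambda>k. (\<eta> powr s) ^ k < ((1/2) ^ J) powr t) sequentially"
      by (rule order_tendstoD) simp
    moreover have "eventually (\<lambda>k. J \<le> k) sequentially" by (rule eventually_ge_at_top)
    ultimately have "eventually (\<lambda>k. (\<eta> powr s) ^ k < ((1/2) ^ J) powr t \<and> J \<le> k) sequentially"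
      by (rule eventually_conj)
    then obtain k where k: "(\<eta> powr s) ^ k < ((1/2) ^ J) powr t" "J \<le> k"
      by (auto simp: eventually_sequentially)
    moreover have "(\<eta> ^ k) powr s = (\<eta> powr s) ^ k"
      using eta by (simp add: powr_realpow[symmetric] powr_powr mult.commute)
    ultimately show ?thesis by (intro exI[of _ k]) auto
  qed
  hence "\<forall>J. \<exists>k. J \<le> k \<and> (\<eta> ^ k) powr s \<le> ((1/2) ^ J) powr t" by blast
  from choice[OF this] obtain \<kappa> where \<kappa>: "\<And>J. J \<le> \<kappa> J \<and> (\<eta> ^ \<kappa> J) powr s \<le> ((1/2) ^ J) powr t" by blast
  have "\<forall>k. \<exists>w. frostman s C k w" using C(2) by blast
  from choice[OF this] obtain w where w: "\<And>k. frostman s C k (w k)" by blast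
  show thesis by (rule that[of C \<kappa> "\<lambda>J. w (\<kappa> J)"]) (use C \<kappa> w in auto)
qed

text \<open>The integral estimates hold over bounded sets of parameters; countably many balls
  exhaust the space.\<close>

lemma AE_cball_all:
  assumes "\<And>m::nat. AE a in lborel. a \<in> cball 0 (real m) \<longrightarrow> P (a :: real^'d^'tau)"
  shows "AE a in lborel. P a"
proof -
  have "AE a in lborel. \<forall>m::nat. a \<in> cball 0 (real m) \<longrightarrow> P (a :: real^'d^'tau)"
    by (rule AE_all_countable[THEN iffD2]) (rule allI, rule assms)
  thus ?thesis
  proof (rule AE_mp, intro AE_I2 impI)
    fix a :: "real^'d^'tau" assume "\<forall>m::nat. a \<in> cball 0 (real m) \<longrightarrow> P a"
    moreover obtain m :: nat where "norm a \<le> real m" using real_arch_simple by blast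
    ultimately show "P a" by auto
  qed
qed

end

section \<open>Lower bound for the dimension\<close>

lemma hausdorff_pre_antimono_exponent:
  assumes "0 \<le> s" "s < t" "\<delta> \<le> 1"
  shows "hausdorff_pre t \<delta> E \<le> hausdorff_pre s \<delta> E"
  unfolding hausdorff_pre_def
proof (rule INF_mono)
  fix U :: "nat \<Rightarrow> 'a set" assume U: "U \<in> {U. E \<subseteq> (\<Union>i. U i) \<and> (\<forall>i. bounded (U i) \<and> diameter (U i) \<le> \<delta>)}"
  have "diam_weight t (U i) \<le> diam_weight s (U i)" for i
  proof -
    have "bounded (U i)" "diameter (U i) \<le> \<delta>" using U by auto
    hence d: "0 \<le> diameter (U i)" "diameter (U i) \<le> 1" using assms(3) diameter_ge_0[of "U i"] by auto
    have "diameter (U i) powr t \<le> diameter (U i) powr s"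
      using d assms by (intro powr_mono') auto
    moreover have "diameter (U i) powr t \<le> 1" using d assms by (intro powr_le1) auto
    ultimately show ?thesis using assms by (auto simp: diam_weight_def intro!: ennreal_leI)
  qed
  thus "\<exists>V\<in>{U. E \<subseteq> (\<Union>i. U i) \<and> (\<forall>i. bounded (U i) \<and> diameter (U i) \<le> \<delta>)}.
    (\<Sum>i. diam_weight t (V i)) \<le> (\<Sum>i. diam_weight s (U i))"
    using U by (intro bexI[of _ U] suminf_le) auto
qed

text \<open>To bound \<open>hausdorff_pre\<close> from below it is enough to consider covers by open balls, at the price
  of a factor \<open>2\<^sup>t\<close> and of arbitrarily small summable radii.\<close>

lemma hausdorff_pre_pos_of_ball_covers:
  fixes E :: "'a::metric_space set"
  assumes t: "0 < t" and c: "0 < c"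
    and balls: "\<And>x r. E \<subseteq> (\<Union>i::nat. ball (x i) (r i)) \<Longrightarrow> (\<And>i. 0 < r i \<and> r i \<le> 1/2) \<Longrightarrow>
       ennreal c \<le> (\<Sum>i. ennreal (r i powr t))"
  shows "0 < hausdorff_pre t (1/4) E"
proof -
  define b where "b = 2 powr t"
  have b: "0 < b" by (simp add: b_def)
  have "ennreal (c / (2 * b)) \<le> hausdorff_pre t (1/4) E"
    unfolding hausdorff_pre_def
  proof (rule INF_greatest)
    fix U assume "U \<in> {U :: nat \<Rightarrow> 'a set. E \<subseteq> (\<Union>i. U i) \<and> (\<forall>i. bounded (U i) \<and> diameter (U i) \<le> 1/4)}"
    hence U: "E \<subseteq> (\<Union>i. U i)" "\<And>i. bounded (U i)" "\<And>i. diameter (U i) \<le> 1/4" by auto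
    \<comment> \<open>The radii are enlarged so that even sets of diameter 0 get genuine balls. The
      powers of the enlargements add up to at most \<open>c / (2 * b)\<close>, so that half of
      \<open>c\<close> survives after multiplication by \<open>b\<close>; the cap 1/4 keeps the
      radii at most 1/2.\<close>
    define \<epsilon> where "\<epsilon> i = min (1/4) ((c / (2 * b) * (1/2) ^ Suc i) powr (1/t))" for i
    have \<epsilon>: "0 < \<epsilon> i" "\<epsilon> i \<le> 1/4" "\<epsilon> i powr t \<le> c / (2 * b) * (1/2) ^ Suc i" for i
    proof -
      have p: "0 < c / (2 * b) * (1/2) ^ Suc i" using c b by simp
      show "0 < \<epsilon> i" "\<epsilon> i \<le> 1/4" using c b by (simp_all add: \<epsilon>_def)
      have "\<epsilon> i powr t \<le> ((c / (2 * b) * (1/2) ^ Suc i) powr (1/t)) powr t"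
        using t \<open>0 < \<epsilon> i\<close> by (intro powr_mono2) (auto simp: \<epsilon>_def)
      also have "\<dots> = c / (2 * b) * (1/2) ^ Suc i"
      proof -
        have "(z powr (1/t)) powr t = z" if "0 < z" for z using that t by (simp add: powr_powr)
        from this[OF p] show ?thesis .
      qed
      finally show "\<epsilon> i powr t \<le> c / (2 * b) * (1/2) ^ Suc i" .
    qed
    define r where "r i = diameter (U i) + \<epsilon> i" for i
    \<comment> \<open>The centre is arbitrary when \<open>U i\<close> is empty; there is then
      nothing to cover.\<close>
    define x where "x i = (SOME y. y \<in> U i)" for i
    have d0: "0 \<le> diameter (U i)" for i by (rule diameter_ge_0[OF U(2)])
    have "U i \<subseteq> ball (x i) (r i)" for i
    proof
      fix y assume y: "y \<in> U i"
      hence "x i \<in> U i" unfolding x_def by (rule someI)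
      hence "dist (x i) y \<le> diameter (U i)" using y by (intro diameter_bounded_bound U)
      thus "y \<in> ball (x i) (r i)" using \<epsilon>(1)[of i] by (simp add: r_def)
    qed
    hence "(\<Union>i. U i) \<subseteq> (\<Union>i. ball (x i) (r i))" by (intro UN_mono order_refl)
    with U(1) have cover: "E \<subseteq> (\<Union>i. ball (x i) (r i))" by (rule order_trans)
    have r: "0 < r i \<and> r i \<le> 1/2" for i using d0[of i] U(3)[of i] \<epsilon>(1,2)[of i] by (simp add: r_def)
    have rle: "ennreal (r i powr t) \<le> ennreal b * diam_weight t (U i) + ennreal (c / 2 * (1/2) ^ Suc i)" for i
    proof -
      have "r i \<le> 2 * max (diameter (U i)) (\<epsilon> i)" by (simp add: r_def)
      hence "r i powr t \<le> (2 * max (diameter (U i)) (\<epsilon> i)) powr t"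
        using r[of i] t by (intro powr_mono2) auto
      also have "\<dots> = b * max (diameter (U i)) (\<epsilon> i) powr t" unfolding b_def using \<epsilon>(1)[of i]
        by (intro powr_mult)
      also have "\<dots> \<le> b * (diameter (U i) powr t + \<epsilon> i powr t)"
        using b by (intro mult_left_mono) (auto simp: max_def)
      also have "\<dots> \<le> b * (diameter (U i) powr t + c / (2 * b) * (1/2) ^ Suc i)"
        using b \<epsilon>(3)[of i] by (intro mult_left_mono add_left_mono) auto
      also have "\<dots> = b * diameter (U i) powr t + c / 2 * (1/2) ^ Suc i" using b by (simp add: field_simps)
      finally have "ennreal (r i powr t) \<le> ennreal (b * diameter (U i) powr t + c / 2 * (1/2) ^ Suc i)"
        by (rule ennreal_leI)
      also have "\<dots> = ennreal b * ennreal (diameter (U i) powr t) + ennreal (c / 2 * (1/2) ^ Suc i)"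
        using b c by (simp add: ennreal_plus ennreal_mult)
      also have "ennreal (diameter (U i) powr t) \<le> diam_weight t (U i)"
        using t by (simp add: diam_weight_def)
      finally show ?thesis by (simp add: mult_left_mono add_right_mono)
    qed
    have half: "(\<Sum>i. ennreal (c / 2 * (1/2) ^ Suc i)) = ennreal (c / 2)"
    proof -
      have "(\<lambda>i. c / 2 * (1/2) ^ Suc i) sums (c / 2 * 1)" by (rule sums_mult[OF power_half_series])
      thus ?thesis using c by (intro suminf_ennreal_eq) auto
    qed
    have "ennreal c \<le> (\<Sum>i. ennreal (r i powr t))" by (rule balls[OF cover r])
    also have "\<dots> \<le> (\<Sum>i. ennreal b * diam_weight t (U i) + ennreal (c / 2 * (1/2) ^ Suc i))"
      by (intro suminf_le rle) auto
    also have "\<dots> = ennreal b * (\<Sum>i. diam_weight t (U i)) + ennreal (c / 2)"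
      by (subst suminf_add[symmetric]) (auto simp: half[simplified])
    finally have "ennreal (c / 2) + ennreal (c / 2) \<le> ennreal b * (\<Sum>i. diam_weight t (U i)) + ennreal (c / 2)"
      using c by (simp flip: ennreal_plus)
    hence *: "ennreal (c / 2) \<le> ennreal b * (\<Sum>i. diam_weight t (U i))"
      by (simp add: ennreal_add_left_cancel_le add.commute)
    have "ennreal (c / (2 * b)) = ennreal (1 / b) * ennreal (c / 2)"
      using b c by (simp flip: ennreal_mult)
    also have "\<dots> \<le> ennreal (1 / b) * (ennreal b * (\<Sum>i. diam_weight t (U i)))"
      using * by (rule mult_left_mono) simp
    also have "\<dots> = ennreal (1 / b * b) * (\<Sum>i. diam_weight t (U i))"
      using b by (simp only: mult.assoc[symmetric] ennreal_mult[symmetric] less_imp_le zero_le_divide_1_iff)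
    also have "\<dots> = (\<Sum>i. diam_weight t (U i))" using b by simp
    finally show "ennreal (c / (2 * b)) \<le> (\<Sum>i. diam_weight t (U i))" .
  qed
  moreover have "0 < ennreal (c / (2 * b))" using b c by simp
  ultimately show ?thesis by (rule less_le_trans[rotated])
qed

text \<open>There is a rational exponent strictly between any candidate below \<open>s\<close> and
  \<open>s\<close>. Restricting to rationals leaves countably many exceptional null sets when this
  is applied to almost every \<open>a\<close>.\<close>

lemma hausdorff_dim_ge:
  assumes "\<And>t. 0 < t \<Longrightarrow> t \<in> \<rat> \<Longrightarrow> ereal t < s \<Longrightarrow> \<exists>\<delta>. 0 < \<delta> \<and> \<delta> \<le> 1 \<and> 0 < hausdorff_pre t \<delta> E"
  shows "s \<le> hausdorff_dim E"
  unfolding hausdorff_dim_def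
proof (rule INF_greatest)
  fix x assume "x \<in> {x. 0 \<le> x \<and> hausdorff_measure x E = 0}"
  hence x: "0 \<le> x" "hausdorff_measure x E = 0" by auto
  show "s \<le> ereal x"
  proof (rule ccontr)
    assume "\<not> s \<le> ereal x"
    hence "ereal x < s" by simp
    then obtain y where y: "ereal x < ereal y" "ereal y < s" using ereal_dense2[of "ereal x" s] by blast
    then obtain t where t: "t \<in> \<rat>" "x < t" "t < y" using Rats_dense_in_real[of x y] by auto
    have "ereal t < s" using t(3) y(2) by (meson ereal_less_eq(3) less_imp_le order_le_less_trans)
    then obtain \<delta> where \<delta>: "0 < \<delta>" "\<delta> \<le> 1" "0 < hausdorff_pre t \<delta> E"
      using assms[of t] t x(1) by auto
    have "hausdorff_pre t \<delta> E \<le> hausdorff_pre x \<delta> E"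
      by (rule hausdorff_pre_antimono_exponent[OF x(1) t(2) \<delta>(2)])
    also have "\<dots> \<le> hausdorff_measure x E"
      unfolding hausdorff_measure_def by (rule SUP_upper) (use \<delta> in simp)
    finally show False using \<delta>(3) x(2) by simp
  qed
qed

section \<open>Compactness of the attractor and approximation by truncated points\<close>

lemma compact_inf_words: "compact (inf_words n)"
proof -
  have eq: "inf_words n = PiE UNIV (\<lambda>j. {1..n (Suc j)})"
    by (simp add: inf_words_def set_eq_iff PiE_iff)
  have "compactin euclidean {1..n (Suc j)}" for j
    unfolding compactin_euclidean_iff by (rule finite_imp_compact) simp
  hence "compactin (product_topology (\<lambda>_::nat. euclidean) UNIV) (PiE UNIV (\<lambda>j. {1..n (Suc j)}))"
    unfolding compactin_PiE by blast
  thus ?thesis unfolding euclidean_product_topology compactin_euclidean_iff eq .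
qed

lemma continuous_on_prefix_word: "continuous_on A (\<lambda>w. f (prefix_word w m) :: 'b::topological_space)"
  unfolding continuous_on
proof
  fix w assume "w \<in> A"
  define S where "S = (\<Inter>j\<in>{..<m}. (\<lambda>v::nat\<Rightarrow>nat. v j) -` {w j})"
  have "open ((\<lambda>v::nat\<Rightarrow>nat. v j) -` {w j})" for j
    by (rule open_vimage[OF open_discrete]) simp
  hence "open S" unfolding S_def by (intro open_INT ballI) auto
  moreover have "w \<in> S" by (simp add: S_def)
  moreover have "f (prefix_word v m) = f (prefix_word w m)" if "v \<in> S" for v
  proof -
    have "prefix_word v m = prefix_word w m" using that by (simp add: S_def prefix_word_def)
    thus ?thesis by simp
  qed
  ultimately have "eventually (\<lambda>v. f (prefix_word v m) = f (prefix_word w m)) (at w within A)"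
    unfolding eventually_at_topological by blast
  thus "((\<lambda>w. f (prefix_word w m)) \<longlongrightarrow> f (prefix_word w m)) (at w within A)"
    by (rule tendsto_eventually)
qed

context affine_system
begin

lemma trunc_error_tendsto: "(\<lambda>m. norm a / (1 - \<eta>) * \<eta> ^ m) \<longlonglongrightarrow> 0"
proof -
  have "(\<lambda>m. norm a / (1 - \<eta>) * \<eta> ^ m) \<longlonglongrightarrow> norm a / (1 - \<eta>) * 0"
    using eta by (intro tendsto_mult tendsto_const LIMSEQ_realpow_zero) auto
  thus ?thesis by simp
qed

text \<open>The coding map is a uniform limit of maps that depend on finitely many letters and are
  thus locally constant on a compact space.\<close>

lemma compact_affine_set: "compact (affine_set n T idx a)"
proof -
  have "uniform_limit (inf_words n) (\<lambda>m w. trunc_pt a (prefix_word w m)) (proj_pt T idx a) sequentially"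
  proof (rule uniform_limitI)
    fix e :: real assume "0 < e"
    hence "eventually (\<lambda>m. norm a / (1 - \<eta>) * \<eta> ^ m < e) sequentially"
      by (rule order_tendstoD(2)[OF trunc_error_tendsto])
    thus "\<forall>\<^sub>F m in sequentially. \<forall>w\<in>inf_words n. dist (trunc_pt a (prefix_word w m)) (proj_pt T idx a w) < e"
    proof (rule eventually_mono, intro ballI)
      fix m w assume "norm a / (1 - \<eta>) * \<eta> ^ m < e" "w \<in> inf_words n"
      thus "dist (trunc_pt a (prefix_word w m)) (proj_pt T idx a w) < e"
        using dist_proj_pt_trunc_pt[of w a m] by (simp add: dist_commute)
    qed
  qed
  hence "continuous_on (inf_words n) (proj_pt T idx a)"
    by (rule uniform_limit_theorem[rotated])
      (auto intro!: always_eventually continuous_on_prefix_word[where f = "trunc_pt a"])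
  thus ?thesis unfolding affine_set_def by (rule compact_continuous_image) (rule compact_inf_words)
qed

text \<open>This replaces weak convergence of measures: by compactness the attractor keeps a
  distance from the complement of \<open>U\<close>, and truncated points approach it uniformly, so
  measures of deep level live inside \<open>U\<close> with room to spare.\<close>

lemma eventually_trunc_ball_subset:
  assumes "open U" "affine_set n T idx a \<subseteq> U"
  obtains e where "0 < e" "\<forall>\<^sub>F k in sequentially. \<forall>u\<in>words n k. ball (trunc_pt a u) e \<subseteq> U"
proof -
  let ?E = "affine_set n T idx"
  obtain e where e: "0 < e" "(\<Union>x\<in>?E a. ball x e) \<subseteq> U"
    using compact_subset_open_imp_ball_epsilon_subset[OF compact_affine_set assms] .
  have "eventually (\<lambda>m. norm a / (1 - \<eta>) * \<eta> ^ m < e / 2) sequentially"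
    by (rule order_tendstoD(2)[OF trunc_error_tendsto]) (use e in simp)
  hence "\<forall>\<^sub>F k in sequentially. \<forall>u\<in>words n k. ball (trunc_pt a u) (e / 2) \<subseteq> U"
  proof (rule eventually_mono, intro ballI subsetI)
    fix k u y assume k: "norm a / (1 - \<eta>) * \<eta> ^ k < e / 2" and u: "u \<in> words n k"
      and y: "y \<in> ball (trunc_pt a u) (e / 2)"
    obtain w where w: "w \<in> inf_words n" "prefix_word w k = u" by (rule words_extend[OF n_ge_1 u])
    have "dist (proj_pt T idx a w) (trunc_pt a u) < e / 2"
      using dist_proj_pt_trunc_pt[OF w(1), of a k] k unfolding w(2) by linarith
    hence "dist (proj_pt T idx a w) y < e"
      using y dist_triangle[of "proj_pt T idx a w" y "trunc_pt a u"] by simp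
    moreover have "proj_pt T idx a w \<in> ?E a" using w by (simp add: affine_set_def)
    ultimately have "y \<in> (\<Union>x\<in>?E a. ball x e)" by (intro UN_I) auto
    thus "y \<in> U" using e(2) by (rule rev_subsetD)
  qed
  thus thesis using that[of "e / 2"] e(1) by simp
qed

lemma eventually_levels:
  assumes "\<forall>\<^sub>F k in sequentially. P k" "\<And>J. J \<le> \<kappa> J"
  shows "\<forall>\<^sub>F J in sequentially. P (\<kappa> J)"
proof -
  obtain N where "\<forall>k\<ge>N. P k" using assms(1) by (auto simp: eventually_sequentially)
  hence "\<forall>J\<ge>N. P (\<kappa> J)" using assms(2) order_trans by blast
  thus ?thesis by (auto simp: eventually_sequentially)
qed

section \<open>Mass distribution at a finite level\<close>

text \<open>Words of small discrete energy carry at least half of the mass, and a ball of radius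
  \<open>r\<close> that meets one of them holds at most \<open>2 * B * 4 powr t * r powr t\<close>
  of that mass. Since finitely many balls cover, one level \<open>J\<close> with bounded energy can
  be deep enough for all of them.\<close>

lemma ball_cover_lower_bound:
  assumes fr: "\<And>J. frostman s C (\<kappa> J) (w J)" and \<kappa>: "\<And>J. J \<le> \<kappa> J" and B: "0 < B" and t: "0 < t"
    and freq: "\<exists>\<^sub>F J in sequentially. (\<Sum>j\<le>J. (2 powr t) ^ j * pair_sum (w J) (\<kappa> J) ((1/2) ^ j) a) \<le> B"
    and cover: "affine_set n T idx a \<subseteq> (\<Union>i::nat. ball (x i) (r i))" and r: "\<And>i. 0 < r i \<and> r i \<le> 1/2"
  shows "ennreal (1 / (4 * B * 4 powr t)) \<le> (\<Sum>i. ennreal (r i powr t))"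
proof -
  let ?E = "affine_set n T idx"
  obtain I where I: "finite I" "?E a \<subseteq> (\<Union>i\<in>I. ball (x i) (r i))"
    by (rule compactE_image[OF compact_affine_set, of UNIV "\<lambda>i. ball (x i) (r i)" a])
      (use cover in \<open>auto intro: that\<close>)
  have "open (\<Union>i\<in>I. ball (x i) (r i))" by (intro open_UN ballI open_ball)
  then obtain e where e: "0 < e" "\<forall>\<^sub>F k in sequentially. \<forall>u\<in>words n k. ball (trunc_pt a u) e \<subseteq> (\<Union>i\<in>I. ball (x i) (r i))"
    by (rule eventually_trunc_ball_subset[OF _ I(2)]) (rule that; assumption)
  \<comment> \<open>The scale matching each ball must be among the scales \<open>j \<le> J\<close>
    that the truncated energy sees.\<close>
  have "\<forall>\<^sub>F J in sequentially. \<forall>i\<in>I. (1/2) ^ J < 2 * r i"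
  proof (rule eventually_ball_finite[OF I(1)], rule ballI)
    fix i assume "i \<in> I"
    have "(\<lambda>J. (1/2 :: real) ^ J) \<longlonglongrightarrow> 0" by (rule LIMSEQ_realpow_zero) auto
    thus "\<forall>\<^sub>F J in sequentially. (1/2) ^ J < 2 * r i"
      by (rule order_tendstoD(2)) (use r[of i] in simp)
  qed
  moreover have "\<forall>\<^sub>F J in sequentially. \<forall>u\<in>words n (\<kappa> J). ball (trunc_pt a u) e \<subseteq> (\<Union>i\<in>I. ball (x i) (r i))"
    by (rule eventually_levels[OF e(2) \<kappa>])
  ultimately have "\<forall>\<^sub>F J in sequentially. (\<forall>i\<in>I. (1/2) ^ J < 2 * r i) \<and>
     (\<forall>u\<in>words n (\<kappa> J). ball (trunc_pt a u) e \<subseteq> (\<Union>i\<in>I. ball (x i) (r i)))"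
    by (rule eventually_conj)
  from frequently_ex[OF frequently_eventually_conj[OF freq this]]
  obtain J where "((\<forall>i\<in>I. (1/2) ^ J < 2 * r i) \<and>
     (\<forall>u\<in>words n (\<kappa> J). ball (trunc_pt a u) e \<subseteq> (\<Union>i\<in>I. ball (x i) (r i)))) \<and>
     (\<Sum>j\<le>J. (2 powr t) ^ j * pair_sum (w J) (\<kappa> J) ((1/2) ^ j) a) \<le> B" by (rule exE)
  hence J: "\<And>i. i \<in> I \<Longrightarrow> (1/2) ^ J < 2 * r i"
    "\<And>u. u \<in> words n (\<kappa> J) \<Longrightarrow> ball (trunc_pt a u) e \<subseteq> (\<Union>i\<in>I. ball (x i) (r i))"
    "(\<Sum>j\<le>J. (2 powr t) ^ j * pair_sum (w J) (\<kappa> J) ((1/2) ^ j) a) \<le> B" by simp_all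
  define W where "W = words n (\<kappa> J)"
  define p where "p = w J"
  define \<beta> where "\<beta> = 2 powr t"
  have \<beta>: "0 < \<beta>" by (simp add: \<beta>_def)
  have finW: "finite W" by (simp add: W_def finite_words)
  have p: "0 \<le> p v" "sum p W = 1" for v using fr[of J] by (auto simp: frostman_def p_def W_def)
  define m where "m j u = (\<Sum>v\<in>W. p v * (if dist (trunc_pt a u) (trunc_pt a v) \<le> (1/2) ^ j then 1 else 0))" for j u
  have m0: "0 \<le> m j u" for j u unfolding m_def using p(1) by (intro sum_nonneg) auto
  define G where "G u = (\<Sum>j\<le>J. \<beta> ^ j * m j u)" for u
  have G0: "0 \<le> G u" for u unfolding G_def using m0 \<beta> by (intro sum_nonneg) auto
  have pG: "(\<Sum>u\<in>W. p u * G u) \<le> B"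
  proof -
    have "(\<Sum>u\<in>W. p u * G u) = (\<Sum>j\<le>J. \<Sum>u\<in>W. p u * (\<beta> ^ j * m j u))"
      unfolding G_def sum_distrib_left by (rule sum.swap)
    also have "\<dots> = (\<Sum>j\<le>J. \<beta> ^ j * pair_sum p (\<kappa> J) ((1/2) ^ j) a)"
      unfolding pair_sum_def m_def W_def sum_distrib_left by (intro sum.cong) (auto simp: mult_ac)
    finally show ?thesis using J(3) by (simp add: \<beta>_def p_def)
  qed
  \<comment> \<open>By Markov's inequality the words outside have total mass at most 1/2.\<close>
  define A where "A = {u\<in>W. G u \<le> 2 * B}"
  let ?P = "\<lambda>i. {u\<in>A. trunc_pt a u \<in> ball (x i) (r i)}"
  have massA: "1/2 \<le> sum p A"
  proof -
    have "sum p (W - A) * (2 * B) = (\<Sum>u\<in>W - A. p u * (2 * B))" by (simp add: sum_distrib_right)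
    also have "\<dots> \<le> (\<Sum>u\<in>W - A. p u * G u)"
      using p(1) by (intro sum_mono mult_left_mono) (auto simp: A_def)
    also have "\<dots> \<le> (\<Sum>u\<in>W. p u * G u)" using finW p(1) G0 by (intro sum_mono2) auto
    also have "\<dots> \<le> B" by (rule pG)
    finally have "sum p (W - A) \<le> 1/2" using B by (simp add: field_simps)
    moreover have "sum p W = sum p A + sum p (W - A)"
      using finW by (subst sum.subset_diff[of A W]) (auto simp: A_def)
    ultimately show ?thesis using p(2) by simp
  qed
  have piece: "sum p (?P i) \<le> 2 * B * 4 powr t * r i powr t" if i: "i \<in> I" for i
  proof (cases "?P i = {}")
    case True
    thus ?thesis using B by (simp only: sum.empty) simp
  next
    case False
    then obtain u0 where u0: "u0 \<in> A" "trunc_pt a u0 \<in> ball (x i) (r i)" by blast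
    \<comment> \<open>The dyadic scale with \<open>(1/2) ^ Suc j < 2 * r i \<le> (1/2) ^ j\<close>.
      The upper inequality puts all points of the ball within one scale of each other, the lower one
      gives \<open>(1/2) ^ j < 4 * r i\<close>; at \<open>j = 0\<close> the assumption
      \<open>r i \<le> 1/2\<close> is used.\<close>
    define j where "j = (LEAST j. (1/2 :: real) ^ Suc j < 2 * r i)"
    have "(1/2 :: real) ^ Suc J < 2 * r i"
    proof -
      have "(1/2 :: real) ^ Suc J \<le> (1/2) ^ J" by simp
      thus ?thesis using J(1)[OF i] by linarith
    qed
    hence j1: "(1/2 :: real) ^ Suc j < 2 * r i" and jJ: "j \<le> J"
      unfolding j_def by (rule LeastI, rule Least_le)
    have j2: "2 * r i \<le> (1/2) ^ j"
    proof (cases j)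
      case 0
      thus ?thesis using r[of i] by simp
    next
      case (Suc j')
      have "\<not> (1/2 :: real) ^ Suc j' < 2 * r i"
        using not_less_Least[of j' "\<lambda>j. (1/2 :: real) ^ Suc j < 2 * r i"] Suc unfolding j_def by simp
      thus ?thesis using Suc by simp
    qed
    have "sum p (?P i) \<le> m j u0"
    proof -
      have "sum p (?P i)
        \<le> sum p {v\<in>W. dist (trunc_pt a u0) (trunc_pt a v) \<le> (1/2) ^ j}"
      proof (rule sum_mono2)
        show "?P i \<subseteq> {v\<in>W. dist (trunc_pt a u0) (trunc_pt a v) \<le> (1/2) ^ j}"
        proof
          fix v assume v: "v \<in> ?P i"
          have "dist (trunc_pt a u0) (trunc_pt a v) \<le> dist (x i) (trunc_pt a u0) + dist (x i) (trunc_pt a v)"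
            by (rule dist_triangle3)
          also have "\<dots> \<le> 2 * r i" using v u0 by simp
          finally have "dist (trunc_pt a u0) (trunc_pt a v) \<le> (1/2) ^ j" using j2 by linarith
          thus "v \<in> {v\<in>W. dist (trunc_pt a u0) (trunc_pt a v) \<le> (1/2) ^ j}" using v by (simp add: A_def)
        qed
      qed (use finW p(1) in auto)
      also have "\<dots> = m j u0" unfolding m_def using finW
        by (simp add: sum.inter_filter[symmetric] if_distrib cong: if_cong)
      finally show ?thesis .
    qed
    also have "m j u0 \<le> 2 * B / \<beta> ^ j"
    proof -
      have "\<beta> ^ j * m j u0 \<le> G u0"
        unfolding G_def by (rule member_le_sum) (use jJ m0 \<beta> in auto)
      also have "\<dots> \<le> 2 * B" using u0(1) by (simp add: A_def)
      finally show ?thesis using \<beta> by (simp add: field_simps)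
    qed
    also have "2 * B / \<beta> ^ j = 2 * B * ((1/2) ^ j) powr t"
    proof -
      have "((1/2 :: real) ^ j) powr t = ((1/2) powr t) ^ j" by (simp add: powr_realpow[symmetric] powr_powr mult.commute)
      also have "(1/2 :: real) powr t = 1 / \<beta>" by (simp add: \<beta>_def powr_divide)
      finally show ?thesis by (simp add: power_divide)
    qed
    also have "\<dots> \<le> 2 * B * (4 * r i) powr t"
      using j1 B t r[of i] by (intro mult_left_mono powr_mono2) auto
    also have "(4 * r i) powr t = 4 powr t * r i powr t" using r[of i] by (intro powr_mult)
    finally show ?thesis by (simp add: mult.assoc)
  qed
  have "A \<subseteq> (\<Union>i\<in>I. ?P i)"
  proof
    fix u assume u: "u \<in> A"
    hence "u \<in> words n (\<kappa> J)" by (simp add: A_def W_def)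
    moreover have "trunc_pt a u \<in> ball (trunc_pt a u) e" using e(1) by simp
    ultimately have "trunc_pt a u \<in> (\<Union>i\<in>I. ball (x i) (r i))" using J(2) by blast
    then obtain i where "i \<in> I" "trunc_pt a u \<in> ball (x i) (r i)" by (rule UN_E)
    thus "u \<in> (\<Union>i\<in>I. ?P i)" using u by (intro UN_I) auto
  qed
  hence "sum p A \<le> sum p (\<Union>i\<in>I. ?P i)"
    using finW I(1) p(1) by (intro sum_mono2) (auto simp: A_def)
  also have "\<dots> \<le> (\<Sum>i\<in>I. sum p (?P i))"
    using finW I(1) p(1) by (intro sum_UN_le) (auto simp: A_def)
  also have "\<dots> \<le> (\<Sum>i\<in>I. 2 * B * 4 powr t * r i powr t)" by (intro sum_mono piece)
  also have "\<dots> = 2 * B * 4 powr t * (\<Sum>i\<in>I. r i powr t)" by (simp add: sum_distrib_left)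
  finally have "1/2 \<le> 2 * B * 4 powr t * (\<Sum>i\<in>I. r i powr t)" using massA by linarith
  hence "1 / (4 * B * 4 powr t) \<le> (\<Sum>i\<in>I. r i powr t)" using B by (simp add: field_simps)
  hence "ennreal (1 / (4 * B * 4 powr t)) \<le> ennreal (\<Sum>i\<in>I. r i powr t)" by (rule ennreal_leI)
  also have "\<dots> = (\<Sum>i\<in>I. ennreal (r i powr t))" by (intro sum_ennreal[symmetric]) simp
  also have "\<dots> \<le> (\<Sum>i. ennreal (r i powr t))" by (rule sum_le_suminf) (use I(1) in auto)
  finally show ?thesis .
qed

lemma AE_hausdorff_pre_pos:
  assumes t: "0 < t'" "t' < t" "t < s" "t \<le> real CARD('d)" and nz: "net_measure n T s (inf_words n) \<noteq> 0"
  shows "AE a in lborel. 0 < hausdorff_pre t' (1/4) (affine_set n T idx a)"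
proof (rule AE_cball_all)
  let ?E = "affine_set n T idx"
  fix \<rho> :: nat
  have s0: "0 < s" and t0: "0 \<le> t" using t by auto
  obtain C w \<kappa> where C: "0 < C" and fr: "\<And>J. frostman s C (\<kappa> J) (w J)"
    and \<kappa>: "\<And>J. (\<eta> ^ \<kappa> J) powr s \<le> ((1/2) ^ J) powr t" "\<And>J. J \<le> \<kappa> J"
    by (rule frostman_levels[OF s0 nz t0]) (rule that; assumption)
  let ?F = "\<lambda>J r a. ennreal (pair_sum (w J) (\<kappa> J) r a) * indicator (cball 0 (real \<rho>)) a"
  define D where "D = energy_const (real \<rho>) s t C"
  have D: "0 \<le> D" unfolding D_def using energy_const_nonneg C t by auto
  define \<beta> where "\<beta> = 2 powr t'"
  have \<beta>: "0 < \<beta>" by (simp add: \<beta>_def)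
  define \<gamma> where "\<gamma> = (2::real) powr (t' - t)"
  have \<gamma>: "0 \<le> \<gamma>" "\<gamma> < 1" using t by (auto simp: \<gamma>_def powr_less_one)
  \<comment> \<open>A dyadic energy of exponent \<open>t'\<close> cut off at scale \<open>J\<close>,
    localised to a ball of parameters.\<close>
  define f where "f J a = (\<Sum>j\<le>J. ennreal (\<beta> ^ j) * (?F J ((1/2) ^ j) a))" for J and a :: "real^'d^'tau"
  have mp: "(\<lambda>a. ennreal (pair_sum (w J) (\<kappa> J) r a)) \<in> borel_measurable lborel" for J r
    by (rule pair_sum_measurable)
  have mi: "(indicator (cball 0 (real \<rho>)) :: real^'d^'tau \<Rightarrow> ennreal) \<in> borel_measurable lborel"
    by (rule borel_measurable_indicator) simp
  have mg: "(\<lambda>a. ?F J r a) \<in> borel_measurable lborel" for J r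
    by (rule borel_measurable_times_ennreal[OF mp mi])
  have fm: "f J \<in> borel_measurable lborel" for J unfolding f_def[abs_def]
    by (intro borel_measurable_sum borel_measurable_times_ennreal[OF borel_measurable_const mg])
  have fi: "(\<integral>\<^sup>+a. f J a \<partial>lborel) \<le> ennreal (2 * D / (1 - \<gamma>))" for J
  proof -
    have "(\<integral>\<^sup>+a. f J a \<partial>lborel) = (\<Sum>j\<le>J. ennreal (\<beta> ^ j) * (\<integral>\<^sup>+a. ?F J ((1/2) ^ j) a \<partial>lborel))"
      unfolding f_def
      by (subst nn_integral_sum, rule borel_measurable_times_ennreal[OF borel_measurable_const mg],
          intro sum.cong refl nn_integral_cmult mg)
    also have "\<dots> \<le> (\<Sum>j\<le>J. ennreal (2 * D * \<gamma> ^ j))"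
    proof (rule sum_mono)
      fix j assume j: "j \<in> {..J}"
      have "(\<integral>\<^sup>+a. ?F J ((1/2) ^ j) a \<partial>lborel)
        \<le> ennreal (D * (((1/2) ^ j) powr t + (\<eta> ^ \<kappa> J) powr s))"
        unfolding D_def by (rule pair_sum_integral_le[OF t0 t(4,3) fr]) (use C in auto)
      also have "\<dots> \<le> ennreal (D * (2 * ((1/2) ^ j) powr t))"
      proof (intro ennreal_leI mult_left_mono D)
        \<comment> \<open>The level was chosen for the finest scale, so the diagonal term is
          absorbed at every coarser scale as well.\<close>
        have "((1/2 :: real) ^ J) powr t \<le> ((1/2) ^ j) powr t"
          using j t0 by (intro powr_mono2 power_decreasing) auto
        thus "((1/2) ^ j) powr t + (\<eta> ^ \<kappa> J) powr s \<le> 2 * ((1/2) ^ j) powr t" using \<kappa>(1)[of J] by linarith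
      qed
      finally have "ennreal (\<beta> ^ j) * (\<integral>\<^sup>+a. ?F J ((1/2) ^ j) a \<partial>lborel)
        \<le> ennreal (\<beta> ^ j) * ennreal (D * (2 * ((1/2) ^ j) powr t))" by (rule mult_left_mono) simp
      also have "\<dots> = ennreal (\<beta> ^ j * (D * (2 * ((1/2) ^ j) powr t)))"
        using \<beta> D by (intro ennreal_mult[symmetric]) auto
      also have "\<beta> ^ j * (D * (2 * ((1/2) ^ j) powr t)) = 2 * D * \<gamma> ^ j"
      proof -
        have "((1/2 :: real) ^ j) powr t = ((1/2) powr t) ^ j" by (simp add: powr_realpow[symmetric] powr_powr mult.commute)
        moreover have "\<beta> * (1/2) powr t = \<gamma>" by (simp add: \<beta>_def \<gamma>_def powr_diff powr_divide)
        ultimately show ?thesis by (simp add: power_mult_distrib[symmetric] mult_ac)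
      qed
      finally show "ennreal (\<beta> ^ j) * (\<integral>\<^sup>+a. ?F J ((1/2) ^ j) a \<partial>lborel) \<le> ennreal (2 * D * \<gamma> ^ j)" .
    qed
    also have "\<dots> = ennreal (2 * D * (\<Sum>j<Suc J. \<gamma> ^ j))"
      using D \<gamma> by (subst sum_ennreal) (auto simp: sum_distrib_left lessThan_Suc_atMost)
    also have "\<dots> \<le> ennreal (2 * D * (1 / (1 - \<gamma>)))"
      using D \<gamma> by (intro ennreal_leI mult_left_mono sum_power_le_geometric) auto
    finally show ?thesis by simp
  qed
  from AE_frequently_bounded[OF fm fi]
  show "AE a in lborel. a \<in> cball 0 (real \<rho>) \<longrightarrow> 0 < hausdorff_pre t' (1/4) (?E a)"
  proof (rule AE_mp, intro AE_I2 impI)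
    fix a :: "real^'d^'tau"
    assume a: "a \<in> cball 0 (real \<rho>)" and "\<exists>B>0. \<exists>\<^sub>F J in sequentially. f J a \<le> ennreal B"
    then obtain B where B: "0 < B" "\<exists>\<^sub>F J in sequentially. f J a \<le> ennreal B" by blast
    have feq: "f J a = ennreal (\<Sum>j\<le>J. \<beta> ^ j * pair_sum (w J) (\<kappa> J) ((1/2) ^ j) a)" for J
    proof -
      have ps: "0 \<le> pair_sum (w J) (\<kappa> J) r a" for r
        using fr[of J] by (intro pair_sum_nonneg) (simp add: frostman_def)
      have "f J a = (\<Sum>j\<le>J. ennreal (\<beta> ^ j * pair_sum (w J) (\<kappa> J) ((1/2) ^ j) a))"
        unfolding f_def using a \<beta> ps by (intro sum.cong) (auto simp: ennreal_mult)
      also have "\<dots> = ennreal (\<Sum>j\<le>J. \<beta> ^ j * pair_sum (w J) (\<kappa> J) ((1/2) ^ j) a)"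
        using \<beta> ps by (intro sum_ennreal) auto
      finally show ?thesis .
    qed
    have freq: "\<exists>\<^sub>F J in sequentially. (\<Sum>j\<le>J. (2 powr t') ^ j * pair_sum (w J) (\<kappa> J) ((1/2) ^ j) a) \<le> B"
      using B(2) unfolding feq \<beta>_def using B(1) by (simp add: ennreal_le_iff)
    show "0 < hausdorff_pre t' (1/4) (?E a)"
    proof (rule hausdorff_pre_pos_of_ball_covers[OF t(1)])
      show "0 < 1 / (4 * B * 4 powr t')" using B by simp
      show "ennreal (1 / (4 * B * 4 powr t')) \<le> (\<Sum>i. ennreal (r i powr t'))"
        if "?E a \<subseteq> (\<Union>i::nat. ball (x i) (r i))" "\<And>i. 0 < r i \<and> r i \<le> 1/2" for x r
        by (rule ball_cover_lower_bound[OF fr \<kappa>(2) B(1) t(1) freq that])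
    qed
  qed
qed

end

section \<open>Positive Lebesgue measure\<close>

context affine_system
begin

text \<open>A null attractor would have an open neighbourhood \<open>U\<close> of measure below
  \<open>c\<close>. The inequality \<open>2 * \<mu> * f - \<mu>\<^sup>2 * f\<^sup>2 \<le> 1\<close>,
  integrated over \<open>U\<close>, is Cauchy-Schwarz in linear form and contradicts this:
  \<open>f\<close> is a density at scale \<open>r\<close> carried by \<open>U\<close>, and its
  square is controlled by the pair sum.\<close>

lemma emeasure_affine_set_pos:
  assumes fr: "\<And>J. frostman s C (\<kappa> J) (w J)" and \<kappa>: "\<And>J. J \<le> \<kappa> J" and B: "0 < B"
    and freq: "\<exists>\<^sub>F J in sequentially. pair_sum (w J) (\<kappa> J) ((1/2) ^ J) a \<le> B * ((1/2) ^ J) ^ CARD('d)"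
  shows "0 < emeasure lborel (affine_set n T idx a)"
proof (rule ccontr)
  let ?E = "affine_set n T idx a" and ?d = "CARD('d)"
  assume "\<not> 0 < emeasure lborel ?E"
  hence E0: "emeasure lborel ?E = 0" by simp
  define V where "V = unit_ball_vol (real ?d)"
  have V: "0 < V" by (simp add: V_def)
  \<comment> \<open>The value of \<open>(\<integral>f)\<^sup>2\<close> divided by the upper bound
    for the integral of \<open>f\<^sup>2\<close>; the scale \<open>r\<close> drops out.\<close>
  define c where "c = V / (2 ^ ?d * B)"
  have c: "0 < c" using V B by (simp add: c_def)
  have Eb: "?E \<in> sets borel" by (intro borel_closed compact_imp_closed compact_affine_set)
  obtain U where U: "open U" "?E \<subseteq> U" "emeasure lborel (U - ?E) < ennreal c"
    using outer_regular_lborel[OF Eb c] .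
  have Ub: "U \<in> sets borel" using U(1) by (rule borel_open)
  have "emeasure lborel U \<le> emeasure lborel ?E + emeasure lborel (U - ?E)"
  proof -
    have "U = ?E \<union> (U - ?E)" using U(2) by blast
    hence "emeasure lborel U = emeasure lborel (?E \<union> (U - ?E))" by (rule arg_cong)
    also have "\<dots> \<le> emeasure lborel ?E + emeasure lborel (U - ?E)"
      by (rule emeasure_subadditive) (use Eb Ub in auto)
    finally show ?thesis .
  qed
  hence eU: "emeasure lborel U < ennreal c" using U(3) E0 by simp
  hence finU: "emeasure lborel U < \<infinity>" by (rule less_trans) simp
  have mU: "measure lborel U < c"
  proof -
    have "emeasure lborel U = ennreal (measure lborel U)" using finU by (intro emeasure_eq_ennreal_measure) auto
    thus ?thesis using eU by (simp add: ennreal_less_iff)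
  qed
  obtain e where e: "0 < e" "\<forall>\<^sub>F k in sequentially. \<forall>u\<in>words n k. ball (trunc_pt a u) e \<subseteq> U"
    by (rule eventually_trunc_ball_subset[OF U(1,2)]) (rule that; assumption)
  have "(\<lambda>J. (1/2 :: real) ^ J) \<longlonglongrightarrow> 0" by (rule LIMSEQ_realpow_zero) auto
  hence "\<forall>\<^sub>F J in sequentially. (1/2) ^ J < e" using e(1) by (rule order_tendstoD(2))
  moreover have "\<forall>\<^sub>F J in sequentially. \<forall>u\<in>words n (\<kappa> J). ball (trunc_pt a u) e \<subseteq> U"
    by (rule eventually_levels[OF e(2) \<kappa>])
  ultimately have "\<forall>\<^sub>F J in sequentially. (1/2) ^ J < e \<and> (\<forall>u\<in>words n (\<kappa> J). ball (trunc_pt a u) e \<subseteq> U)"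
    by (rule eventually_conj)
  from frequently_ex[OF frequently_eventually_conj[OF freq this]]
  obtain J where "((1/2) ^ J < e \<and> (\<forall>u\<in>words n (\<kappa> J). ball (trunc_pt a u) e \<subseteq> U)) \<and>
     pair_sum (w J) (\<kappa> J) ((1/2) ^ J) a \<le> B * ((1/2) ^ J) ^ CARD('d)" by (rule exE)
  hence J: "(1/2) ^ J < e" "\<And>u. u \<in> words n (\<kappa> J) \<Longrightarrow> ball (trunc_pt a u) e \<subseteq> U"
     "pair_sum (w J) (\<kappa> J) ((1/2) ^ J) a \<le> B * ((1/2) ^ J) ^ CARD('d)" by simp_all
  define r where "r = (1/2 :: real) ^ J"
  have r: "0 < r" by (simp add: r_def)
  define W where "W = words n (\<kappa> J)"
  define p where "p = w J"
  have finW: "finite W" by (simp add: W_def finite_words)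
  have p: "0 \<le> p v" "sum p W = 1" for v using fr[of J] by (auto simp: frostman_def p_def W_def)
  \<comment> \<open>Radius \<open>r / 2\<close> lets two of these balls meet only if their centres
    are within \<open>r\<close>, as counted by \<open>pair_sum\<close>.\<close>
  define Q where "Q u = cball (trunc_pt a u) (r / 2)" for u
  have QU: "Q u \<subseteq> U" if "u \<in> W" for u
  proof -
    have "Q u \<subseteq> ball (trunc_pt a u) e" using J(1) r unfolding Q_def r_def[symmetric] by auto
    also have "\<dots> \<subseteq> U" using J(2) that by (simp add: W_def)
    finally show ?thesis .
  qed
  have Qm: "measure lborel (Q u) = V * (r / 2) ^ ?d" for u
    unfolding Q_def V_def using r by (subst content_cball) auto
  have Qs: "Q u \<in> sets borel" for u by (simp add: Q_def)
  have Qf: "emeasure lborel (Q u) < \<infinity>" for u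
    unfolding Q_def using emeasure_lborel_cball_finite[of "trunc_pt a u" "r / 2"] by (simp add: less_top)
  define K where "K u v = Q u \<inter> Q v" for u v
  have Ks: "K u v \<in> sets borel" for u v using Qs by (simp add: K_def)
  have Kle: "emeasure lborel (K u v) \<le> emeasure lborel (Q u)" for u v
    unfolding K_def by (rule emeasure_mono) (use Qs in auto)
  have Kf: "emeasure lborel (K u v) < \<infinity>" for u v using Kle Qf by (rule le_less_trans)
  have Km: "measure lborel (K u v) \<le> V * (r / 2) ^ ?d * (if dist (trunc_pt a u) (trunc_pt a v) \<le> r then 1 else 0)" for u v
  proof (cases "dist (trunc_pt a u) (trunc_pt a v) \<le> r")
    case True
    have "measure lborel (K u v) \<le> measure lborel (Q u)"
      unfolding measure_def using Kle Qf by (intro enn2real_mono) auto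
    thus ?thesis using True by (simp add: Qm)
  next
    case False
    have "K u v = {}"
    proof (rule ccontr)
      assume "K u v \<noteq> {}"
      then obtain y where "y \<in> K u v" by blast
      hence "dist (trunc_pt a u) y \<le> r / 2" "dist (trunc_pt a v) y \<le> r / 2" by (auto simp: K_def Q_def)
      thus False using False dist_triangle2[of "trunc_pt a u" "trunc_pt a v" y] by linarith
    qed
    thus ?thesis using False by simp
  qed
  have iQ: "integrable lborel (indicat_real (Q u))" for u
    by (rule integrable_real_indicator) (use Qs Qf in auto)
  have iK: "integrable lborel (indicat_real (K u v))" for u v
    by (rule integrable_real_indicator) (use Ks Kf in auto)
  have iU: "integrable lborel (indicat_real U)"
    by (rule integrable_real_indicator) (use Ub finU in auto)
  \<comment> \<open>The optimal multiplier: the integral of \<open>f\<close> divided by the bound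
    for the integral of \<open>f\<^sup>2\<close>.\<close>
  define \<mu> where "\<mu> = 1 / (B * r ^ ?d)"
  have \<mu>: "0 < \<mu>" using B r by (simp add: \<mu>_def)
  define f where "f x = (\<Sum>u\<in>W. p u * indicat_real (Q u) x)" for x
  define g where "g x = (\<Sum>u\<in>W. \<Sum>v\<in>W. p u * p v * indicat_real (K u v) x)" for x
  have fg: "(f x)\<^sup>2 = g x" for x
    unfolding f_def g_def power2_eq_square sum_product
    by (intro sum.cong refl) (auto simp: K_def indicator_def)
  have intf: "integrable lborel f" "integral\<^sup>L lborel f = V * (r / 2) ^ ?d"
  proof -
    show "integrable lborel f" unfolding f_def[abs_def] by (intro Bochner_Integration.integrable_sum integrable_mult_right iQ)
    have "integral\<^sup>L lborel f = (\<Sum>u\<in>W. integral\<^sup>L lborel (\<lambda>x. p u * indicat_real (Q u) x))"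
      unfolding f_def[abs_def] by (intro Bochner_Integration.integral_sum integrable_mult_right iQ)
    also have "\<dots> = (\<Sum>u\<in>W. p u * (V * (r / 2) ^ ?d))"
      using Qs by (intro sum.cong) (auto simp: Qm)
    also have "\<dots> = V * (r / 2) ^ ?d" by (simp only: sum_distrib_right[symmetric] p(2) mult_1)
    finally show "integral\<^sup>L lborel f = V * (r / 2) ^ ?d" .
  qed
  have intg: "integrable lborel g" "integral\<^sup>L lborel g \<le> V * (r / 2) ^ ?d * (B * r ^ ?d)"
  proof -
    show "integrable lborel g" unfolding g_def[abs_def] by (intro Bochner_Integration.integrable_sum integrable_mult_right iK)
    have "integral\<^sup>L lborel g = (\<Sum>u\<in>W. \<Sum>v\<in>W. integral\<^sup>L lborel (\<lambda>x. p u * p v * indicat_real (K u v) x))"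
      unfolding g_def[abs_def]
      by (subst Bochner_Integration.integral_sum, intro Bochner_Integration.integrable_sum integrable_mult_right iK,
          intro sum.cong refl Bochner_Integration.integral_sum integrable_mult_right iK)
    also have "\<dots> = (\<Sum>u\<in>W. \<Sum>v\<in>W. p u * p v * measure lborel (K u v))"
      using Ks by (intro sum.cong) auto
    also have "\<dots> \<le> (\<Sum>u\<in>W. \<Sum>v\<in>W. p u * p v * (V * (r / 2) ^ ?d * (if dist (trunc_pt a u) (trunc_pt a v) \<le> r then 1 else 0)))"
      using p(1) by (intro sum_mono mult_left_mono Km) auto
    also have "\<dots> = V * (r / 2) ^ ?d * pair_sum p (\<kappa> J) r a"
      unfolding pair_sum_def W_def sum_distrib_left by (intro sum.cong refl) (simp only: mult_ac)
    also have "\<dots> \<le> V * (r / 2) ^ ?d * (B * r ^ ?d)"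
      using J(3) V r unfolding p_def r_def[symmetric] by (intro mult_left_mono) auto
    finally show "integral\<^sup>L lborel g \<le> V * (r / 2) ^ ?d * (B * r ^ ?d)" .
  qed
  have "2 * \<mu> * (V * (r / 2) ^ ?d) - \<mu>\<^sup>2 * (V * (r / 2) ^ ?d * (B * r ^ ?d))
     \<le> 2 * \<mu> * integral\<^sup>L lborel f - \<mu>\<^sup>2 * integral\<^sup>L lborel g"
    unfolding intf(2) using intg(2) by (intro diff_left_mono mult_left_mono) auto
  also have "\<dots> = integral\<^sup>L lborel (\<lambda>x. 2 * \<mu> * f x - \<mu>\<^sup>2 * g x)"
    using intf(1) intg(1) by (subst Bochner_Integration.integral_diff) auto
  also have "\<dots> \<le> integral\<^sup>L lborel (indicat_real U)"
  proof (rule integral_mono)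
    show "integrable lborel (\<lambda>x. 2 * \<mu> * f x - \<mu>\<^sup>2 * g x)" using intf(1) intg(1) by auto
    show "2 * \<mu> * f x - \<mu>\<^sup>2 * g x \<le> indicat_real U x" for x
    proof (cases "x \<in> U")
      case True
      have "0 \<le> (1 - \<mu> * f x)\<^sup>2" by simp
      hence "2 * \<mu> * f x - \<mu>\<^sup>2 * (f x)\<^sup>2 \<le> 1" by (simp add: power2_eq_square algebra_simps)
      thus ?thesis using True by (simp add: fg)
    next
      case False
      have "f x = 0" unfolding f_def
      proof (rule sum.neutral, rule)
        fix u assume "u \<in> W"
        hence "x \<notin> Q u" using QU False by blast
        thus "p u * indicat_real (Q u) x = 0" by simp
      qed
      thus ?thesis using False fg[of x] by simp
    qed
  qed (rule iU)
  also have "\<dots> = measure lborel U" using Ub by simp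
  also have "\<dots> < c" by (rule mU)
  also have "c = 2 * \<mu> * (V * (r / 2) ^ ?d) - \<mu>\<^sup>2 * (V * (r / 2) ^ ?d * (B * r ^ ?d))"
  proof -
    have "\<mu>\<^sup>2 * (V * (r / 2) ^ ?d * (B * r ^ ?d)) = \<mu> * (V * (r / 2) ^ ?d) * (\<mu> * (B * r ^ ?d))"
      by (simp add: power2_eq_square mult_ac)
    also have "\<mu> * (B * r ^ ?d) = 1" using B r by (simp add: \<mu>_def)
    finally have "2 * \<mu> * (V * (r / 2) ^ ?d) - \<mu>\<^sup>2 * (V * (r / 2) ^ ?d * (B * r ^ ?d)) = \<mu> * (V * (r / 2) ^ ?d)"
      by linarith
    also have "\<dots> = c" using B r by (simp add: \<mu>_def c_def power_divide)
    finally show ?thesis by (rule sym)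
  qed
  finally show False by simp
qed

text \<open>With \<open>t\<close> equal to the dimension, the expected pair sum at scale
  \<open>2^-J\<close> is of order \<open>2^(-d J)\<close>, the size needed for a density with
  bounded square mean. There is no sum over scales, hence no further loss of exponent.\<close>

lemma AE_emeasure_affine_set_pos:
  assumes s: "real CARD('d) < s" and nz: "net_measure n T s (inf_words n) \<noteq> 0"
  shows "AE a in lborel. 0 < emeasure lborel (affine_set n T idx a)"
proof (rule AE_cball_all)
  let ?E = "affine_set n T idx"
  fix \<rho> :: nat
  define t where "t = real CARD('d)"
  have t: "0 \<le> t" "t \<le> real CARD('d)" "t < s" and s0: "0 < s" using s by (auto simp: t_def)
  obtain C w \<kappa> where C: "0 < C" and fr: "\<And>J. frostman s C (\<kappa> J) (w J)"
    and \<kappa>: "\<And>J. (\<eta> ^ \<kappa> J) powr s \<le> ((1/2) ^ J) powr t" "\<And>J. J \<le> \<kappa> J"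
    by (rule frostman_levels[OF s0 nz t(1)]) (rule that; assumption)
  let ?F = "\<lambda>J r a. ennreal (pair_sum (w J) (\<kappa> J) r a) * indicator (cball 0 (real \<rho>)) a"
  define D where "D = energy_const (real \<rho>) s t C"
  have D: "0 \<le> D" unfolding D_def using energy_const_nonneg C t by auto
  define \<beta> where "\<beta> = (2::real) ^ CARD('d)"
  have \<beta>: "0 < \<beta>" by (simp add: \<beta>_def)
  have half: "((1/2 :: real) ^ J) powr t = 1 / \<beta> ^ J" for J
  proof -
    have "((1/2 :: real) ^ J) powr t = ((1/2) ^ J) ^ CARD('d)" unfolding t_def by (rule powr_realpow) simp
    thus ?thesis by (simp add: \<beta>_def power_divide power_mult[symmetric] mult.commute)
  qed
  define f where "f J a = ennreal (\<beta> ^ J) * (?F J ((1/2) ^ J) a)" for J and a :: "real^'d^'tau"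
  have mi: "(indicator (cball 0 (real \<rho>)) :: real^'d^'tau \<Rightarrow> ennreal) \<in> borel_measurable lborel"
    by (rule borel_measurable_indicator) simp
  have mg: "(\<lambda>a. ?F J r a) \<in> borel_measurable lborel" for J r
    by (rule borel_measurable_times_ennreal[OF pair_sum_measurable mi])
  have fm: "f J \<in> borel_measurable lborel" for J unfolding f_def[abs_def]
    by (rule borel_measurable_times_ennreal[OF borel_measurable_const mg])
  have fi: "(\<integral>\<^sup>+a. f J a \<partial>lborel) \<le> ennreal (2 * D)" for J
  proof -
    have "(\<integral>\<^sup>+a. f J a \<partial>lborel) = ennreal (\<beta> ^ J) * (\<integral>\<^sup>+a. ?F J ((1/2) ^ J) a \<partial>lborel)"
      unfolding f_def by (rule nn_integral_cmult[OF mg])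
    also have "\<dots> \<le> ennreal (\<beta> ^ J) * ennreal (D * (((1/2) ^ J) powr t + (\<eta> ^ \<kappa> J) powr s))"
      unfolding D_def by (intro mult_left_mono pair_sum_integral_le[OF t fr]) (use C in auto)
    also have "\<dots> = ennreal (\<beta> ^ J * (D * (((1/2) ^ J) powr t + (\<eta> ^ \<kappa> J) powr s)))"
      using \<beta> D by (intro ennreal_mult[symmetric] mult_nonneg_nonneg add_nonneg_nonneg) auto
    also have "\<dots> \<le> ennreal (\<beta> ^ J * (D * (2 * (1 / \<beta> ^ J))))"
      using \<kappa>(1)[of J] \<beta> D unfolding half by (intro ennreal_leI mult_left_mono) auto
    also have "\<beta> ^ J * (D * (2 * (1 / \<beta> ^ J))) = 2 * D" using \<beta> by simp
    finally show ?thesis .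
  qed
  from AE_frequently_bounded[OF fm fi]
  show "AE a in lborel. a \<in> cball 0 (real \<rho>) \<longrightarrow> 0 < emeasure lborel (?E a)"
  proof (rule AE_mp, intro AE_I2 impI)
    fix a :: "real^'d^'tau"
    assume a: "a \<in> cball 0 (real \<rho>)" and "\<exists>B>0. \<exists>\<^sub>F J in sequentially. f J a \<le> ennreal B"
    then obtain B where B: "0 < B" "\<exists>\<^sub>F J in sequentially. f J a \<le> ennreal B" by blast
    have "pair_sum (w J) (\<kappa> J) ((1/2) ^ J) a \<le> B * ((1/2) ^ J) ^ CARD('d)" if "f J a \<le> ennreal B" for J
    proof -
      have ps: "0 \<le> pair_sum (w J) (\<kappa> J) ((1/2) ^ J) a"
        using fr[of J] by (intro pair_sum_nonneg) (simp add: frostman_def)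
      have "f J a = ennreal (\<beta> ^ J * pair_sum (w J) (\<kappa> J) ((1/2) ^ J) a)"
        unfolding f_def using a \<beta> ps by (simp add: ennreal_mult)
      hence "\<beta> ^ J * pair_sum (w J) (\<kappa> J) ((1/2) ^ J) a \<le> B"
        using that B(1) by (simp add: ennreal_le_iff)
      hence "pair_sum (w J) (\<kappa> J) ((1/2) ^ J) a \<le> B * (1 / \<beta> ^ J)" using \<beta> by (simp add: field_simps)
      moreover have "((1/2 :: real) ^ J) ^ CARD('d) = 1 / \<beta> ^ J"
        by (simp add: \<beta>_def power_divide power_mult[symmetric] mult.commute)
      ultimately show ?thesis by simp
    qed
    hence "\<exists>\<^sub>F J in sequentially. pair_sum (w J) (\<kappa> J) ((1/2) ^ J) a \<le> B * ((1/2) ^ J) ^ CARD('d)"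
      by (rule frequently_elim1[OF B(2)])
    thus "0 < emeasure lborel (?E a)" by (rule emeasure_affine_set_pos[OF fr \<kappa>(2) B(1)])
  qed
qed

section \<open>Passing to the critical exponent\<close>

lemma net_measure_nonzero: "0 \<le> s \<Longrightarrow> ereal s < s_A n T \<Longrightarrow> net_measure n T s (inf_words n) \<noteq> 0"
proof
  assume "0 \<le> s" "ereal s < s_A n T" "net_measure n T s (inf_words n) = 0"
  moreover from this have "s_A n T \<le> ereal s" unfolding s_A_def by (intro INF_lower) auto
  ultimately show False by simp
qed

lemma AE_dimension:
  assumes "s_A n T \<le> ereal (real CARD('d))"
  shows "AE a in lborel. hausdorff_dim (affine_set n T idx a) = s_A n T"
proof -
  let ?E = "affine_set n T idx"
  define Q where "Q = {t \<in> \<rat>. 0 < t \<and> ereal t < s_A n T}"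
  have "AE a in lborel. \<forall>t\<in>Q. 0 < hausdorff_pre t (1/4) (?E a)"
  proof (rule AE_ball_countable[THEN iffD2], safe)
    show "countable Q" unfolding Q_def by (rule countable_subset[OF _ countable_rat]) auto
    fix t' assume "t' \<in> Q"
    hence t': "0 < t'" "ereal t' < s_A n T" by (auto simp: Q_def)
    \<comment> \<open>The two auxiliary exponents are inserted strictly between \<open>t'\<close>
      and the critical one; \<open>t\<close> stays at most \<open>d\<close> because the critical
      exponent does.\<close>
    obtain t where t: "ereal t' < ereal t" "ereal t < s_A n T" using ereal_dense2[OF t'(2)] by blast
    obtain s where s: "ereal t < ereal s" "ereal s < s_A n T" using ereal_dense2[OF t(2)] by blast
    have "t \<le> real CARD('d)" using less_le_trans[OF t(2) assms] by simp
    moreover have "net_measure n T s (inf_words n) \<noteq> 0"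
      by (rule net_measure_nonzero) (use s t t' in auto)
    ultimately show "AE a in lborel. 0 < hausdorff_pre t' (1/4) (?E a)"
      using t' t s by (intro AE_hausdorff_pre_pos[of t' t s]) auto
  qed
  thus ?thesis
  proof (rule AE_mp, intro AE_I2 impI)
    fix a :: "real^'d^'tau"
    assume a: "\<forall>t\<in>Q. 0 < hausdorff_pre t (1/4) (?E a)"
    have "s_A n T \<le> hausdorff_dim (?E a)"
    proof (rule hausdorff_dim_ge)
      fix t :: real assume "0 < t" "t \<in> \<rat>" "ereal t < s_A n T"
      hence "t \<in> Q" by (simp add: Q_def)
      thus "\<exists>\<delta>. 0 < \<delta> \<and> \<delta> \<le> 1 \<and> 0 < hausdorff_pre t \<delta> (?E a)"
        using a by (intro exI[of _ "1/4"]) auto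
    qed
    thus "hausdorff_dim (?E a) = s_A n T"
      by (intro antisym hausdorff_dim_le_s_A)
  qed
qed

lemma AE_positive_measure:
  assumes "ereal (real CARD('d)) < s_A n T"
  shows "AE a in lborel. 0 < emeasure lebesgue (affine_set n T idx a)"
proof -
  let ?E = "affine_set n T idx"
  obtain s where s: "ereal (real CARD('d)) < ereal s" "ereal s < s_A n T" using ereal_dense2[OF assms] by blast
  hence s': "real CARD('d) < s" by simp
  have "0 \<le> s" using s' by (meson less_imp_le of_nat_0_le_iff order_trans)
  hence "AE a in lborel. 0 < emeasure lborel (?E a)"
    by (intro AE_emeasure_affine_set_pos[OF s'] net_measure_nonzero s(2))
  moreover have "emeasure lebesgue (?E a) = emeasure lborel (?E a)" for a
    by (simp add: borel_closed compact_imp_closed compact_affine_set)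
  ultimately show ?thesis by simp
qed

end

theorem theorem2p7:
  fixes n :: "nat \<Rightarrow> nat"
    and T :: "nat \<Rightarrow> nat \<Rightarrow> real^'d^'d"
    and idx :: "nat list \<Rightarrow> 'tau::finite"
  assumes n_ge_2: "\<And>k. 1 \<le> k \<Longrightarrow> 2 \<le> n k"
    and nonsing: "\<And>k i. 1 \<le> k \<Longrightarrow> 1 \<le> i \<Longrightarrow> i \<le> n k \<Longrightarrow> invertible (T k i)"
    and alpha_bounds: "0 < alpha_minus n T" "alpha_minus n T \<le> alpha_plus n T" "alpha_plus n T < 1"
    and idx_siblings: "separates_siblings n idx"
    and norm_half: "(SUP (k, i) \<in> letter_idx n. ereal (onorm ((*v) (T k i)))) < ereal (1/2)"
  shows "AE a in (lebesgue :: (real^'d^'tau) measure).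
           (s_A n T \<le> ereal (real CARD('d)) \<longrightarrow>
              hausdorff_dim (affine_set n T idx a) = s_A n T) \<and>
           (ereal (real CARD('d)) < s_A n T \<longrightarrow>
              0 < emeasure lebesgue (affine_set n T idx a))"
proof -
  obtain \<eta>0 where \<eta>0: "(SUP (k, i) \<in> letter_idx n. ereal (onorm ((*v) (T k i)))) < ereal \<eta>0" "ereal \<eta>0 < ereal (1/2)"
    using ereal_dense2[OF norm_half] by blast
  \<comment> \<open>The maximum with 1/4 secures positivity and stays below 1/2.\<close>
  define \<eta> where "\<eta> = max \<eta>0 (1/4)"
  interpret affine_system n T idx \<eta>
  proof
    show "1 \<le> n k" if "1 \<le> k" for k using n_ge_2[OF that] by simp
    show "onorm ((*v) (T k i)) \<le> \<eta>" if "1 \<le> k" "1 \<le> i" "i \<le> n k" for k i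
    proof -
      have "(k, i) \<in> letter_idx n" using that by (simp add: letter_idx_def)
      hence "ereal (onorm ((*v) (T k i))) \<le> (SUP (k, i) \<in> letter_idx n. ereal (onorm ((*v) (T k i))))"
        by (intro SUP_upper2[of "(k, i)"]) auto
      also have "\<dots> < ereal \<eta>0" by (rule \<eta>0)
      finally show ?thesis by (simp add: \<eta>_def)
    qed
    show "0 < \<eta>" "\<eta> < 1/2" using \<eta>0(2) by (auto simp: \<eta>_def)
  qed (use nonsing idx_siblings in auto)
  show ?thesis
  proof (rule AE_completion)
    show "AE a in lborel. (s_A n T \<le> ereal (real CARD('d)) \<longrightarrow>
              hausdorff_dim (affine_set n T idx a) = s_A n T) \<and>
           (ereal (real CARD('d)) < s_A n T \<longrightarrow>
              0 < emeasure lebesgue (affine_set n T idx a))"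
    proof (cases "s_A n T \<le> ereal (real CARD('d))")
      case True
      thus ?thesis using AE_dimension[OF True] by (auto simp: not_less)
    next
      case False
      thus ?thesis using AE_positive_measure by (auto simp: not_le)
    qed
  qed
qed

end
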